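(* Let $\overline{\mathrm{Spec}}:\mathbf{HA}^{\mathrm{op}}\to\mathcal K$ be the functor sending a Heyting algebra $A$ to the sheaf $P\mapsto \mathbf{HA}(A,\mathcal UP)$ on $\mathbf{Kp}$. Then $\overline{\mathrm{Spec}}$ factors through the full subcategory $\mathbf{IKp}\hookrightarrow\mathcal K$, and the resulting functor $\overline{\mathrm{Spec}}:\mathbf{HA}^{\mathrm{op}}\to\mathbf{IKp}$ is right adjoint to the functor $\mathcal U:\mathbf{IKp}\to\mathbf{HA}^{\mathrm{op}}$, $X\mapsto\mathcal UX$. Under the equivalence $\mathcal U:\mathbf{IKp}\simeq\mathbf{Pro}(\mathbf{HA}_f)^{\mathrm{op}}$, $\overline{\mathrm{Spec}}$ corresponds to the dual of the profinite completion functor $\widehat{(-)}:\mathbf{HA}\to\mathbf{Pro}(\mathbf{HA}_f)$; i.e. $\mathcal U\,\overline{\mathrm{Spec}}\,A\cong\widehat A$ naturally in $A$, and the counit $A\to\mathcal U(\overline{\mathrm{Spec}}A)$ is the profinite completion map $A\to\widehat A$.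
   Context: $\mathbf{HA}$ is the category of Heyting algebras. $\mathbf{Kp}$ is the category of finite posets and open maps (monotone $f:P\to Q$ such that whenever $f(p)\le q$ there is $p'\ge p$ with $f(p')=q$). For a poset $X$, $\mathcal UX$ is the Heyting algebra of upward closed subsets of $X$; $\mathcal U$ gives a duality between $\mathbf{Kp}$ and finite Heyting algebras. $J$ is the Grothendieck topology on $\mathbf{Kp}$ whose covering sieves are the jointly surjective ones, and $\mathcal K=\mathbf{Sh}(\mathbf{Kp},J)$. $\mathbf{IKp}$ is the category of image finite posets (each ${\uparrow}x$ finite) with open maps, regarded as a full subcategory of $\mathcal K$ via $X\mapsto\mathbf{IKp}(-,X)|_{\mathbf{Kp}}$. $\mathbf{Pro}(\mathbf{HA}_f)$ is the pro-completion of the category of finite Heyting algebras (profinite Heyting algebras); $X\mapsto\mathcal UX$ gives an equivalence $\mathbf{IKp}\simeq\mathbf{Pro}(\mathbf{HA}_f)^{\mathrm{op}}$. The profinite completion $\widehat{(-)}$ is the left adjoint of the forgetful functor $\mathbf{Pro}(\mathbf{HA}_f)\to\mathbf{HA}$. *)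

theory Defs
  imports "HOL-Algebra.Lattice" "HOL-Library.FuncSet"
begin

text \<open>
  Posets and Heyting algebras are \<^typ>\<open>'a gorder\<close> structures on an arbitrary type \<open>'a\<close>.  A type
  plays the role of a universe, and no type is closed under power sets: if \<open>A\<close> lives in \<open>'a\<close>, the
  points of its spectrum live naturally in \<open>'a set\<close> and their up-sets in \<open>'a set set\<close>.  Hom-sets
  are therefore defined between structures on different types, and a universal property carries
  an argument \<open>TYPE(_)\<close> naming the universe of the test objects.  Morphisms are extensional
  functions, so that equality of morphisms is equality in HOL.
\<close>

section \<open>Categories and functors\<close>

record ('o, 'm) cat =
  Obj :: "'o set"
  Arr :: "'o \<Rightarrow> 'o \<Rightarrow> 'm set"
  Ident :: "'o \<Rightarrow> 'm"
  Cmp :: "'o \<Rightarrow> 'o \<Rightarrow> 'o \<Rightarrow> 'm \<Rightarrow> 'm \<Rightarrow> 'm"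
    \<comment> \<open>\<open>Cmp C x y z g f\<close> is \<open>g \<circ> f\<close> for \<open>f : x \<rightarrow> y\<close> and \<open>g : y \<rightarrow> z\<close>\<close>

definition category :: "('o, 'm) cat \<Rightarrow> bool" where
  "category C \<longleftrightarrow>
     (\<forall>x\<in>Obj C. Ident C x \<in> Arr C x x) \<and>
     (\<forall>x\<in>Obj C. \<forall>y\<in>Obj C. \<forall>z\<in>Obj C. \<forall>f\<in>Arr C x y. \<forall>g\<in>Arr C y z. Cmp C x y z g f \<in> Arr C x z) \<and>
     (\<forall>x\<in>Obj C. \<forall>y\<in>Obj C. \<forall>f\<in>Arr C x y.
        Cmp C x x y f (Ident C x) = f \<and> Cmp C x y y (Ident C y) f = f) \<and>
     (\<forall>w\<in>Obj C. \<forall>x\<in>Obj C. \<forall>y\<in>Obj C. \<forall>z\<in>Obj C.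
        \<forall>f\<in>Arr C w x. \<forall>g\<in>Arr C x y. \<forall>h\<in>Arr C y z.
        Cmp C w y z h (Cmp C w x y g f) = Cmp C w x z (Cmp C x y z h g) f)"

definition op_cat :: "('o, 'm) cat \<Rightarrow> ('o, 'm) cat" where
  "op_cat C = \<lparr>Obj = Obj C, Arr = (\<lambda>x y. Arr C y x), Ident = Ident C,
               Cmp = (\<lambda>x y z g f. Cmp C z y x f g)\<rparr>"

record ('o, 'm, 'p, 'n) functr =
  fobj :: "'o \<Rightarrow> 'p"
  fmap :: "'o \<Rightarrow> 'o \<Rightarrow> 'm \<Rightarrow> 'n"

definition is_functor :: "('o, 'm) cat \<Rightarrow> ('p, 'n) cat \<Rightarrow> ('o, 'm, 'p, 'n) functr \<Rightarrow> bool" where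
  "is_functor C D F \<longleftrightarrow>
     (\<forall>x\<in>Obj C. fobj F x \<in> Obj D) \<and>
     (\<forall>x\<in>Obj C. \<forall>y\<in>Obj C. \<forall>f\<in>Arr C x y. fmap F x y f \<in> Arr D (fobj F x) (fobj F y)) \<and>
     (\<forall>x\<in>Obj C. fmap F x x (Ident C x) = Ident D (fobj F x)) \<and>
     (\<forall>x\<in>Obj C. \<forall>y\<in>Obj C. \<forall>z\<in>Obj C. \<forall>f\<in>Arr C x y. \<forall>g\<in>Arr C y z.
        fmap F x z (Cmp C x y z g f) =
        Cmp D (fobj F x) (fobj F y) (fobj F z) (fmap F y z g) (fmap F x y f))"

definition op_functr :: "('o, 'm, 'p, 'n) functr \<Rightarrow> ('o, 'm, 'p, 'n) functr" where
  "op_functr F = \<lparr>fobj = fobj F, fmap = (\<lambda>x y. fmap F y x)\<rparr>"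

definition comp_functr ::
  "('p, 'n, 'q, 'l) functr \<Rightarrow> ('o, 'm, 'p, 'n) functr \<Rightarrow> ('o, 'm, 'q, 'l) functr" where
  "comp_functr G F = \<lparr>fobj = (\<lambda>x. fobj G (fobj F x)),
                      fmap = (\<lambda>x y f. fmap G (fobj F x) (fobj F y) (fmap F x y f))\<rparr>"

definition Set_cat :: "('v set, 'v \<Rightarrow> 'v) cat" where
  "Set_cat = \<lparr>Obj = UNIV, Arr = (\<lambda>X Y. X \<rightarrow>\<^sub>E Y), Ident = (\<lambda>X. \<lambda>x\<in>X. x),
              Cmp = (\<lambda>X Y Z g f. compose X g f)\<rparr>"


section \<open>Heyting algebras\<close>

definition heyting_algebra :: "'a gorder \<Rightarrow> bool" where
  "heyting_algebra A \<longleftrightarrow> bounded_lattice A \<and>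
     (\<forall>a\<in>carrier A. \<forall>b\<in>carrier A. \<exists>c. greatest A c {x \<in> carrier A. a \<sqinter>\<^bsub>A\<^esub> x \<sqsubseteq>\<^bsub>A\<^esub> b})"

definition himp :: "'a gorder \<Rightarrow> 'a \<Rightarrow> 'a \<Rightarrow> 'a" where
  "himp A a b = (SOME c. greatest A c {x \<in> carrier A. a \<sqinter>\<^bsub>A\<^esub> x \<sqsubseteq>\<^bsub>A\<^esub> b})"

definition ha_hom :: "'a gorder \<Rightarrow> 'b gorder \<Rightarrow> ('a \<Rightarrow> 'b) set" where
  "ha_hom A B = {h \<in> carrier A \<rightarrow>\<^sub>E carrier B.
     h \<top>\<^bsub>A\<^esub> = \<top>\<^bsub>B\<^esub> \<and> h \<bottom>\<^bsub>A\<^esub> = \<bottom>\<^bsub>B\<^esub> \<and>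
     (\<forall>a\<in>carrier A. \<forall>b\<in>carrier A.
        h (a \<sqinter>\<^bsub>A\<^esub> b) = h a \<sqinter>\<^bsub>B\<^esub> h b \<and>
        h (a \<squnion>\<^bsub>A\<^esub> b) = h a \<squnion>\<^bsub>B\<^esub> h b \<and>
        h (himp A a b) = himp B (h a) (h b))}"

definition HA_cat :: "('a gorder, 'a \<Rightarrow> 'a) cat" where
  "HA_cat = \<lparr>Obj = {A. heyting_algebra A}, Arr = ha_hom, Ident = (\<lambda>A. \<lambda>a\<in>carrier A. a),
             Cmp = (\<lambda>A B C g f. compose (carrier A) g f)\<rparr>"

definition HAf_cat :: "('a gorder, 'a \<Rightarrow> 'a) cat" where
  "HAf_cat = HA_cat\<lparr>Obj := {A. heyting_algebra A \<and> finite (carrier A)}\<rparr>"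


section \<open>Posets, open maps and up-sets\<close>

definition open_maps :: "'x gorder \<Rightarrow> 'y gorder \<Rightarrow> ('x \<Rightarrow> 'y) set" where
  "open_maps P Q = {f \<in> carrier P \<rightarrow>\<^sub>E carrier Q.
     (\<forall>p\<in>carrier P. \<forall>p'\<in>carrier P. p \<sqsubseteq>\<^bsub>P\<^esub> p' \<longrightarrow> f p \<sqsubseteq>\<^bsub>Q\<^esub> f p') \<and>
     (\<forall>p\<in>carrier P. \<forall>q\<in>carrier Q. f p \<sqsubseteq>\<^bsub>Q\<^esub> q \<longrightarrow> (\<exists>p'\<in>carrier P. p \<sqsubseteq>\<^bsub>P\<^esub> p' \<and> f p' = q))}"

definition image_finite :: "'x gorder \<Rightarrow> bool" where
  "image_finite X \<longleftrightarrow> (\<forall>x\<in>carrier X. finite {y \<in> carrier X. x \<sqsubseteq>\<^bsub>X\<^esub> y})"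

definition IKp_cat :: "('x gorder, 'x \<Rightarrow> 'x) cat" where
  "IKp_cat = \<lparr>Obj = {X. partial_order X \<and> image_finite X}, Arr = open_maps,
              Ident = (\<lambda>X. \<lambda>x\<in>carrier X. x), Cmp = (\<lambda>X Y Z g f. compose (carrier X) g f)\<rparr>"

text \<open>Every finite poset is isomorphic to one with carrier in \<^typ>\<open>nat\<close>, which makes the site small.\<close>

definition Kp_cat :: "(nat gorder, nat \<Rightarrow> nat) cat" where
  "Kp_cat = IKp_cat\<lparr>Obj := {P. partial_order P \<and> finite (carrier P)}\<rparr>"

definition upsets :: "'x gorder \<Rightarrow> 'x set set" where
  "upsets X = {V. V \<subseteq> carrier X \<and> (\<forall>x\<in>V. \<forall>y\<in>carrier X. x \<sqsubseteq>\<^bsub>X\<^esub> y \<longrightarrow> y \<in> V)}"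

definition UU :: "'x gorder \<Rightarrow> 'x set gorder" where
  "UU X = \<lparr>carrier = upsets X, eq = (=), le = (\<subseteq>)\<rparr>"

definition UU_map :: "'x gorder \<Rightarrow> 'y gorder \<Rightarrow> ('x \<Rightarrow> 'y) \<Rightarrow> 'y set \<Rightarrow> 'x set" where
  "UU_map X Y f = (\<lambda>V\<in>carrier (UU Y). {x \<in> carrier X. f x \<in> V})"

definition U_functor :: "('x gorder, 'x \<Rightarrow> 'x, 'x set gorder, 'x set \<Rightarrow> 'x set) functr"
    \<comment> \<open>\<open>IKp \<rightarrow> HA\<^sup>o\<^sup>p\<close>\<close>
  where "U_functor = \<lparr>fobj = UU, fmap = UU_map\<rparr>"


section \<open>Sheaves on finite posets\<close>

type_synonym 'v psh = "(nat gorder, nat \<Rightarrow> nat, 'v set, 'v \<Rightarrow> 'v) functr"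

definition sieve :: "nat gorder \<Rightarrow> (nat gorder \<times> (nat \<Rightarrow> nat)) set \<Rightarrow> bool" where
  "sieve P R \<longleftrightarrow>
     (\<forall>(Q, f)\<in>R. Q \<in> Obj Kp_cat \<and> f \<in> Arr Kp_cat Q P) \<and>
     (\<forall>(Q, f)\<in>R. \<forall>Q'\<in>Obj Kp_cat. \<forall>g\<in>Arr Kp_cat Q' Q. (Q', Cmp Kp_cat Q' Q P f g) \<in> R)"

definition covering_sieve :: "nat gorder \<Rightarrow> (nat gorder \<times> (nat \<Rightarrow> nat)) set \<Rightarrow> bool" where
  "covering_sieve P R \<longleftrightarrow> sieve P R \<and> (\<Union>(Q, f)\<in>R. f ` carrier Q) = carrier P"

definition matching_family ::
  "'v psh \<Rightarrow> nat gorder \<Rightarrow> (nat gorder \<times> (nat \<Rightarrow> nat)) set \<Rightarrow> (nat gorder \<Rightarrow> (nat \<Rightarrow> nat) \<Rightarrow> 'v) \<Rightarrow> bool"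
  where
  "matching_family F P R s \<longleftrightarrow>
     (\<forall>(Q, f)\<in>R. s Q f \<in> fobj F Q) \<and>
     (\<forall>(Q, f)\<in>R. \<forall>Q'\<in>Obj Kp_cat. \<forall>g\<in>Arr Kp_cat Q' Q.
        s Q' (Cmp Kp_cat Q' Q P f g) = fmap F Q Q' g (s Q f))"

definition is_sheaf :: "'v psh \<Rightarrow> bool" where
  "is_sheaf F \<longleftrightarrow> is_functor (op_cat Kp_cat) Set_cat F \<and>
     (\<forall>P\<in>Obj Kp_cat. \<forall>R s. covering_sieve P R \<and> matching_family F P R s \<longrightarrow>
        (\<exists>!t. t \<in> fobj F P \<and> (\<forall>(Q, f)\<in>R. fmap F P Q f t = s Q f)))"

definition psh_hom :: "'v psh \<Rightarrow> 'w psh \<Rightarrow> (nat gorder \<Rightarrow> 'v \<Rightarrow> 'w) set" where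
  "psh_hom F G = {\<eta> \<in> (\<Pi>\<^sub>E P\<in>Obj Kp_cat. fobj F P \<rightarrow>\<^sub>E fobj G P).
     \<forall>P\<in>Obj Kp_cat. \<forall>Q\<in>Obj Kp_cat. \<forall>f\<in>Arr Kp_cat Q P. \<forall>x\<in>fobj F P.
       \<eta> Q (fmap F P Q f x) = fmap G P Q f (\<eta> P x)}"

definition psh_iso :: "'v psh \<Rightarrow> 'w psh \<Rightarrow> (nat gorder \<Rightarrow> 'v \<Rightarrow> 'w) \<Rightarrow> bool" where
  "psh_iso F G \<eta> \<longleftrightarrow> \<eta> \<in> psh_hom F G \<and> (\<forall>P\<in>Obj Kp_cat. bij_betw (\<eta> P) (fobj F P) (fobj G P))"

definition Sh_cat :: "('v psh, nat gorder \<Rightarrow> 'v \<Rightarrow> 'v) cat" where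
  "Sh_cat = \<lparr>Obj = {F. is_sheaf F}, Arr = psh_hom,
             Ident = (\<lambda>F. \<lambda>P\<in>Obj Kp_cat. \<lambda>x\<in>fobj F P. x),
             Cmp = (\<lambda>F G H \<theta> \<eta>. \<lambda>P\<in>Obj Kp_cat. compose (fobj F P) (\<theta> P) (\<eta> P))\<rparr>"

definition Spec_bar ::
  "('a gorder, 'a \<Rightarrow> 'a, ('a \<Rightarrow> nat set) psh, nat gorder \<Rightarrow> ('a \<Rightarrow> nat set) \<Rightarrow> ('a \<Rightarrow> nat set)) functr"
    \<comment> \<open>\<open>HA\<^sup>o\<^sup>p \<rightarrow> Sh(Kp, J)\<close>\<close>
  where
  "Spec_bar = \<lparr>
     fobj = (\<lambda>A. \<lparr>fobj = (\<lambda>P. ha_hom A (UU P)),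
                  fmap = (\<lambda>P Q f. \<lambda>g\<in>ha_hom A (UU P). compose (carrier A) (UU_map Q P f) g)\<rparr>),
     fmap = (\<lambda>B A h. \<lambda>P\<in>Obj Kp_cat. \<lambda>g\<in>ha_hom B (UU P). compose (carrier A) g h)\<rparr>"

definition IKp_embedding ::
  "('x gorder, 'x \<Rightarrow> 'x, (nat \<Rightarrow> 'x) psh, nat gorder \<Rightarrow> (nat \<Rightarrow> 'x) \<Rightarrow> (nat \<Rightarrow> 'x)) functr"
    \<comment> \<open>\<open>IKp \<rightarrow> Sh(Kp, J)\<close>, \<open>X \<mapsto> IKp(-, X)\<close> restricted to \<open>Kp\<close>\<close>
  where
  "IKp_embedding = \<lparr>
     fobj = (\<lambda>X. \<lparr>fobj = (\<lambda>P. open_maps P X),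
                  fmap = (\<lambda>P Q f. \<lambda>g\<in>open_maps P X. compose (carrier Q) g f)\<rparr>),
     fmap = (\<lambda>X Y k. \<lambda>P\<in>Obj Kp_cat. \<lambda>g\<in>open_maps P X. compose (carrier P) k g)\<rparr>"

text \<open>
  A factorization of \<open>Spec_bar\<close> through \<open>IKp\<close>: a functor \<open>S : HA\<^sup>o\<^sup>p \<rightarrow> IKp\<close> and an isomorphism
  \<open>\<alpha>\<close> from \<open>Spec_bar\<close> to \<open>IKp_embedding \<circ> S\<close>, natural in the algebra and in the finite poset.
\<close>

definition IKp_factorization ::
  "('a gorder, 'a \<Rightarrow> 'a, 's gorder, 's \<Rightarrow> 's) functr \<Rightarrow>
   ('a gorder \<Rightarrow> nat gorder \<Rightarrow> ('a \<Rightarrow> nat set) \<Rightarrow> nat \<Rightarrow> 's) \<Rightarrow> bool" where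
  "IKp_factorization S \<alpha> \<longleftrightarrow>
     is_functor (op_cat HA_cat) IKp_cat S \<and>
     (\<forall>A\<in>Obj HA_cat. psh_iso (fobj Spec_bar A) (fobj IKp_embedding (fobj S A)) (\<alpha> A)) \<and>
     (\<forall>A\<in>Obj HA_cat. \<forall>B\<in>Obj HA_cat. \<forall>h\<in>ha_hom A B.
        \<forall>P\<in>Obj Kp_cat. \<forall>g\<in>fobj (fobj Spec_bar B) P.
          \<alpha> A P (fmap Spec_bar B A h P g) =
          fmap IKp_embedding (fobj S B) (fobj S A) (fmap S B A h) P (\<alpha> B P g))"

text \<open>
  \<open>S : HA\<^sup>o\<^sup>p \<rightarrow> IKp\<close> is right adjoint to \<open>U : IKp \<rightarrow> HA\<^sup>o\<^sup>p\<close> with counit \<open>\<epsilon>\<close>.  The component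
  \<open>U (S A) \<rightarrow> A\<close> of the counit in \<open>HA\<^sup>o\<^sup>p\<close> is a homomorphism \<open>A \<rightarrow> U (S A)\<close>.
\<close>

definition right_adjoint_to_U ::
  "('a gorder, 'a \<Rightarrow> 'a, 's gorder, 's \<Rightarrow> 's) functr \<Rightarrow> ('a gorder \<Rightarrow> 'a \<Rightarrow> 's set) \<Rightarrow>
   'x gorder itself \<Rightarrow> bool" where
  "right_adjoint_to_U S \<epsilon> (T :: 'x gorder itself) \<longleftrightarrow>
     is_functor (op_cat HA_cat) IKp_cat S \<and>
     is_functor IKp_cat (op_cat HA_cat)
       (U_functor :: ('x gorder, 'x \<Rightarrow> 'x, 'x set gorder, 'x set \<Rightarrow> 'x set) functr) \<and>
     (\<forall>A\<in>Obj HA_cat. \<epsilon> A \<in> ha_hom A (UU (fobj S A))) \<and>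
     (\<forall>A\<in>Obj HA_cat. \<forall>B\<in>Obj HA_cat. \<forall>h\<in>ha_hom A B.
        compose (carrier A) (\<epsilon> B) h =
        compose (carrier A) (UU_map (fobj S B) (fobj S A) (fmap S B A h)) (\<epsilon> A)) \<and>
     (\<forall>A\<in>Obj HA_cat. \<forall>X\<in>(Obj IKp_cat :: 'x gorder set).
        bij_betw (\<lambda>f. compose (carrier A) (UU_map X (fobj S A) f) (\<epsilon> A))
          (open_maps X (fobj S A)) (ha_hom A (UU X)))"


section \<open>The pro-completion of finite Heyting algebras\<close>

definition cofiltered :: "('i, 'm) cat \<Rightarrow> bool" where
  "cofiltered I \<longleftrightarrow> category I \<and> Obj I \<noteq> {} \<and>
     (\<forall>i\<in>Obj I. \<forall>j\<in>Obj I. \<exists>k\<in>Obj I. Arr I k i \<noteq> {} \<and> Arr I k j \<noteq> {}) \<and>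
     (\<forall>i\<in>Obj I. \<forall>j\<in>Obj I. \<forall>u\<in>Arr I i j. \<forall>v\<in>Arr I i j.
        \<exists>k\<in>Obj I. \<exists>w\<in>Arr I k i. Cmp I k i j u w = Cmp I k i j v w)"

record ('i, 'm, 'h) pro =
  idx :: "('i, 'm) cat"
  dia :: "('i, 'm, 'h gorder, 'h \<Rightarrow> 'h) functr"

abbreviation pob :: "('i, 'm, 'h) pro \<Rightarrow> 'i \<Rightarrow> 'h gorder" where
  "pob X i \<equiv> fobj (dia X) i"

definition pro_object :: "('i, 'm, 'h) pro \<Rightarrow> bool" where
  "pro_object X \<longleftrightarrow> cofiltered (idx X) \<and> is_functor (idx X) HAf_cat (dia X)"

text \<open>
  Hom-sets are \<open>lim\<^sub>j colim\<^sub>i HA(X\<^sub>i, Y\<^sub>j)\<close>.  An element of the inner colimit is an equivalence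
  class of pairs \<open>(i, f)\<close> with \<open>f : X\<^sub>i \<rightarrow> Y\<^sub>j\<close>.
\<close>

definition pro_rel ::
  "('i, 'm, 'h) pro \<Rightarrow> 'k gorder \<Rightarrow> (('i \<times> ('h \<Rightarrow> 'k)) \<times> ('i \<times> ('h \<Rightarrow> 'k))) set" where
  "pro_rel X B = {((i, f), (i', f')).
     i \<in> Obj (idx X) \<and> f \<in> ha_hom (pob X i) B \<and> i' \<in> Obj (idx X) \<and> f' \<in> ha_hom (pob X i') B \<and>
     (\<exists>k\<in>Obj (idx X). \<exists>u\<in>Arr (idx X) k i. \<exists>u'\<in>Arr (idx X) k i'.
        compose (carrier (pob X k)) f (fmap (dia X) k i u) =
        compose (carrier (pob X k)) f' (fmap (dia X) k i' u'))}"

definition pro_colim :: "('i, 'm, 'h) pro \<Rightarrow> 'k gorder \<Rightarrow> ('i \<times> ('h \<Rightarrow> 'k)) set set" where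
  "pro_colim X B = (SIGMA i : Obj (idx X). ha_hom (pob X i) B) // pro_rel X B"

definition pro_hom ::
  "('i, 'm, 'h) pro \<Rightarrow> ('j, 'n, 'k) pro \<Rightarrow> ('j \<Rightarrow> ('i \<times> ('h \<Rightarrow> 'k)) set) set" where
  "pro_hom X Y = {\<phi> \<in> (\<Pi>\<^sub>E j\<in>Obj (idx Y). pro_colim X (pob Y j)).
     \<forall>j\<in>Obj (idx Y). \<forall>j'\<in>Obj (idx Y). \<forall>v\<in>Arr (idx Y) j j'. \<forall>(i, f)\<in>\<phi> j.
       (i, compose (carrier (pob X i)) (fmap (dia Y) j j' v) f) \<in> \<phi> j'}"

definition pro_id :: "('i, 'm, 'h) pro \<Rightarrow> 'i \<Rightarrow> ('i \<times> ('h \<Rightarrow> 'h)) set" where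
  "pro_id X = (\<lambda>i\<in>Obj (idx X). pro_rel X (pob X i) `` {(i, \<lambda>a\<in>carrier (pob X i). a)})"

definition pro_comp ::
  "('i, 'm, 'h) pro \<Rightarrow> ('j, 'n, 'k) pro \<Rightarrow> ('q, 'l, 'r) pro \<Rightarrow>
   ('q \<Rightarrow> ('j \<times> ('k \<Rightarrow> 'r)) set) \<Rightarrow> ('j \<Rightarrow> ('i \<times> ('h \<Rightarrow> 'k)) set) \<Rightarrow> 'q \<Rightarrow> ('i \<times> ('h \<Rightarrow> 'r)) set"
  where
  "pro_comp X Y Z \<psi> \<phi> = (\<lambda>q\<in>Obj (idx Z). \<Union>(j, g)\<in>\<psi> q. \<Union>(i, f)\<in>\<phi> j.
     pro_rel X (pob Z q) `` {(i, compose (carrier (pob X i)) g f)})"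

definition Pro_cat :: "(('i, 'm, 'h) pro, 'i \<Rightarrow> ('i \<times> ('h \<Rightarrow> 'h)) set) cat" where
  "Pro_cat = \<lparr>Obj = {X. pro_object X}, Arr = pro_hom, Ident = pro_id, Cmp = pro_comp\<rparr>"

definition pro_iso ::
  "('i, 'm, 'h) pro \<Rightarrow> ('j, 'n, 'k) pro \<Rightarrow> ('j \<Rightarrow> ('i \<times> ('h \<Rightarrow> 'k)) set) \<Rightarrow> bool" where
  "pro_iso X Y \<phi> \<longleftrightarrow> \<phi> \<in> pro_hom X Y \<and>
     (\<exists>\<psi>\<in>pro_hom Y X. pro_comp X Y X \<psi> \<phi> = pro_id X \<and> pro_comp Y X Y \<phi> \<psi> = pro_id Y)"

text \<open>The forgetful functor \<open>Pro(HA\<^sub>f) \<rightarrow> HA\<close> takes the limit of a diagram in \<open>HA\<close>.\<close>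

definition pro_lim :: "('i, 'm, 'h) pro \<Rightarrow> ('i \<Rightarrow> 'h) gorder" where
  "pro_lim X = \<lparr>
     carrier = {x \<in> (\<Pi>\<^sub>E i\<in>Obj (idx X). carrier (pob X i)).
       \<forall>i\<in>Obj (idx X). \<forall>j\<in>Obj (idx X). \<forall>u\<in>Arr (idx X) i j. fmap (dia X) i j u (x i) = x j},
     eq = (=),
     le = (\<lambda>x y. \<forall>i\<in>Obj (idx X). x i \<sqsubseteq>\<^bsub>pob X i\<^esub> y i)\<rparr>"

definition pro_lim_map ::
  "('i, 'm, 'h) pro \<Rightarrow> ('j, 'n, 'k) pro \<Rightarrow> ('j \<Rightarrow> ('i \<times> ('h \<Rightarrow> 'k)) set) \<Rightarrow> ('i \<Rightarrow> 'h) \<Rightarrow> 'j \<Rightarrow> 'k"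
  where
  "pro_lim_map X Y \<phi> =
     (\<lambda>x\<in>carrier (pro_lim X). \<lambda>j\<in>Obj (idx Y). THE y. \<exists>(i, f)\<in>\<phi> j. y = f (x i))"

definition forget_functor ::
  "(('i, 'm, 'h) pro, 'i \<Rightarrow> ('i \<times> ('h \<Rightarrow> 'h)) set, ('i \<Rightarrow> 'h) gorder, ('i \<Rightarrow> 'h) \<Rightarrow> ('i \<Rightarrow> 'h)) functr"
  where "forget_functor = \<lparr>fobj = pro_lim, fmap = pro_lim_map\<rparr>"

text \<open>
  \<open>(L, \<eta>)\<close> is a left adjoint \<open>HA \<rightarrow> Pro(HA\<^sub>f)\<close> of the forgetful functor with unit \<open>\<eta>\<close>, that is, a
  profinite completion functor with completion maps \<open>\<eta> A : A \<rightarrow> |L A|\<close>.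
\<close>

definition profinite_completion ::
  "('a gorder, 'a \<Rightarrow> 'a, ('i, 'm, 'h) pro, 'i \<Rightarrow> ('i \<times> ('h \<Rightarrow> 'h)) set) functr \<Rightarrow>
   ('a gorder \<Rightarrow> 'a \<Rightarrow> 'i \<Rightarrow> 'h) \<Rightarrow> ('j, 'n, 'k) pro itself \<Rightarrow> bool" where
  "profinite_completion L \<eta> (T :: ('j, 'n, 'k) pro itself) \<longleftrightarrow>
     is_functor HA_cat Pro_cat L \<and>
     is_functor Pro_cat HA_cat
       (forget_functor :: (('j, 'n, 'k) pro, 'j \<Rightarrow> ('j \<times> ('k \<Rightarrow> 'k)) set,
                           ('j \<Rightarrow> 'k) gorder, ('j \<Rightarrow> 'k) \<Rightarrow> ('j \<Rightarrow> 'k)) functr) \<and>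
     (\<forall>A\<in>Obj HA_cat. \<eta> A \<in> ha_hom A (pro_lim (fobj L A))) \<and>
     (\<forall>A\<in>Obj HA_cat. \<forall>B\<in>Obj HA_cat. \<forall>h\<in>ha_hom A B.
        compose (carrier A) (\<eta> B) h =
        compose (carrier A) (pro_lim_map (fobj L A) (fobj L B) (fmap L A B h)) (\<eta> A)) \<and>
     (\<forall>A\<in>Obj HA_cat. \<forall>Y\<in>(Obj Pro_cat :: ('j, 'n, 'k) pro set).
        bij_betw (\<lambda>\<phi>. compose (carrier A) (pro_lim_map (fobj L A) Y \<phi>) (\<eta> A))
          (pro_hom (fobj L A) Y) (ha_hom A (pro_lim Y)))"

definition pro_nat_iso ::
  "('a gorder, 'a \<Rightarrow> 'a, ('i, 'm, 'h) pro, 'i \<Rightarrow> ('i \<times> ('h \<Rightarrow> 'h)) set) functr \<Rightarrow>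
   ('a gorder, 'a \<Rightarrow> 'a, ('j, 'n, 'k) pro, 'j \<Rightarrow> ('j \<times> ('k \<Rightarrow> 'k)) set) functr \<Rightarrow>
   ('a gorder \<Rightarrow> 'j \<Rightarrow> ('i \<times> ('h \<Rightarrow> 'k)) set) \<Rightarrow> bool" where
  "pro_nat_iso L M \<theta> \<longleftrightarrow>
     (\<forall>A\<in>Obj HA_cat. pro_iso (fobj L A) (fobj M A) (\<theta> A)) \<and>
     (\<forall>A\<in>Obj HA_cat. \<forall>B\<in>Obj HA_cat. \<forall>h\<in>ha_hom A B.
        pro_comp (fobj L A) (fobj L B) (fobj M B) (\<theta> B) (fmap L A B h) =
        pro_comp (fobj L A) (fobj M A) (fobj M B) (fmap M A B h) (\<theta> A))"

text \<open>
  The equivalence \<open>U : IKp \<rightarrow> Pro(HA\<^sub>f)\<^sup>o\<^sup>p\<close>.  An image finite poset \<open>X\<close> is the directed union of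
  its finite up-sets \<open>F\<close>, and \<open>U X\<close> as a profinite algebra is the cofiltered diagram of the
  finite algebras \<open>U F\<close> with restriction maps; \<open>U_pro_lim_iso\<close> identifies the algebra of
  up-sets \<open>UU X\<close> with its limit.
\<close>

definition fin_upsets :: "'x gorder \<Rightarrow> 'x set set" where
  "fin_upsets X = {F \<in> upsets X. finite F}"

definition U_pro_obj :: "'x gorder \<Rightarrow> ('x set, unit, 'x set) pro" where
  "U_pro_obj X = \<lparr>
     idx = \<lparr>Obj = fin_upsets X, Arr = (\<lambda>F G. if G \<subseteq> F then {()} else {}),
            Ident = (\<lambda>_. ()), Cmp = (\<lambda>_ _ _ _ _. ())\<rparr>,
     dia = \<lparr>fobj = (\<lambda>F. UU (X\<lparr>carrier := F\<rparr>)),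
            fmap = (\<lambda>F G _. \<lambda>V\<in>carrier (UU (X\<lparr>carrier := F\<rparr>)). V \<inter> G)\<rparr>\<rparr>"

definition U_pro_map ::
  "'x gorder \<Rightarrow> 'y gorder \<Rightarrow> ('x \<Rightarrow> 'y) \<Rightarrow> 'x set \<Rightarrow> ('y set \<times> ('y set \<Rightarrow> 'x set)) set" where
  "U_pro_map X Y f = (\<lambda>F\<in>fin_upsets X.
     pro_rel (U_pro_obj Y) (UU (X\<lparr>carrier := F\<rparr>)) ``
       {(f ` F, UU_map (X\<lparr>carrier := F\<rparr>) (Y\<lparr>carrier := f ` F\<rparr>) f)})"

definition U_pro_functor ::
  "('x gorder, 'x \<Rightarrow> 'x, ('x set, unit, 'x set) pro, 'x set \<Rightarrow> ('x set \<times> ('x set \<Rightarrow> 'x set)) set) functr"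
  where "U_pro_functor = \<lparr>fobj = U_pro_obj, fmap = U_pro_map\<rparr>"

definition U_pro_lim_iso :: "'x gorder \<Rightarrow> 'x set \<Rightarrow> 'x set \<Rightarrow> 'x set" where
  "U_pro_lim_iso X = (\<lambda>V\<in>carrier (UU X). \<lambda>F\<in>fin_upsets X. V \<inter> F)"

end

theory Submission
  imports Defs
begin

text \<open>
  A homomorphism \<open>g : A \<rightarrow> U P\<close> assigns to each \<open>p\<close> the prime filter \<open>{a. p \<in> g a}\<close>.  Let \<open>Spec A\<close> be
  the set of the prime filters that arise in this way from finite \<open>P\<close>, ordered by inclusion.  Since
  \<open>P\<close> is finite, the map \<open>P \<rightarrow> Spec A\<close> given by \<open>g\<close> is open; hence \<open>Spec A\<close> is image finite, and
  homomorphisms \<open>A \<rightarrow> U X\<close> correspond to open maps \<open>X \<rightarrow> Spec A\<close> for every image finite \<open>X\<close>.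

  Pullbacks of open maps between finite posets allow a compatible family of open maps out of finite
  posets to be glued.  Gluing over a finite poset shows that \<open>IKp(-, X)\<close> is a sheaf, and so is the
  isomorphic presheaf \<open>HA(A, U -)\<close>.  Gluing over an image finite poset shows that \<open>IKp\<close> embeds fully
  faithfully in the sheaves, so every factorization of \<open>Spec_bar\<close> is isomorphic to \<open>Spec\<close>.

  For a finite up-set \<open>F\<close> of \<open>Spec A\<close> the restriction \<open>A \<rightarrow> U F\<close> is surjective, and every homomorphism
  from \<open>A\<close> to a finite algebra factors through one of these restrictions.  So the diagram of the
  algebras \<open>U F\<close> pro-represents the homomorphisms from \<open>A\<close> to finite algebras, which is the universal
  property of the profinite completion.
\<close>

section \<open>Posets and Heyting algebras\<close>

lemma partial_orderI:
  fixes L :: "'a gorder" (structure)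
  assumes "eq L = (=)"
    and "\<And>x. x \<in> carrier L \<Longrightarrow> x \<sqsubseteq> x"
    and "\<And>x y. x \<in> carrier L \<Longrightarrow> y \<in> carrier L \<Longrightarrow> x \<sqsubseteq> y \<Longrightarrow> y \<sqsubseteq> x \<Longrightarrow> x = y"
    and "\<And>x y z. x \<in> carrier L \<Longrightarrow> y \<in> carrier L \<Longrightarrow> z \<in> carrier L \<Longrightarrow>
      x \<sqsubseteq> y \<Longrightarrow> y \<sqsubseteq> z \<Longrightarrow> x \<sqsubseteq> z"
  shows "partial_order L"
  by unfold_locales (unfold assms(1), (blast intro: assms(2-))+)

lemma partial_order_subset:
  "partial_order L \<Longrightarrow> S \<subseteq> carrier L \<Longrightarrow> partial_order (L\<lparr>carrier := S\<rparr>)"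
  by (simp add: partial_order_def partial_order_axioms_def weak_partial_order_subset)

definition induced_poset :: "'p set \<Rightarrow> ('p \<Rightarrow> 'x) \<Rightarrow> 'x gorder \<Rightarrow> 'p gorder" where
  "induced_poset S d X = \<lparr>carrier = S, eq = (=), le = (\<lambda>p q. d p \<sqsubseteq>\<^bsub>X\<^esub> d q)\<rparr>"

lemma induced_poset_simps [simp]:
  "carrier (induced_poset S d X) = S" "eq (induced_poset S d X) = (=)"
  "p \<sqsubseteq>\<^bsub>induced_poset S d X\<^esub> q \<longleftrightarrow> d p \<sqsubseteq>\<^bsub>X\<^esub> d q"
  by (simp_all add: induced_poset_def)

lemma partial_order_induced:
  assumes "partial_order X" "inj_on d S" "d ` S \<subseteq> carrier X"
  shows "partial_order (induced_poset S d X)"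
proof -
  interpret partial_order X by fact
  have dX: "d p \<in> carrier X" if "p \<in> S" for p using that assms(3) by blast
  then have "p = q" if "p \<in> S" "q \<in> S" "d p \<sqsubseteq>\<^bsub>X\<^esub> d q" "d q \<sqsubseteq>\<^bsub>X\<^esub> d p" for p q
    using that le_antisym inj_onD[OF assms(2)] by blast
  with dX show ?thesis by (intro partial_orderI) (auto intro: le_trans)
qed

locale heyting_operations = partial_order L for L :: "'a gorder" (structure) +
  fixes one zero and conj disj impl
  assumes one: "one \<in> carrier L" "\<And>x. x \<in> carrier L \<Longrightarrow> x \<sqsubseteq> one"
    and zero: "zero \<in> carrier L" "\<And>x. x \<in> carrier L \<Longrightarrow> zero \<sqsubseteq> x"
    and conj: "\<And>x y. x \<in> carrier L \<Longrightarrow> y \<in> carrier L \<Longrightarrow> conj x y \<in> carrier L"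
      "\<And>x y z. x \<in> carrier L \<Longrightarrow> y \<in> carrier L \<Longrightarrow> z \<in> carrier L \<Longrightarrow>
        z \<sqsubseteq> conj x y \<longleftrightarrow> z \<sqsubseteq> x \<and> z \<sqsubseteq> y"
    and disj: "\<And>x y. x \<in> carrier L \<Longrightarrow> y \<in> carrier L \<Longrightarrow> disj x y \<in> carrier L"
      "\<And>x y z. x \<in> carrier L \<Longrightarrow> y \<in> carrier L \<Longrightarrow> z \<in> carrier L \<Longrightarrow>
        disj x y \<sqsubseteq> z \<longleftrightarrow> x \<sqsubseteq> z \<and> y \<sqsubseteq> z"
    and impl: "\<And>x y. x \<in> carrier L \<Longrightarrow> y \<in> carrier L \<Longrightarrow> impl x y \<in> carrier L"
      "\<And>x y z. x \<in> carrier L \<Longrightarrow> y \<in> carrier L \<Longrightarrow> z \<in> carrier L \<Longrightarrow>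
        z \<sqsubseteq> impl x y \<longleftrightarrow> conj x z \<sqsubseteq> y"
begin

lemma greatest_conj:
  "x \<in> carrier L \<Longrightarrow> y \<in> carrier L \<Longrightarrow> greatest L (conj x y) (Lower L {x, y})"
  using conj(2)[of x y "conj x y"] by (auto simp: greatest_def Lower_def conj)

lemma least_disj:
  "x \<in> carrier L \<Longrightarrow> y \<in> carrier L \<Longrightarrow> least L (disj x y) (Upper L {x, y})"
  using disj(2)[of x y "disj x y"] by (auto simp: least_def Upper_def disj)

sublocale bounded_lattice L
proof
  show "\<exists>s. least L s (Upper L {x, y})" "\<exists>s. greatest L s (Lower L {x, y})"
    if "x \<in> carrier L" "y \<in> carrier L" for x y
    using that least_disj greatest_conj by blast+
  show "\<exists>x. least L x (carrier L)" "\<exists>x. greatest L x (carrier L)"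
    using zero one by (auto simp: least_def greatest_def)
qed

lemma top_eq_one: "\<top> = one"
  using one by (rule top_eq[symmetric])

lemma bottom_eq_zero: "\<bottom> = zero"
  using zero by (rule bottom_eq[symmetric])

lemma meet_eq_conj: "x \<in> carrier L \<Longrightarrow> y \<in> carrier L \<Longrightarrow> x \<sqinter> y = conj x y"
  by (rule meetI) (blast intro: greatest_unique greatest_conj)+

lemma join_eq_disj: "x \<in> carrier L \<Longrightarrow> y \<in> carrier L \<Longrightarrow> x \<squnion> y = disj x y"
  by (rule joinI) (blast intro: least_unique least_disj)+

lemma greatest_impl:
  "x \<in> carrier L \<Longrightarrow> y \<in> carrier L \<Longrightarrow> greatest L (impl x y) {z \<in> carrier L. x \<sqinter> z \<sqsubseteq> y}"
  using impl(2)[of x y "impl x y"] by (auto simp: greatest_def meet_eq_conj impl)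

lemma himp_eq_impl: "x \<in> carrier L \<Longrightarrow> y \<in> carrier L \<Longrightarrow> himp L x y = impl x y"
  unfolding himp_def by (rule some_equality) (blast intro: greatest_unique greatest_impl)+

lemma heyting_algebra: "heyting_algebra L"
  unfolding heyting_algebra_def using greatest_impl bounded_lattice_axioms by blast

end

locale heyting =
  fixes A :: "'a gorder" (structure)
  assumes heyting_algebra: "heyting_algebra A"

sublocale heyting \<subseteq> bounded_lattice A
  using heyting_algebra by (simp add: heyting_algebra_def)

context heyting
begin

lemma le_meet_iff:
  "a \<in> carrier A \<Longrightarrow> b \<in> carrier A \<Longrightarrow> c \<in> carrier A \<Longrightarrow> c \<sqsubseteq> a \<sqinter> b \<longleftrightarrow> c \<sqsubseteq> a \<and> c \<sqsubseteq> b"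
  by (meson le_trans meet_closed meet_le meet_left meet_right)

lemma join_le_iff:
  "a \<in> carrier A \<Longrightarrow> b \<in> carrier A \<Longrightarrow> c \<in> carrier A \<Longrightarrow> a \<squnion> b \<sqsubseteq> c \<longleftrightarrow> a \<sqsubseteq> c \<and> b \<sqsubseteq> c"
  by (meson le_trans join_closed join_le join_left join_right)

lemma greatest_himp:
  "a \<in> carrier A \<Longrightarrow> b \<in> carrier A \<Longrightarrow> greatest A (himp A a b) {x \<in> carrier A. a \<sqinter> x \<sqsubseteq> b}"
  unfolding himp_def using heyting_algebra by (auto simp: heyting_algebra_def intro: someI_ex)

lemma himp_closed [simp]: "a \<in> carrier A \<Longrightarrow> b \<in> carrier A \<Longrightarrow> himp A a b \<in> carrier A"
  using greatest_himp by (auto simp: greatest_def)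

lemma le_himp_iff:
  assumes "a \<in> carrier A" "b \<in> carrier A" "c \<in> carrier A"
  shows "c \<sqsubseteq> himp A a b \<longleftrightarrow> a \<sqinter> c \<sqsubseteq> b"
proof
  note greatest = greatest_himp[OF assms(1,2)]
  assume "c \<sqsubseteq> himp A a b"
  then have "a \<sqinter> c \<sqsubseteq> a \<sqinter> himp A a b"
    using assms meet_left[of a c] le_trans[OF meet_right, of a c "himp A a b"]
    by (simp add: le_meet_iff)
  also have "\<dots> \<sqsubseteq> b" using greatest by (simp add: greatest_def)
  finally show "a \<sqinter> c \<sqsubseteq> b" using assms by simp
next
  assume "a \<sqinter> c \<sqsubseteq> b"
  then show "c \<sqsubseteq> himp A a b"
    using greatest_himp[OF assms(1,2)] assms(3) by (auto simp: greatest_def)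
qed

end

lemma heyting_partial_order: "heyting_algebra A \<Longrightarrow> partial_order A"
  by (simp add: heyting_algebra_def bounded_lattice_def lattice_def upper_semilattice_def)

lemma heyting_closed:
  fixes A :: "'a gorder" (structure)
  assumes "heyting_algebra A"
  shows "\<top> \<in> carrier A" "\<bottom> \<in> carrier A"
    and "a \<in> carrier A \<Longrightarrow> b \<in> carrier A \<Longrightarrow> a \<sqinter> b \<in> carrier A"
    and "a \<in> carrier A \<Longrightarrow> b \<in> carrier A \<Longrightarrow> a \<squnion> b \<in> carrier A"
    and "a \<in> carrier A \<Longrightarrow> b \<in> carrier A \<Longrightarrow> himp A a b \<in> carrier A"
proof -
  interpret heyting A by unfold_locales fact
  show "\<top> \<in> carrier A" "\<bottom> \<in> carrier A"
    and "a \<in> carrier A \<Longrightarrow> b \<in> carrier A \<Longrightarrow> a \<sqinter> b \<in> carrier A"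
    and "a \<in> carrier A \<Longrightarrow> b \<in> carrier A \<Longrightarrow> a \<squnion> b \<in> carrier A"
    and "a \<in> carrier A \<Longrightarrow> b \<in> carrier A \<Longrightarrow> himp A a b \<in> carrier A"
    by simp_all
qed

lemma ha_homI:
  assumes "h \<in> carrier A \<rightarrow>\<^sub>E carrier B" "h \<top>\<^bsub>A\<^esub> = \<top>\<^bsub>B\<^esub>" "h \<bottom>\<^bsub>A\<^esub> = \<bottom>\<^bsub>B\<^esub>"
    "\<And>a b. a \<in> carrier A \<Longrightarrow> b \<in> carrier A \<Longrightarrow> h (a \<sqinter>\<^bsub>A\<^esub> b) = h a \<sqinter>\<^bsub>B\<^esub> h b"
    "\<And>a b. a \<in> carrier A \<Longrightarrow> b \<in> carrier A \<Longrightarrow> h (a \<squnion>\<^bsub>A\<^esub> b) = h a \<squnion>\<^bsub>B\<^esub> h b"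
    "\<And>a b. a \<in> carrier A \<Longrightarrow> b \<in> carrier A \<Longrightarrow> h (himp A a b) = himp B (h a) (h b)"
  shows "h \<in> ha_hom A B"
  using assms by (simp add: ha_hom_def)

lemma ha_hom_closed: "h \<in> ha_hom A B \<Longrightarrow> a \<in> carrier A \<Longrightarrow> h a \<in> carrier B"
  by (auto simp: ha_hom_def)

lemma ha_hom_funcset: "h \<in> ha_hom A B \<Longrightarrow> h \<in> carrier A \<rightarrow> carrier B"
  by (auto simp: ha_hom_def)

lemma ha_hom_extensional: "h \<in> ha_hom A B \<Longrightarrow> h \<in> extensional (carrier A)"
  by (simp add: ha_hom_def PiE_iff)

lemma ha_hom_preserves:
  assumes "h \<in> ha_hom A B"
  shows "h \<top>\<^bsub>A\<^esub> = \<top>\<^bsub>B\<^esub>" "h \<bottom>\<^bsub>A\<^esub> = \<bottom>\<^bsub>B\<^esub>"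
    and "a \<in> carrier A \<Longrightarrow> b \<in> carrier A \<Longrightarrow> h (a \<sqinter>\<^bsub>A\<^esub> b) = h a \<sqinter>\<^bsub>B\<^esub> h b"
    and "a \<in> carrier A \<Longrightarrow> b \<in> carrier A \<Longrightarrow> h (a \<squnion>\<^bsub>A\<^esub> b) = h a \<squnion>\<^bsub>B\<^esub> h b"
    and "a \<in> carrier A \<Longrightarrow> b \<in> carrier A \<Longrightarrow> h (himp A a b) = himp B (h a) (h b)"
  using assms by (simp_all add: ha_hom_def)

lemma ha_hom_eqI:
  assumes "h \<in> ha_hom A B" "k \<in> ha_hom A C" "\<And>a. a \<in> carrier A \<Longrightarrow> h a = k a"
  shows "h = k"
  using ha_hom_extensional[OF assms(1)] ha_hom_extensional[OF assms(2)] assms(3)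
  by (rule extensionalityI)

lemma ha_hom_id: "heyting_algebra A \<Longrightarrow> (\<lambda>a\<in>carrier A. a) \<in> ha_hom A A"
  by (rule ha_homI) (simp_all add: heyting_closed)

lemma ha_hom_compose:
  assumes "heyting_algebra A" "h \<in> ha_hom A B" "k \<in> ha_hom B C"
  shows "compose (carrier A) k h \<in> ha_hom A C"
  using assms
  by (intro ha_homI) (auto simp: compose_def heyting_closed ha_hom_preserves ha_hom_closed)

lemma ha_hom_factor_surj:
  assumes "heyting_algebra A" "r \<in> ha_hom A B" "r ` carrier A = carrier B"
    and "compose (carrier A) f r \<in> ha_hom A C" "f \<in> extensional (carrier B)"
  shows "f \<in> ha_hom B C"
proof -
  note closed = heyting_closed[OF assms(1)] ha_hom_closed[OF assms(4)]
  note r = ha_hom_preserves[OF assms(2), symmetric] and fr = ha_hom_preserves[OF assms(4)]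
  have f_r: "f (r a) = compose (carrier A) f r a" if "a \<in> carrier A" for a
    using that by (simp add: compose_eq)
  show ?thesis
  proof (rule ha_homI)
    show "f \<in> carrier B \<rightarrow>\<^sub>E carrier C"
      using assms(5) by (auto simp: PiE_iff assms(3)[symmetric] f_r closed)
    show "f \<top>\<^bsub>B\<^esub> = \<top>\<^bsub>C\<^esub>" "f \<bottom>\<^bsub>B\<^esub> = \<bottom>\<^bsub>C\<^esub>"
      by (simp_all add: r(1,2) f_r closed fr)
    fix b b' assume "b \<in> carrier B" "b' \<in> carrier B"
    then obtain a a' where "a \<in> carrier A" "a' \<in> carrier A" "b = r a" "b' = r a'"
      using assms(3) by blast
    then show "f (b \<sqinter>\<^bsub>B\<^esub> b') = f b \<sqinter>\<^bsub>C\<^esub> f b'"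
      and "f (b \<squnion>\<^bsub>B\<^esub> b') = f b \<squnion>\<^bsub>C\<^esub> f b'"
      and "f (himp B b b') = himp C (f b) (f b')"
      by (simp_all add: r(3-) f_r closed fr)
  qed
qed

section \<open>Up-sets\<close>

lemma UU_simps [simp]: "carrier (UU X) = upsets X" "le (UU X) = (\<subseteq>)" "eq (UU X) = (=)"
  by (simp_all add: UU_def)

lemma upsets_subset: "V \<in> upsets X \<Longrightarrow> V \<subseteq> carrier X"
  by (simp add: upsets_def)

lemma upsets_upward: "V \<in> upsets X \<Longrightarrow> x \<in> V \<Longrightarrow> y \<in> carrier X \<Longrightarrow> x \<sqsubseteq>\<^bsub>X\<^esub> y \<Longrightarrow> y \<in> V"
  by (auto simp: upsets_def)

lemma carrier_upset: "carrier X \<in> upsets X"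
  by (simp add: upsets_def)

lemma principal_upset:
  assumes "partial_order X" "x \<in> carrier X"
  shows "{y \<in> carrier X. x \<sqsubseteq>\<^bsub>X\<^esub> y} \<in> upsets X"
proof -
  interpret partial_order X by fact
  show ?thesis using assms(2) by (auto simp: upsets_def intro: le_trans)
qed

lemma upsets_restrict:
  "V \<in> upsets X \<Longrightarrow> F \<subseteq> carrier X \<Longrightarrow> V \<inter> F \<in> upsets (X\<lparr>carrier := F\<rparr>)"
  by (auto simp: upsets_def)

definition upset_imp :: "'x gorder \<Rightarrow> 'x set \<Rightarrow> 'x set \<Rightarrow> 'x set" where
  "upset_imp X V W = {x \<in> carrier X. \<forall>y\<in>carrier X. x \<sqsubseteq>\<^bsub>X\<^esub> y \<longrightarrow> y \<in> V \<longrightarrow> y \<in> W}"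

lemma upset_imp_upset:
  assumes "partial_order X"
  shows "upset_imp X V W \<in> upsets X"
proof -
  interpret partial_order X by fact
  show ?thesis by (simp add: upset_imp_def upsets_def) (blast intro: le_trans)
qed

lemma subset_upset_imp_iff:
  assumes "partial_order X" "V \<in> upsets X" "Z \<in> upsets X"
  shows "Z \<subseteq> upset_imp X V W \<longleftrightarrow> V \<inter> Z \<subseteq> W"
proof -
  interpret partial_order X by fact
  show ?thesis using assms(2,3) by (auto simp: upset_imp_def upsets_def)
qed

lemma UU_heyting_operations:
  assumes "partial_order X"
  shows "heyting_operations (UU X) (carrier X) {} (\<inter>) (\<union>) (upset_imp X)"
proof (rule heyting_operations.intro)
  show "partial_order (UU X)"
    by (rule partial_orderI) auto
  show "heyting_operations_axioms (UU X) (carrier X) {} (\<inter>) (\<union>) (upset_imp X)"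
    by unfold_locales
      (auto simp: upset_imp_upset[OF assms] subset_upset_imp_iff[OF assms], auto simp: upsets_def)
qed

lemmas UU_heyting = heyting_operations.heyting_algebra[OF UU_heyting_operations]
  and UU_top = heyting_operations.top_eq_one[OF UU_heyting_operations]
  and UU_bottom = heyting_operations.bottom_eq_zero[OF UU_heyting_operations]
  and UU_meet = heyting_operations.meet_eq_conj[OF UU_heyting_operations, unfolded UU_simps]
  and UU_join = heyting_operations.join_eq_disj[OF UU_heyting_operations, unfolded UU_simps]
  and UU_himp = heyting_operations.himp_eq_impl[OF UU_heyting_operations, unfolded UU_simps]

lemma hom_UU_upset: "g \<in> ha_hom A (UU X) \<Longrightarrow> a \<in> carrier A \<Longrightarrow> g a \<in> upsets X"
  using ha_hom_closed by fastforce

lemma hom_UU_mem: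
  assumes "partial_order X" "g \<in> ha_hom A (UU X)" "x \<in> carrier X"
  shows "x \<in> g \<top>\<^bsub>A\<^esub>" "x \<notin> g \<bottom>\<^bsub>A\<^esub>"
    and "a \<in> carrier A \<Longrightarrow> b \<in> carrier A \<Longrightarrow> x \<in> g (a \<sqinter>\<^bsub>A\<^esub> b) \<longleftrightarrow> x \<in> g a \<and> x \<in> g b"
    and "a \<in> carrier A \<Longrightarrow> b \<in> carrier A \<Longrightarrow> x \<in> g (a \<squnion>\<^bsub>A\<^esub> b) \<longleftrightarrow> x \<in> g a \<or> x \<in> g b"
    and "a \<in> carrier A \<Longrightarrow> b \<in> carrier A \<Longrightarrow> x \<in> g (himp A a b) \<longleftrightarrow>
      (\<forall>y\<in>carrier X. x \<sqsubseteq>\<^bsub>X\<^esub> y \<longrightarrow> y \<in> g a \<longrightarrow> y \<in> g b)"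
  using assms(1,3) by (auto simp: ha_hom_preserves[OF assms(2)] hom_UU_upset[OF assms(2)]
      UU_top UU_bottom UU_meet UU_join UU_himp upset_imp_def)

lemma hom_UU_I:
  assumes A: "heyting_algebra A" and X: "partial_order X" and g: "g \<in> carrier A \<rightarrow>\<^sub>E upsets X"
    and top: "\<And>x. x \<in> carrier X \<Longrightarrow> x \<in> g \<top>\<^bsub>A\<^esub>"
    and bottom: "\<And>x. x \<in> carrier X \<Longrightarrow> x \<notin> g \<bottom>\<^bsub>A\<^esub>"
    and meet: "\<And>x a b. x \<in> carrier X \<Longrightarrow> a \<in> carrier A \<Longrightarrow> b \<in> carrier A \<Longrightarrow>
      x \<in> g (a \<sqinter>\<^bsub>A\<^esub> b) \<longleftrightarrow> x \<in> g a \<and> x \<in> g b"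
    and join: "\<And>x a b. x \<in> carrier X \<Longrightarrow> a \<in> carrier A \<Longrightarrow> b \<in> carrier A \<Longrightarrow>
      x \<in> g (a \<squnion>\<^bsub>A\<^esub> b) \<longleftrightarrow> x \<in> g a \<or> x \<in> g b"
    and himp: "\<And>x a b. x \<in> carrier X \<Longrightarrow> a \<in> carrier A \<Longrightarrow> b \<in> carrier A \<Longrightarrow>
      x \<in> g (himp A a b) \<longleftrightarrow> (\<forall>y\<in>carrier X. x \<sqsubseteq>\<^bsub>X\<^esub> y \<longrightarrow> y \<in> g a \<longrightarrow> y \<in> g b)"
  shows "g \<in> ha_hom A (UU X)"
proof (rule ha_homI)
  have g_upset: "g a \<in> upsets X" if "a \<in> carrier A" for a using g that by blast
  have eqI: "g a = W" if "a \<in> carrier A" "W \<subseteq> carrier X" "\<And>x. x \<in> carrier X \<Longrightarrow> x \<in> g a \<longleftrightarrow> x \<in> W"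
    for a W using upsets_subset[OF g_upset[OF that(1)]] that(2,3) by blast
  note closed = heyting_closed[OF A]
  show "g \<in> carrier A \<rightarrow>\<^sub>E carrier (UU X)" using g by simp
  show "g \<top>\<^bsub>A\<^esub> = \<top>\<^bsub>UU X\<^esub>" by (rule eqI) (simp_all add: closed top UU_top[OF X])
  show "g \<bottom>\<^bsub>A\<^esub> = \<bottom>\<^bsub>UU X\<^esub>" by (rule eqI) (simp_all add: closed bottom UU_bottom[OF X])
  fix a b assume ab: "a \<in> carrier A" "b \<in> carrier A"
  note gab_upsets = g_upset[OF ab(1)] g_upset[OF ab(2)] upsets_subset[OF g_upset[OF ab(1)]]
    upsets_subset[OF g_upset[OF ab(2)]]
  show "g (a \<sqinter>\<^bsub>A\<^esub> b) = g a \<sqinter>\<^bsub>UU X\<^esub> g b"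
    by (rule eqI) (use gab_upsets ab in \<open>auto simp: closed meet UU_meet[OF X]\<close>)
  show "g (a \<squnion>\<^bsub>A\<^esub> b) = g a \<squnion>\<^bsub>UU X\<^esub> g b"
    by (rule eqI) (use gab_upsets ab in \<open>auto simp: closed join UU_join[OF X]\<close>)
  show "g (himp A a b) = himp (UU X) (g a) (g b)"
    by (rule eqI) (use gab_upsets ab in \<open>auto simp: closed himp UU_himp[OF X] upset_imp_def\<close>)
qed

section \<open>Open maps\<close>

lemma open_mapsI:
  assumes "f \<in> carrier P \<rightarrow>\<^sub>E carrier Q"
    and "\<And>p p'. p \<in> carrier P \<Longrightarrow> p' \<in> carrier P \<Longrightarrow> p \<sqsubseteq>\<^bsub>P\<^esub> p' \<Longrightarrow> f p \<sqsubseteq>\<^bsub>Q\<^esub> f p'"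
    and "\<And>p q. p \<in> carrier P \<Longrightarrow> q \<in> carrier Q \<Longrightarrow> f p \<sqsubseteq>\<^bsub>Q\<^esub> q \<Longrightarrow>
      \<exists>p'\<in>carrier P. p \<sqsubseteq>\<^bsub>P\<^esub> p' \<and> f p' = q"
  shows "f \<in> open_maps P Q"
  using assms by (simp add: open_maps_def)

lemma open_maps_closed: "f \<in> open_maps P Q \<Longrightarrow> p \<in> carrier P \<Longrightarrow> f p \<in> carrier Q"
  by (auto simp: open_maps_def)

lemma open_maps_funcset: "f \<in> open_maps P Q \<Longrightarrow> f \<in> carrier P \<rightarrow> carrier Q"
  by (auto simp: open_maps_def)

lemma open_maps_extensional: "f \<in> open_maps P Q \<Longrightarrow> f \<in> extensional (carrier P)"
  by (simp add: open_maps_def PiE_iff)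

lemma open_maps_mono:
  "f \<in> open_maps P Q \<Longrightarrow> p \<in> carrier P \<Longrightarrow> p' \<in> carrier P \<Longrightarrow> p \<sqsubseteq>\<^bsub>P\<^esub> p' \<Longrightarrow> f p \<sqsubseteq>\<^bsub>Q\<^esub> f p'"
  by (simp add: open_maps_def)

lemma open_maps_lift:
  assumes "f \<in> open_maps P Q" "p \<in> carrier P" "q \<in> carrier Q" "f p \<sqsubseteq>\<^bsub>Q\<^esub> q"
  obtains p' where "p' \<in> carrier P" "p \<sqsubseteq>\<^bsub>P\<^esub> p'" "f p' = q"
  using assms unfolding open_maps_def by blast

lemma open_maps_eqI:
  assumes "f \<in> open_maps P Q" "g \<in> open_maps P R" "\<And>p. p \<in> carrier P \<Longrightarrow> f p = g p"
  shows "f = g"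
  using open_maps_extensional[OF assms(1)] open_maps_extensional[OF assms(2)] assms(3)
  by (rule extensionalityI)

lemma open_maps_id:
  assumes "partial_order P"
  shows "(\<lambda>p\<in>carrier P. p) \<in> open_maps P P"
proof -
  interpret partial_order P by fact
  show ?thesis by (rule open_mapsI) auto
qed

lemma open_maps_compose:
  assumes f: "f \<in> open_maps P Q" and g: "g \<in> open_maps Q R"
  shows "compose (carrier P) g f \<in> open_maps P R"
proof (rule open_mapsI)
  show "compose (carrier P) g f \<in> carrier P \<rightarrow>\<^sub>E carrier R"
    using open_maps_closed[OF f] open_maps_closed[OF g] by (auto simp: compose_def)
  fix p assume p: "p \<in> carrier P"
  show "compose (carrier P) g f p \<sqsubseteq>\<^bsub>R\<^esub> compose (carrier P) g f p'"
    if "p' \<in> carrier P" "p \<sqsubseteq>\<^bsub>P\<^esub> p'" for p'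
    using p that
    by (simp add: compose_eq open_maps_mono[OF g] open_maps_mono[OF f] open_maps_closed[OF f])
  show "\<exists>p'\<in>carrier P. p \<sqsubseteq>\<^bsub>P\<^esub> p' \<and> compose (carrier P) g f p' = r"
    if r: "r \<in> carrier R" "compose (carrier P) g f p \<sqsubseteq>\<^bsub>R\<^esub> r" for r
  proof -
    have "g (f p) \<sqsubseteq>\<^bsub>R\<^esub> r" using r(2) p by (simp add: compose_eq)
    then obtain q where q: "q \<in> carrier Q" "f p \<sqsubseteq>\<^bsub>Q\<^esub> q" "g q = r"
      using open_maps_lift[OF g open_maps_closed[OF f p] r(1)] by blast
    then show ?thesis
      using open_maps_lift[OF f p q(1,2)] by (metis compose_eq)
  qed
qed

lemma open_maps_all_above_iff:
  assumes f: "f \<in> open_maps X Y" and x: "x \<in> carrier X"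
  shows "(\<forall>y\<in>carrier Y. f x \<sqsubseteq>\<^bsub>Y\<^esub> y \<longrightarrow> R y) \<longleftrightarrow> (\<forall>x'\<in>carrier X. x \<sqsubseteq>\<^bsub>X\<^esub> x' \<longrightarrow> R (f x'))"
  using open_maps_mono[OF f x] open_maps_closed[OF f] open_maps_lift[OF f x] by metis

lemma open_inj_reflects_le:
  assumes k: "k \<in> open_maps X Y" "inj_on k (carrier X)"
    and x: "x \<in> carrier X" "x' \<in> carrier X" "k x \<sqsubseteq>\<^bsub>Y\<^esub> k x'"
  shows "x \<sqsubseteq>\<^bsub>X\<^esub> x'"
proof -
  obtain z where "z \<in> carrier X" "x \<sqsubseteq>\<^bsub>X\<^esub> z" "k z = k x'"
    using open_maps_lift[OF k(1) x(1) open_maps_closed[OF k(1) x(2)] x(3)] .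
  then show ?thesis using inj_onD[OF k(2)] x(2) by metis
qed

lemma open_maps_inv_into:
  assumes k: "k \<in> open_maps X Y" and bij: "bij_betw k (carrier X) (carrier Y)"
  shows "(\<lambda>y\<in>carrier Y. inv_into (carrier X) k y) \<in> open_maps Y X" (is "?i \<in> _")
proof (rule open_mapsI)
  have inj: "inj_on k (carrier X)" and ran: "k ` carrier X = carrier Y"
    using bij by (auto simp: bij_betw_def)
  have i_closed: "?i y \<in> carrier X" and k_i: "k (?i y) = y" if "y \<in> carrier Y" for y
    using that ran by (auto simp: inv_into_into f_inv_into_f)
  show "?i \<in> carrier Y \<rightarrow>\<^sub>E carrier X" using i_closed by auto
  fix y assume y: "y \<in> carrier Y"
  show "?i y \<sqsubseteq>\<^bsub>X\<^esub> ?i y'" if "y' \<in> carrier Y" "y \<sqsubseteq>\<^bsub>Y\<^esub> y'" for y'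
    by (rule open_inj_reflects_le[OF k inj]) (simp_all only: i_closed k_i y that)
  show "\<exists>y'\<in>carrier Y. y \<sqsubseteq>\<^bsub>Y\<^esub> y' \<and> ?i y' = x" if x: "x \<in> carrier X" "?i y \<sqsubseteq>\<^bsub>X\<^esub> x" for x
  proof (intro bexI conjI)
    show "y \<sqsubseteq>\<^bsub>Y\<^esub> k x" using open_maps_mono[OF k i_closed[OF y] x] by (simp only: k_i y)
    show "k x \<in> carrier Y" by (rule open_maps_closed[OF k x(1)])
    then show "?i (k x) = x" using inj x(1) by simp
  qed
qed

lemma image_upset:
  assumes f: "f \<in> open_maps P Q" and V: "V \<in> upsets P"
  shows "f ` V \<in> upsets Q"
proof -
  have "q \<in> f ` V" if p: "p \<in> V" and q: "q \<in> carrier Q" "f p \<sqsubseteq>\<^bsub>Q\<^esub> q" for p q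
  proof -
    have "p \<in> carrier P" using p upsets_subset[OF V] by blast
    then obtain p' where "p' \<in> carrier P" "p \<sqsubseteq>\<^bsub>P\<^esub> p'" "f p' = q"
      using open_maps_lift[OF f _ q] by blast
    then show ?thesis using upsets_upward[OF V p] by blast
  qed
  then show ?thesis
    using open_maps_closed[OF f] upsets_subset[OF V] by (auto simp: upsets_def[of Q])
qed

lemma preimage_upset:
  assumes "f \<in> open_maps X Y" "V \<in> upsets Y"
  shows "{x \<in> carrier X. f x \<in> V} \<in> upsets X"
  using upsets_upward[OF assms(2)] open_maps_mono[OF assms(1)] open_maps_closed[OF assms(1)]
  by (auto simp: upsets_def[of X])

lemma UU_map_eq: "V \<in> upsets Y \<Longrightarrow> UU_map X Y f V = {x \<in> carrier X. f x \<in> V}"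
  by (simp add: UU_map_def)

lemma UU_map_hom:
  assumes X: "partial_order X" and Y: "partial_order Y" and f: "f \<in> open_maps X Y"
  shows "UU_map X Y f \<in> ha_hom (UU Y) (UU X)"
proof (rule hom_UU_I[OF UU_heyting[OF Y] X])
  show "UU_map X Y f \<in> carrier (UU Y) \<rightarrow>\<^sub>E upsets X"
    using preimage_upset[OF f] by (auto simp: UU_map_def)
  note closed = heyting_closed[OF UU_heyting[OF Y], unfolded UU_simps]
  note UU_ops = UU_top[OF Y] UU_bottom[OF Y] UU_meet[OF Y] UU_join[OF Y]
  fix x assume x: "x \<in> carrier X"
  note fx = open_maps_closed[OF f x]
  show "x \<in> UU_map X Y f \<top>\<^bsub>UU Y\<^esub>" "x \<notin> UU_map X Y f \<bottom>\<^bsub>UU Y\<^esub>"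
    using x fx by (simp_all add: UU_map_eq closed) (simp_all add: UU_ops)
  fix V W assume "V \<in> carrier (UU Y)" "W \<in> carrier (UU Y)"
  then have VW: "V \<in> upsets Y" "W \<in> upsets Y" by simp_all
  show "x \<in> UU_map X Y f (V \<sqinter>\<^bsub>UU Y\<^esub> W) \<longleftrightarrow> x \<in> UU_map X Y f V \<and> x \<in> UU_map X Y f W"
    and "x \<in> UU_map X Y f (V \<squnion>\<^bsub>UU Y\<^esub> W) \<longleftrightarrow> x \<in> UU_map X Y f V \<or> x \<in> UU_map X Y f W"
    using x VW by (simp_all add: UU_map_eq closed) (simp_all add: UU_ops)
  have "x \<in> UU_map X Y f (himp (UU Y) V W) \<longleftrightarrow> (\<forall>y\<in>carrier Y. f x \<sqsubseteq>\<^bsub>Y\<^esub> y \<longrightarrow> y \<in> V \<longrightarrow> y \<in> W)"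
    using x fx VW by (simp add: UU_map_eq closed) (simp add: UU_himp[OF Y] upset_imp_def)
  also have "\<dots> \<longleftrightarrow> (\<forall>x'\<in>carrier X. x \<sqsubseteq>\<^bsub>X\<^esub> x' \<longrightarrow> f x' \<in> V \<longrightarrow> f x' \<in> W)"
    by (rule open_maps_all_above_iff[OF f x])
  finally show "x \<in> UU_map X Y f (himp (UU Y) V W) \<longleftrightarrow>
      (\<forall>x'\<in>carrier X. x \<sqsubseteq>\<^bsub>X\<^esub> x' \<longrightarrow> x' \<in> UU_map X Y f V \<longrightarrow> x' \<in> UU_map X Y f W)"
    using VW by (simp add: UU_map_eq)
qed

lemma UU_map_id: "UU_map X X (\<lambda>x\<in>carrier X. x) = (\<lambda>V\<in>upsets X. V)"
  by (auto simp: UU_map_def upsets_def fun_eq_iff)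

lemma UU_map_compose:
  assumes "f \<in> open_maps X Y" "g \<in> open_maps Y Z"
  shows "UU_map X Z (compose (carrier X) g f) = compose (upsets Z) (UU_map X Y f) (UU_map Y Z g)"
proof (rule extensionalityI)
  fix V assume "V \<in> upsets Z"
  then show "UU_map X Z (compose (carrier X) g f) V =
      compose (upsets Z) (UU_map X Y f) (UU_map Y Z g) V"
    using open_maps_closed[OF assms(1)] preimage_upset[OF assms(2)]
    by (auto simp: UU_map_eq compose_eq)
qed (simp_all add: UU_map_def)

lemma open_maps_local:
  assumes k: "k \<in> extensional (carrier X)"
    and cover: "\<And>x. x \<in> carrier X \<Longrightarrow> \<exists>(P :: 'p gorder) f. f \<in> open_maps P X \<and> x \<in> f ` carrier P \<and>
      compose (carrier P) k f \<in> open_maps P Y"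
  shows "k \<in> open_maps X Y"
proof (rule open_mapsI)
  have chart: "\<exists>(P :: 'p gorder) f p. f \<in> open_maps P X \<and> p \<in> carrier P \<and> x = f p \<and>
      compose (carrier P) k f \<in> open_maps P Y" if "x \<in> carrier X" for x
    using cover[OF that] by blast
  have "k x \<in> carrier Y" if x: "x \<in> carrier X" for x
    using chart[OF x] open_maps_closed compose_eq by metis
  then show "k \<in> carrier X \<rightarrow>\<^sub>E carrier Y" using k by (simp add: PiE_iff)
  fix x assume "x \<in> carrier X"
  from chart[OF this] obtain P :: "'p gorder" and f p where f: "f \<in> open_maps P X"
    and p: "p \<in> carrier P" "x = f p" and kf: "compose (carrier P) k f \<in> open_maps P Y"
    by blast
  show "k x \<sqsubseteq>\<^bsub>Y\<^esub> k x'" if x': "x' \<in> carrier X" "x \<sqsubseteq>\<^bsub>X\<^esub> x'" for x'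
  proof -
    obtain p' where "p' \<in> carrier P" "p \<sqsubseteq>\<^bsub>P\<^esub> p'" "f p' = x'"
      using open_maps_lift[OF f p(1) x'(1)] x'(2) p(2) by blast
    then show ?thesis using open_maps_mono[OF kf p(1)] p by (metis compose_eq)
  qed
  show "\<exists>x'\<in>carrier X. x \<sqsubseteq>\<^bsub>X\<^esub> x' \<and> k x' = y" if y: "y \<in> carrier Y" "k x \<sqsubseteq>\<^bsub>Y\<^esub> y" for y
  proof -
    obtain p' where "p' \<in> carrier P" "p \<sqsubseteq>\<^bsub>P\<^esub> p'" "k (f p') = y"
      using open_maps_lift[OF kf p(1) y(1)] y(2) p by (metis compose_eq)
    then show ?thesis
      using open_maps_mono[OF f p(1)] open_maps_closed[OF f] p(2) by blast
  qed
qed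

section \<open>Finite posets and gluing\<close>

lemma Kp_Obj: "P \<in> Obj Kp_cat \<longleftrightarrow> partial_order P \<and> finite (carrier P)"
  by (simp add: Kp_cat_def)

lemma IKp_Obj: "X \<in> Obj IKp_cat \<longleftrightarrow> partial_order X \<and> image_finite X"
  by (simp add: IKp_cat_def)

lemma finite_image_finite: "finite (carrier X) \<Longrightarrow> image_finite X"
  by (simp add: image_finite_def)

lemma Kp_partial_order: "P \<in> Obj Kp_cat \<Longrightarrow> partial_order P"
  by (simp add: Kp_Obj)

lemma IKp_partial_order: "X \<in> Obj IKp_cat \<Longrightarrow> partial_order X"
  by (simp add: IKp_Obj)

lemma Kp_IKp: "P \<in> Obj Kp_cat \<Longrightarrow> P \<in> Obj IKp_cat"
  by (simp add: Kp_Obj IKp_Obj finite_image_finite)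

lemma induced_poset_open:
  assumes "d ` S \<in> upsets X"
  shows "restrict d S \<in> open_maps (induced_poset S d X) X"
proof (rule open_mapsI)
  fix p q assume "p \<in> carrier (induced_poset S d X)" "q \<in> carrier X" "restrict d S p \<sqsubseteq>\<^bsub>X\<^esub> q"
  then show "\<exists>p'\<in>carrier (induced_poset S d X). p \<sqsubseteq>\<^bsub>induced_poset S d X\<^esub> p' \<and> restrict d S p' = q"
    using upsets_upward[OF assms, of "d p" q] by auto
qed (use upsets_subset[OF assms] in auto)

lemma fin_upsetsD:
  assumes "F \<in> fin_upsets X"
  shows "F \<in> upsets X" "finite F" "F \<subseteq> carrier X"
  using assms by (auto simp: fin_upsets_def upsets_def)

lemma fin_upset_Kp_chart:
  assumes X: "partial_order X" and F: "F \<in> fin_upsets X"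
  obtains P d where "P \<in> Obj Kp_cat" "d \<in> open_maps P X" "d ` carrier P = F"
proof -
  note F = fin_upsetsD[OF F]
  obtain d where "bij_betw d {0..<card F} F"
    using ex_bij_betw_nat_finite[OF F(2)] by blast
  then have d: "inj_on d {0..<card F}" "d ` {0..<card F} = F" by (auto simp: bij_betw_def)
  let ?P = "induced_poset {0..<card F} d X"
  have "?P \<in> Obj Kp_cat"
    using partial_order_induced[OF X d(1)] d(2) F(3) by (simp add: Kp_Obj)
  moreover have "restrict d {0..<card F} \<in> open_maps ?P X"
    using F(1) d(2) by (intro induced_poset_open) simp
  ultimately show thesis using that d(2) by simp
qed

lemma IKp_chart_at:
  assumes X: "X \<in> Obj IKp_cat" and x: "x \<in> carrier X"
  obtains P d p where "P \<in> Obj Kp_cat" "d \<in> open_maps P X" "p \<in> carrier P" "x = d p"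
proof -
  interpret partial_order X by (rule IKp_partial_order[OF X])
  have "{y \<in> carrier X. x \<sqsubseteq>\<^bsub>X\<^esub> y} \<in> fin_upsets X"
    using principal_upset[of X x] X x by (simp add: IKp_Obj fin_upsets_def image_finite_def)
  then obtain P d where P: "P \<in> Obj Kp_cat" "d \<in> open_maps P X"
    and d: "d ` carrier P = {y \<in> carrier X. x \<sqsubseteq>\<^bsub>X\<^esub> y}"
    by (rule fin_upset_Kp_chart[OF IKp_partial_order[OF X]])
  have "x \<in> d ` carrier P" unfolding d using x by simp
  then show thesis using that[OF P] by blast
qed

definition pullback_poset ::
  "'p gorder \<Rightarrow> 'q gorder \<Rightarrow> ('p \<Rightarrow> 'x) \<Rightarrow> ('q \<Rightarrow> 'x) \<Rightarrow> ('p \<times> 'q) gorder" where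
  "pullback_poset P Q f g = \<lparr>carrier = {(p, q). p \<in> carrier P \<and> q \<in> carrier Q \<and> f p = g q},
     eq = (=), le = (\<lambda>(p, q) (p', q'). p \<sqsubseteq>\<^bsub>P\<^esub> p' \<and> q \<sqsubseteq>\<^bsub>Q\<^esub> q')\<rparr>"

lemma pullback_poset_simps [simp]:
  "(p, q) \<in> carrier (pullback_poset P Q f g) \<longleftrightarrow> p \<in> carrier P \<and> q \<in> carrier Q \<and> f p = g q"
  "(p, q) \<sqsubseteq>\<^bsub>pullback_poset P Q f g\<^esub> (p', q') \<longleftrightarrow> p \<sqsubseteq>\<^bsub>P\<^esub> p' \<and> q \<sqsubseteq>\<^bsub>Q\<^esub> q'"
  "eq (pullback_poset P Q f g) = (=)"
  by (simp_all add: pullback_poset_def)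

lemma partial_order_pullback:
  assumes "partial_order P" "partial_order Q"
  shows "partial_order (pullback_poset P Q f g)"
proof -
  interpret P: partial_order P by fact
  interpret Q: partial_order Q by fact
  show ?thesis
    by (rule partial_orderI) (auto intro: P.le_antisym Q.le_antisym P.le_trans Q.le_trans)
qed

lemma finite_pullback:
  assumes "finite (carrier P)" "finite (carrier Q)"
  shows "finite (carrier (pullback_poset P Q f g))"
proof (rule finite_subset)
  show "carrier (pullback_poset P Q f g) \<subseteq> carrier P \<times> carrier Q" by auto
qed (use assms in simp)

lemma pullback_fst_open:
  assumes f: "f \<in> open_maps P X" and g: "g \<in> open_maps Q X"
  shows "restrict fst (carrier (pullback_poset P Q f g)) \<in> open_maps (pullback_poset P Q f g) P"
    (is "restrict fst (carrier ?W) \<in> _")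
proof (rule open_mapsI)
  fix w p' assume w: "w \<in> carrier ?W" and p': "p' \<in> carrier P" "restrict fst (carrier ?W) w \<sqsubseteq>\<^bsub>P\<^esub> p'"
  obtain p q where pq: "w = (p, q)" "p \<in> carrier P" "q \<in> carrier Q" "f p = g q"
    using w by (cases w) auto
  have "p \<sqsubseteq>\<^bsub>P\<^esub> p'" using p'(2) pq by simp
  then have "g q \<sqsubseteq>\<^bsub>X\<^esub> f p'" using open_maps_mono[OF f pq(2) p'(1)] pq(4) by simp
  then obtain q' where "q' \<in> carrier Q" "q \<sqsubseteq>\<^bsub>Q\<^esub> q'" "g q' = f p'"
    using open_maps_lift[OF g pq(3) open_maps_closed[OF f p'(1)]] by blast
  then show "\<exists>w'\<in>carrier ?W. w \<sqsubseteq>\<^bsub>?W\<^esub> w' \<and> restrict fst (carrier ?W) w' = p'"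
    using \<open>p \<sqsubseteq>\<^bsub>P\<^esub> p'\<close> p'(1) pq(1) by (intro bexI[of _ "(p', q')"]) simp_all
qed auto

lemma pullback_swap_open:
  "restrict prod.swap (carrier (pullback_poset P Q f g)) \<in>
    open_maps (pullback_poset P Q f g) (pullback_poset Q P g f)" (is "restrict _ (carrier ?W) \<in> _")
proof (rule open_mapsI)
  fix w v assume "w \<in> carrier ?W" "v \<in> carrier (pullback_poset Q P g f)"
    "restrict prod.swap (carrier ?W) w \<sqsubseteq>\<^bsub>pullback_poset Q P g f\<^esub> v"
  then show "\<exists>w'\<in>carrier ?W. w \<sqsubseteq>\<^bsub>?W\<^esub> w' \<and> restrict prod.swap (carrier ?W) w' = v"
    by (cases w; cases v) (auto intro!: bexI[of _ "prod.swap v"])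
qed auto

lemma pullback_snd_open:
  assumes f: "f \<in> open_maps P X" and g: "g \<in> open_maps Q X"
  shows "restrict snd (carrier (pullback_poset P Q f g)) \<in> open_maps (pullback_poset P Q f g) Q"
proof -
  let ?W = "pullback_poset P Q f g" and ?V = "pullback_poset Q P g f"
  have "compose (carrier ?W) (restrict fst (carrier ?V)) (restrict prod.swap (carrier ?W)) =
      restrict snd (carrier ?W)"
    by (auto simp: compose_def fun_eq_iff)
  then show ?thesis
    using open_maps_compose[OF pullback_swap_open pullback_fst_open[OF g f]] by metis
qed

lemma Kp_pullback:
  assumes P: "P \<in> Obj Kp_cat" and Q: "Q \<in> Obj Kp_cat"
    and f: "f \<in> open_maps P X" and g: "g \<in> open_maps Q X"
    and pq: "p \<in> carrier P" "q \<in> carrier Q" "f p = g q"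
  obtains W u v w where "W \<in> Obj Kp_cat" "u \<in> open_maps W P" "v \<in> open_maps W Q"
    "compose (carrier W) f u = compose (carrier W) g v" "w \<in> carrier W" "u w = p" "v w = q"
proof -
  let ?R = "pullback_poset P Q f g"
  have R: "partial_order ?R" "carrier ?R \<in> fin_upsets ?R"
    using P Q
    by (simp_all add: Kp_Obj partial_order_pullback finite_pullback fin_upsets_def carrier_upset)
  then obtain W d where W: "W \<in> Obj Kp_cat" and d: "d \<in> open_maps W ?R" "d ` carrier W = carrier ?R"
    by (rule fin_upset_Kp_chart)
  have "(p, q) \<in> d ` carrier W" unfolding d(2) using pq by simp
  then obtain w where w: "w \<in> carrier W" "d w = (p, q)" by (metis imageE)
  define u where "u = compose (carrier W) (restrict fst (carrier ?R)) d"
  define v where "v = compose (carrier W) (restrict snd (carrier ?R)) d"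
  have uv: "d x = (u x, v x)" "f (u x) = g (v x)" if "x \<in> carrier W" for x
    using open_maps_closed[OF d(1) that] that by (cases "d x"; simp add: u_def v_def compose_eq)+
  show thesis
  proof (rule that[OF W _ _ _ w(1)])
    show "u \<in> open_maps W P" "v \<in> open_maps W Q"
      unfolding u_def v_def
      by (rule open_maps_compose[OF d(1)] pullback_fst_open[OF f g] pullback_snd_open[OF f g])+
    show "compose (carrier W) f u = compose (carrier W) g v"
      by (simp add: compose_def fun_eq_iff uv(2))
    show "u w = p" "v w = q" using uv(1)[OF w(1)] w(2) by simp_all
  qed
qed

lemma matching_maps_agree:
  assumes chart: "\<And>P f. (P, f) \<in> R \<Longrightarrow> P \<in> Obj Kp_cat" "\<And>P f. (P, f) \<in> R \<Longrightarrow> f \<in> open_maps P X"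
    and matching: "\<And>P f Q u. (P, f) \<in> R \<Longrightarrow> Q \<in> Obj Kp_cat \<Longrightarrow> u \<in> open_maps Q P \<Longrightarrow>
      s Q (compose (carrier Q) f u) = compose (carrier Q) (s P f) u"
    and R: "(P, f) \<in> R" "(Q, g) \<in> R"
    and pq: "p \<in> carrier P" "q \<in> carrier Q" "f p = g q"
  shows "s P f p = s Q g q"
proof -
  obtain W u v w where W: "W \<in> Obj Kp_cat" "u \<in> open_maps W P" "v \<in> open_maps W Q"
    "compose (carrier W) f u = compose (carrier W) g v" "w \<in> carrier W" "u w = p" "v w = q"
    by (rule Kp_pullback[OF chart(1)[OF R(1)] chart(1)[OF R(2)] chart(2)[OF R(1)] chart(2)[OF R(2)]
        pq])
  have "compose (carrier W) (s P f) u = compose (carrier W) (s Q g) v"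
    using matching[OF R(1) W(1,2)] matching[OF R(2) W(1,3)] W(4) by simp
  then show ?thesis using W(5-7) compose_eq by metis
qed

lemma open_maps_amalgamation:
  assumes chart: "\<And>P f. (P, f) \<in> R \<Longrightarrow> P \<in> Obj Kp_cat" "\<And>P f. (P, f) \<in> R \<Longrightarrow> f \<in> open_maps P X"
    and family: "\<And>P f. (P, f) \<in> R \<Longrightarrow> s P f \<in> open_maps P Y"
    and matching: "\<And>P f Q u. (P, f) \<in> R \<Longrightarrow> Q \<in> Obj Kp_cat \<Longrightarrow> u \<in> open_maps Q P \<Longrightarrow>
      s Q (compose (carrier Q) f u) = compose (carrier Q) (s P f) u"
    and cover: "carrier X \<subseteq> (\<Union>(P, f)\<in>R. f ` carrier P)"
  shows "\<exists>!k. k \<in> open_maps X Y \<and> (\<forall>(P, f)\<in>R. compose (carrier P) k f = s P f)"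
proof -
  have point: "\<exists>P f p. (P, f) \<in> R \<and> p \<in> carrier P \<and> x = f p" if "x \<in> carrier X" for x
    using subsetD[OF cover that] by blast
  have agree: "s P f p = s Q g q"
    if "(P, f) \<in> R" "(Q, g) \<in> R" "p \<in> carrier P" "q \<in> carrier Q" "f p = g q" for P f p Q g q
    by (rule matching_maps_agree[OF chart matching that])
  have "\<exists>y. \<forall>P f p. (P, f) \<in> R \<longrightarrow> p \<in> carrier P \<longrightarrow> f p = x \<longrightarrow> s P f p = y" if "x \<in> carrier X" for x
    using point[OF that] agree by metis
  then obtain k' where k': "\<And>x P f p. x \<in> carrier X \<Longrightarrow> (P, f) \<in> R \<Longrightarrow> p \<in> carrier P \<Longrightarrow> f p = x \<Longrightarrow>
      s P f p = k' x"
    by metis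
  define k where "k = restrict k' (carrier X)"
  have k_s: "compose (carrier P) k f = s P f" if R: "(P, f) \<in> R" for P f
  proof (rule extensionalityI)
    show "s P f \<in> extensional (carrier P)" by (rule open_maps_extensional[OF family[OF R]])
    fix p assume p: "p \<in> carrier P"
    then show "compose (carrier P) k f p = s P f p"
      using k'[OF _ R p] open_maps_closed[OF chart(2)[OF R] p] by (simp add: k_def compose_eq)
  qed simp
  have "k \<in> open_maps X Y"
  proof (rule open_maps_local)
    fix x assume "x \<in> carrier X"
    then show "\<exists>(P :: nat gorder) f. f \<in> open_maps P X \<and> x \<in> f ` carrier P \<and>
        compose (carrier P) k f \<in> open_maps P Y"
      using point chart(2) family k_s by (metis imageI)
  qed (simp add: k_def)
  moreover have "l = k" if l: "l \<in> open_maps X Y" "\<forall>(P, f)\<in>R. compose (carrier P) l f = s P f" for l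
  proof (rule open_maps_eqI[OF l(1) calculation])
    fix x assume "x \<in> carrier X"
    then obtain P f p where P: "(P, f) \<in> R" "p \<in> carrier P" "x = f p" using point by blast
    have "compose (carrier P) l f = compose (carrier P) k f" using l(2) k_s P(1) by auto
    then show "l x = k x" using P(2,3) by (metis compose_eq)
  qed
  ultimately show ?thesis using k_s by blast
qed

section \<open>The spectrum of a Heyting algebra\<close>

definition spec_map :: "'a gorder \<Rightarrow> 'x gorder \<Rightarrow> ('a \<Rightarrow> 'x set) \<Rightarrow> 'x \<Rightarrow> 'a set" where
  "spec_map A X g = (\<lambda>x\<in>carrier X. {a \<in> carrier A. x \<in> g a})"

definition spec_hom :: "'a gorder \<Rightarrow> 'x gorder \<Rightarrow> ('x \<Rightarrow> 'a set) \<Rightarrow> 'a \<Rightarrow> 'x set" where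
  "spec_hom A X k = (\<lambda>a\<in>carrier A. {x \<in> carrier X. a \<in> k x})"

definition spec_poset :: "'a gorder \<Rightarrow> 'a set gorder" where
  "spec_poset A = \<lparr>
     carrier = (\<Union>P\<in>Obj Kp_cat. \<Union>g\<in>ha_hom A (UU P). spec_map A P g ` carrier P),
     eq = (=), le = (\<subseteq>)\<rparr>"

lemma spec_poset_simps [simp]: "le (spec_poset A) = (\<subseteq>)" "eq (spec_poset A) = (=)"
  by (simp_all add: spec_poset_def)

lemma spec_poset_partial_order: "partial_order (spec_poset A)"
  by (rule partial_orderI) auto

lemma spec_map_eq: "x \<in> carrier X \<Longrightarrow> spec_map A X g x = {a \<in> carrier A. x \<in> g a}"
  by (simp add: spec_map_def)

lemma spec_pointI:
  "P \<in> Obj Kp_cat \<Longrightarrow> g \<in> ha_hom A (UU P) \<Longrightarrow> p \<in> carrier P \<Longrightarrow> spec_map A P g p \<in> carrier (spec_poset A)"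
  by (auto simp: spec_poset_def)

lemma spec_pointE:
  assumes "y \<in> carrier (spec_poset A)"
  obtains P g p where "P \<in> Obj Kp_cat" "g \<in> ha_hom A (UU P)" "p \<in> carrier P" "y = spec_map A P g p"
  using assms by (auto simp: spec_poset_def)

lemma spec_point_subset: "x \<in> carrier (spec_poset A) \<Longrightarrow> x \<subseteq> carrier A"
  by (erule spec_pointE) (auto simp: spec_map_eq)

lemma spec_map_inverse: "g \<in> ha_hom A (UU X) \<Longrightarrow> spec_hom A X (spec_map A X g) = g"
  by (intro extensionalityI[OF _ ha_hom_extensional])
    (auto simp: spec_hom_def spec_map_def dest: subsetD[OF upsets_subset[OF hom_UU_upset]])

lemma spec_hom_inverse: "k \<in> open_maps X (spec_poset A) \<Longrightarrow> spec_map A X (spec_hom A X k) = k"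
  by (intro extensionalityI[OF _ open_maps_extensional])
    (auto simp: spec_hom_def spec_map_def dest: subsetD[OF spec_point_subset[OF open_maps_closed]])

lemma spec_map_inj:
  "g \<in> ha_hom A (UU X) \<Longrightarrow> h \<in> ha_hom A (UU X) \<Longrightarrow> spec_map A X g = spec_map A X h \<Longrightarrow> g = h"
  using spec_map_inverse by metis

lemma hom_UU_restrict:
  assumes "heyting_algebra A" "partial_order X" "partial_order Y"
    and "d \<in> open_maps X Y" "g \<in> ha_hom A (UU Y)"
  shows "compose (carrier A) (UU_map X Y d) g \<in> ha_hom A (UU X)"
  using ha_hom_compose UU_map_hom assms by blast

lemma hom_UU_restrict_compose:
  assumes "d \<in> open_maps X Y" "e \<in> open_maps Y Z" "g \<in> ha_hom A (UU Z)"
  shows "compose (carrier A) (UU_map X Z (compose (carrier X) e d)) g =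
    compose (carrier A) (UU_map X Y d) (compose (carrier A) (UU_map Y Z e) g)"
  using ha_hom_funcset[OF assms(3)]
  by (subst compose_assoc[where B = "upsets Z"]) (simp_all add: UU_map_compose[OF assms(1,2)])

lemma spec_map_restrict:
  assumes "d \<in> open_maps X Y" "g \<in> ha_hom A (UU Y)"
  shows "spec_map A X (compose (carrier A) (UU_map X Y d) g) =
      compose (carrier X) (spec_map A Y g) d"
proof (rule extensionalityI)
  fix x assume "x \<in> carrier X"
  then show "spec_map A X (compose (carrier A) (UU_map X Y d) g) x =
      compose (carrier X) (spec_map A Y g) d x"
    using open_maps_closed[OF assms(1)] hom_UU_upset[OF assms(2)]
    by (auto simp: spec_map_eq compose_eq UU_map_eq)
qed (simp_all add: spec_map_def)

lemma finite_directed_witness: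
  assumes "finite T" "c\<^sub>0 \<in> C"
    and directed: "\<And>b c. b \<in> C \<Longrightarrow> c \<in> C \<Longrightarrow> \<exists>d\<in>C. \<forall>t\<in>T. R b t \<or> R c t \<longrightarrow> R d t"
    and pointwise: "\<And>t. t \<in> T \<Longrightarrow> \<exists>c\<in>C. R c t"
  shows "\<exists>c\<in>C. \<forall>t\<in>T. R c t"
proof -
  have "\<exists>c\<in>C. \<forall>t\<in>S. R c t" if "S \<subseteq> T" for S
    using finite_subset[OF that assms(1)] that
  proof (induction S rule: finite_induct)
    case empty
    then show ?case using assms(2) by blast
  next
    case (insert s S)
    then obtain b c where "b \<in> C" "\<forall>t\<in>S. R b t" "c \<in> C" "R c s" using pointwise by blast
    then show ?case using directed[of b c] insert.prems by blast
  qed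
  then show ?thesis by blast
qed

context
  fixes A :: "'a gorder" and X :: "'x gorder" and Y :: "'y gorder" and g h y
  assumes A: "heyting_algebra A" and X: "partial_order X" and Y: "partial_order Y"
    and g: "g \<in> ha_hom A (UU X)" and h: "h \<in> ha_hom A (UU Y)" and y: "y \<in> carrier Y"
begin

lemma finite_meet_separation:
  assumes T: "finite T" "T \<subseteq> carrier X" and sep: "\<And>t. t \<in> T \<Longrightarrow> \<exists>a\<in>carrier A. y \<in> h a \<and> t \<notin> g a"
  shows "\<exists>a\<in>carrier A. y \<in> h a \<and> (\<forall>t\<in>T. t \<notin> g a)"
proof -
  have "\<exists>a\<in>{a \<in> carrier A. y \<in> h a}. \<forall>t\<in>T. t \<notin> g a"
  proof (rule finite_directed_witness[OF T(1)])
    show "\<top>\<^bsub>A\<^esub> \<in> {a \<in> carrier A. y \<in> h a}"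
      using hom_UU_mem(1)[OF Y h y] by (simp add: heyting_closed[OF A])
    fix a b assume "a \<in> {a \<in> carrier A. y \<in> h a}" "b \<in> {a \<in> carrier A. y \<in> h a}"
    then show "\<exists>d\<in>{a \<in> carrier A. y \<in> h a}. \<forall>t\<in>T. t \<notin> g a \<or> t \<notin> g b \<longrightarrow> t \<notin> g d"
      using hom_UU_mem(3)[OF Y h y] hom_UU_mem(3)[OF X g] T(2)
      by (intro bexI[of _ "a \<sqinter>\<^bsub>A\<^esub> b"]) (auto simp: heyting_closed[OF A])
  qed (use sep in auto)
  then show ?thesis by blast
qed

lemma finite_join_separation:
  assumes T: "finite T" "T \<subseteq> carrier X" and sep: "\<And>t. t \<in> T \<Longrightarrow> \<exists>a\<in>carrier A. y \<notin> h a \<and> t \<in> g a"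
  shows "\<exists>a\<in>carrier A. y \<notin> h a \<and> (\<forall>t\<in>T. t \<in> g a)"
proof -
  have "\<exists>a\<in>{a \<in> carrier A. y \<notin> h a}. \<forall>t\<in>T. t \<in> g a"
  proof (rule finite_directed_witness[OF T(1)])
    show "\<bottom>\<^bsub>A\<^esub> \<in> {a \<in> carrier A. y \<notin> h a}"
      using hom_UU_mem(2)[OF Y h y] by (simp add: heyting_closed[OF A])
    fix a b assume "a \<in> {a \<in> carrier A. y \<notin> h a}" "b \<in> {a \<in> carrier A. y \<notin> h a}"
    then show "\<exists>d\<in>{a \<in> carrier A. y \<notin> h a}. \<forall>t\<in>T. t \<in> g a \<or> t \<in> g b \<longrightarrow> t \<in> g d"
      using hom_UU_mem(4)[OF Y h y] hom_UU_mem(4)[OF X g] T(2)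
      by (intro bexI[of _ "a \<squnion>\<^bsub>A\<^esub> b"]) (auto simp: heyting_closed[OF A])
  qed (use sep in auto)
  then show ?thesis by blast
qed

text \<open>
  If every point above \<open>x\<close> differed from \<open>y\<close>, a finite meet \<open>b\<close> and a finite join \<open>c\<close> would
  witness all the differences at once, and \<open>b \<rightarrow> c\<close> would hold at \<open>x\<close> but not at \<open>y\<close>.
\<close>

lemma spec_point_lift:
  assumes x: "x \<in> carrier X" and fin: "finite {x' \<in> carrier X. x \<sqsubseteq>\<^bsub>X\<^esub> x'}"
    and le: "spec_map A X g x \<subseteq> spec_map A Y h y"
  shows "\<exists>x'\<in>carrier X. x \<sqsubseteq>\<^bsub>X\<^esub> x' \<and> spec_map A X g x' = spec_map A Y h y"
proof -
  interpret Y: partial_order Y by (rule Y)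
  let ?up = "{x' \<in> carrier X. x \<sqsubseteq>\<^bsub>X\<^esub> x'}"
  let ?missing = "{t \<in> ?up. \<exists>a\<in>carrier A. y \<in> h a \<and> t \<notin> g a}"
  let ?exceeding = "{t \<in> ?up. \<exists>a\<in>carrier A. y \<notin> h a \<and> t \<in> g a}"
  obtain b where b: "b \<in> carrier A" "y \<in> h b" "\<forall>t\<in>?missing. t \<notin> g b"
    using finite_meet_separation[of ?missing, OF finite_subset[OF _ fin]] by blast
  obtain c where c: "c \<in> carrier A" "y \<notin> h c" "\<forall>t\<in>?exceeding. t \<in> g c"
    using finite_join_separation[of ?exceeding, OF finite_subset[OF _ fin]] by blast
  have "y \<notin> h (himp A b c)"
    using hom_UU_mem(5)[OF Y h y b(1) c(1)] b(2) c(2) y by blast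
  then have "x \<notin> g (himp A b c)"
    using le x y heyting_closed(5)[OF A b(1) c(1)] by (auto simp: spec_map_eq)
  then obtain t where t: "t \<in> carrier X" "x \<sqsubseteq>\<^bsub>X\<^esub> t" "t \<in> g b" "t \<notin> g c"
    using hom_UU_mem(5)[OF X g x b(1) c(1)] by blast
  then have "t \<notin> ?missing" "t \<notin> ?exceeding" using b(3) c(3) by blast+
  then have "spec_map A X g t = spec_map A Y h y"
    using t(1,2) y by (auto simp: spec_map_eq)
  then show ?thesis using t by blast
qed

end

lemma spec_map_closed:
  assumes A: "heyting_algebra A" and X: "X \<in> Obj IKp_cat"
    and g: "g \<in> ha_hom A (UU X)" and x: "x \<in> carrier X"
  shows "spec_map A X g x \<in> carrier (spec_poset A)"
proof -
  obtain P d p where P: "P \<in> Obj Kp_cat" "d \<in> open_maps P X" and p: "p \<in> carrier P" "x = d p"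
    using X x by (rule IKp_chart_at)
  note X = IKp_partial_order[OF X]
  have "spec_map A X g x = spec_map A P (compose (carrier A) (UU_map P X d) g) p"
    using p by (simp add: spec_map_restrict[OF P(2) g] compose_eq)
  then show ?thesis
    using spec_pointI[OF P(1) hom_UU_restrict[OF A Kp_partial_order[OF P(1)] X P(2) g] p(1)] by simp
qed

lemma spec_map_open:
  assumes A: "heyting_algebra A" and X: "X \<in> Obj IKp_cat" and g: "g \<in> ha_hom A (UU X)"
  shows "spec_map A X g \<in> open_maps X (spec_poset A)"
proof (rule open_mapsI)
  show "spec_map A X g \<in> carrier X \<rightarrow>\<^sub>E carrier (spec_poset A)"
    using spec_map_closed[OF A X g] by (auto simp: spec_map_def)
  fix x assume x: "x \<in> carrier X"
  show "spec_map A X g x \<sqsubseteq>\<^bsub>spec_poset A\<^esub> spec_map A X g x'" if "x' \<in> carrier X" "x \<sqsubseteq>\<^bsub>X\<^esub> x'" for x'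
    using upsets_upward[OF hom_UU_upset[OF g], of _ x x'] x that by (auto simp: spec_map_eq)
  show "\<exists>x'\<in>carrier X. x \<sqsubseteq>\<^bsub>X\<^esub> x' \<and> spec_map A X g x' = y"
    if y: "y \<in> carrier (spec_poset A)" and le: "spec_map A X g x \<sqsubseteq>\<^bsub>spec_poset A\<^esub> y" for y
  proof -
    obtain Q h q
      where Q: "Q \<in> Obj Kp_cat" "h \<in> ha_hom A (UU Q)" "q \<in> carrier Q" "y = spec_map A Q h q"
      using y by (rule spec_pointE)
    then show ?thesis
      using spec_point_lift[OF A IKp_partial_order[OF X] Kp_partial_order[OF Q(1)] g Q(2,3) x] X x
        le
      by (simp add: IKp_Obj image_finite_def)
  qed
qed

lemma spec_poset_IKp:
  assumes A: "heyting_algebra A"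
  shows "spec_poset A \<in> Obj IKp_cat"
proof -
  have "finite {z \<in> carrier (spec_poset A). y \<sqsubseteq>\<^bsub>spec_poset A\<^esub> z}"
    if y: "y \<in> carrier (spec_poset A)" for y
  proof -
    obtain P g p
      where P: "P \<in> Obj Kp_cat" "g \<in> ha_hom A (UU P)" "p \<in> carrier P" "y = spec_map A P g p"
      using y by (rule spec_pointE)
    have "{z \<in> carrier (spec_poset A). y \<sqsubseteq>\<^bsub>spec_poset A\<^esub> z} \<subseteq> spec_map A P g ` carrier P"
      using open_maps_lift[OF spec_map_open[OF A Kp_IKp[OF P(1)] P(2)] P(3)] P(4) by blast
    then show ?thesis using P(1) finite_surj by (auto simp: Kp_Obj)
  qed
  then show ?thesis by (simp add: IKp_Obj image_finite_def spec_poset_partial_order)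
qed

lemma spec_point_mem:
  assumes A: "heyting_algebra A" and y: "y \<in> carrier (spec_poset A)"
  shows "\<top>\<^bsub>A\<^esub> \<in> y" "\<bottom>\<^bsub>A\<^esub> \<notin> y"
    and "a \<in> carrier A \<Longrightarrow> b \<in> carrier A \<Longrightarrow> a \<sqinter>\<^bsub>A\<^esub> b \<in> y \<longleftrightarrow> a \<in> y \<and> b \<in> y"
    and "a \<in> carrier A \<Longrightarrow> b \<in> carrier A \<Longrightarrow> a \<squnion>\<^bsub>A\<^esub> b \<in> y \<longleftrightarrow> a \<in> y \<or> b \<in> y"
    and "a \<in> carrier A \<Longrightarrow> b \<in> carrier A \<Longrightarrow> himp A a b \<in> y \<longleftrightarrow>
      (\<forall>z\<in>carrier (spec_poset A). y \<subseteq> z \<longrightarrow> a \<in> z \<longrightarrow> b \<in> z)"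
proof -
  obtain Q h q where Q: "Q \<in> Obj Kp_cat" "h \<in> ha_hom A (UU Q)" "q \<in> carrier Q"
    and "y = spec_map A Q h q"
    using y by (rule spec_pointE)
  then have y_eq: "y = {a \<in> carrier A. q \<in> h a}" by (simp add: spec_map_eq)
  note mem = hom_UU_mem[OF Kp_partial_order[OF Q(1)] Q(2,3)] heyting_closed[OF A]
  show "\<top>\<^bsub>A\<^esub> \<in> y" "\<bottom>\<^bsub>A\<^esub> \<notin> y" using mem by (simp_all add: y_eq)
  assume ab: "a \<in> carrier A" "b \<in> carrier A"
  show "a \<sqinter>\<^bsub>A\<^esub> b \<in> y \<longleftrightarrow> a \<in> y \<and> b \<in> y" "a \<squnion>\<^bsub>A\<^esub> b \<in> y \<longleftrightarrow> a \<in> y \<or> b \<in> y"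
    using mem ab by (simp_all add: y_eq)
  have "himp A a b \<in> y \<longleftrightarrow> (\<forall>q'\<in>carrier Q. q \<sqsubseteq>\<^bsub>Q\<^esub> q' \<longrightarrow> a \<in> spec_map A Q h q' \<longrightarrow> b \<in> spec_map A Q h q')"
    using mem ab by (simp add: y_eq spec_map_eq)
  also have "\<dots> \<longleftrightarrow> (\<forall>z\<in>carrier (spec_poset A). y \<subseteq> z \<longrightarrow> a \<in> z \<longrightarrow> b \<in> z)"
    using open_maps_all_above_iff[OF spec_map_open[OF A Kp_IKp[OF Q(1)] Q(2)] Q(3),
        of "\<lambda>z. a \<in> z \<longrightarrow> b \<in> z"]
      \<open>y = spec_map A Q h q\<close> by simp
  finally show "himp A a b \<in> y \<longleftrightarrow> (\<forall>z\<in>carrier (spec_poset A). y \<subseteq> z \<longrightarrow> a \<in> z \<longrightarrow> b \<in> z)" .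
qed

lemma spec_hom_hom:
  assumes A: "heyting_algebra A" and X: "partial_order X" and k: "k \<in> open_maps X (spec_poset A)"
  shows "spec_hom A X k \<in> ha_hom A (UU X)"
proof (rule hom_UU_I[OF A X])
  note closed = heyting_closed[OF A]
  have "{x \<in> carrier X. a \<in> k x} \<in> upsets X" for a
    using open_maps_mono[OF k] by (auto simp: upsets_def)
  then show "spec_hom A X k \<in> carrier A \<rightarrow>\<^sub>E upsets X" by (simp add: spec_hom_def)
  fix x assume x: "x \<in> carrier X"
  note kx = spec_point_mem[OF A open_maps_closed[OF k x]]
  have mem: "z \<in> spec_hom A X k a \<longleftrightarrow> a \<in> k z" if "a \<in> carrier A" "z \<in> carrier X" for a z
    using that by (simp add: spec_hom_def)
  show "x \<in> spec_hom A X k \<top>\<^bsub>A\<^esub>" "x \<notin> spec_hom A X k \<bottom>\<^bsub>A\<^esub>"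
    using kx x by (simp_all add: mem closed)
  fix a b assume ab: "a \<in> carrier A" "b \<in> carrier A"
  show "x \<in> spec_hom A X k (a \<sqinter>\<^bsub>A\<^esub> b) \<longleftrightarrow> x \<in> spec_hom A X k a \<and> x \<in> spec_hom A X k b"
    and "x \<in> spec_hom A X k (a \<squnion>\<^bsub>A\<^esub> b) \<longleftrightarrow> x \<in> spec_hom A X k a \<or> x \<in> spec_hom A X k b"
    using kx x ab by (simp_all add: mem closed)
  show "x \<in> spec_hom A X k (himp A a b) \<longleftrightarrow>
      (\<forall>x'\<in>carrier X. x \<sqsubseteq>\<^bsub>X\<^esub> x' \<longrightarrow> x' \<in> spec_hom A X k a \<longrightarrow> x' \<in> spec_hom A X k b)"
    using kx(5)[OF ab] open_maps_all_above_iff[OF k x, of "\<lambda>z. a \<in> z \<longrightarrow> b \<in> z"] x ab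
    by (simp add: mem closed)
qed

lemma spec_map_bij:
  assumes "heyting_algebra A" "X \<in> Obj IKp_cat"
  shows "bij_betw (spec_map A X) (ha_hom A (UU X)) (open_maps X (spec_poset A))"
  using spec_map_open[OF assms] spec_hom_hom[OF assms(1) IKp_partial_order[OF assms(2)]]
  by (intro bij_betwI[where g = "spec_hom A X"]) (simp_all add: spec_map_inverse spec_hom_inverse)

section \<open>Sheaves on finite posets\<close>

lemma HA_Obj: "A \<in> Obj HA_cat \<longleftrightarrow> heyting_algebra A"
  by (simp add: HA_cat_def)

lemma cat_simps [simp]:
  "Arr Kp_cat = open_maps" "Ident Kp_cat = (\<lambda>X. \<lambda>x\<in>carrier X. x)"
  "Cmp Kp_cat = (\<lambda>X Y Z g f. compose (carrier X) g f)"
  "Arr IKp_cat = open_maps" "Ident IKp_cat = (\<lambda>X. \<lambda>x\<in>carrier X. x)"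
  "Cmp IKp_cat = (\<lambda>X Y Z g f. compose (carrier X) g f)"
  "Arr HA_cat = ha_hom" "Ident HA_cat = (\<lambda>A. \<lambda>a\<in>carrier A. a)"
  "Cmp HA_cat = (\<lambda>A B C g f. compose (carrier A) g f)"
  "Obj Set_cat = UNIV" "Arr Set_cat = (\<lambda>X Y. X \<rightarrow>\<^sub>E Y)" "Ident Set_cat = (\<lambda>X. \<lambda>x\<in>X. x)"
  "Cmp Set_cat = (\<lambda>X Y Z g f. compose X g f)"
  "Obj Sh_cat = {F. is_sheaf F}" "Arr Sh_cat = psh_hom"
  "Ident Sh_cat = (\<lambda>F. \<lambda>P\<in>Obj Kp_cat. \<lambda>x\<in>fobj F P. x)"
  "Cmp Sh_cat = (\<lambda>F G H \<theta> \<eta>. \<lambda>P\<in>Obj Kp_cat. compose (fobj F P) (\<theta> P) (\<eta> P))"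
  "Obj (op_cat C) = Obj C" "Arr (op_cat C) x y = Arr C y x" "Ident (op_cat C) = Ident C"
  "Cmp (op_cat C) x y z g f = Cmp C z y x f g"
  by (simp_all add: Kp_cat_def IKp_cat_def HA_cat_def Set_cat_def Sh_cat_def op_cat_def)

lemma Spec_bar_simps [simp]:
  "fobj (fobj Spec_bar A) P = ha_hom A (UU P)"
  "fmap (fobj Spec_bar A) P Q f = (\<lambda>g\<in>ha_hom A (UU P). compose (carrier A) (UU_map Q P f) g)"
  "fmap Spec_bar B A h = (\<lambda>P\<in>Obj Kp_cat. \<lambda>g\<in>ha_hom B (UU P). compose (carrier A) g h)"
  by (simp_all add: Spec_bar_def)

lemma IKp_embedding_simps [simp]:
  "fobj (fobj IKp_embedding X) P = open_maps P X"
  "fmap (fobj IKp_embedding X) P Q f = (\<lambda>g\<in>open_maps P X. compose (carrier Q) g f)"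
  "fmap IKp_embedding X Y k = (\<lambda>P\<in>Obj Kp_cat. \<lambda>g\<in>open_maps P X. compose (carrier P) k g)"
  by (simp_all add: IKp_embedding_def)

lemma presheafI:
  assumes "\<And>P Q f x. P \<in> Obj Kp_cat \<Longrightarrow> Q \<in> Obj Kp_cat \<Longrightarrow> f \<in> open_maps Q P \<Longrightarrow>
      fmap F P Q f \<in> fobj F P \<rightarrow>\<^sub>E fobj F Q"
    and "\<And>P x. P \<in> Obj Kp_cat \<Longrightarrow> x \<in> fobj F P \<Longrightarrow> fmap F P P (\<lambda>p\<in>carrier P. p) x = x"
    and "\<And>P Q W f g x. P \<in> Obj Kp_cat \<Longrightarrow> Q \<in> Obj Kp_cat \<Longrightarrow> W \<in> Obj Kp_cat \<Longrightarrow>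
      f \<in> open_maps Q P \<Longrightarrow> g \<in> open_maps W Q \<Longrightarrow> x \<in> fobj F P \<Longrightarrow>
      fmap F P W (compose (carrier W) f g) x = fmap F Q W g (fmap F P Q f x)"
  shows "is_functor (op_cat Kp_cat) Set_cat F"
  unfolding is_functor_def
proof (intro conjI ballI)
  show "fobj F P \<in> Obj Set_cat" for P by simp
  show "fmap F P Q f \<in> Arr Set_cat (fobj F P) (fobj F Q)"
    if "P \<in> Obj (op_cat Kp_cat)" "Q \<in> Obj (op_cat Kp_cat)" "f \<in> Arr (op_cat Kp_cat) P Q" for P Q f
    using that assms(1) by simp
  show "fmap F P P (Ident (op_cat Kp_cat) P) = Ident Set_cat (fobj F P)"
    if "P \<in> Obj (op_cat Kp_cat)" for P
    using that assms(1)[of P P, OF _ _ open_maps_id] assms(2)[of P] Kp_partial_order[of P]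
    by (auto simp: PiE_iff intro!: extensionalityI[where A = "fobj F P"])
  show "fmap F P W (Cmp (op_cat Kp_cat) P Q W g f) =
      Cmp Set_cat (fobj F P) (fobj F Q) (fobj F W) (fmap F Q W g) (fmap F P Q f)"
    if "P \<in> Obj (op_cat Kp_cat)" "Q \<in> Obj (op_cat Kp_cat)" "W \<in> Obj (op_cat Kp_cat)"
      "f \<in> Arr (op_cat Kp_cat) P Q" "g \<in> Arr (op_cat Kp_cat) Q W" for P Q W f g
    using that assms(1)[of P W "compose (carrier W) f g"] assms(3)[of P Q W f g]
      open_maps_compose[of g W Q f P]
    by (auto simp: PiE_iff compose_eq intro!: extensionalityI[where A = "fobj F P"])
qed

lemma presheaf_map_closed:
  "is_functor (op_cat Kp_cat) Set_cat F \<Longrightarrow> P \<in> Obj Kp_cat \<Longrightarrow> Q \<in> Obj Kp_cat \<Longrightarrow>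
    f \<in> open_maps Q P \<Longrightarrow> x \<in> fobj F P \<Longrightarrow> fmap F P Q f x \<in> fobj F Q"
  by (auto simp: is_functor_def)

lemma psh_hom_natural:
  "\<eta> \<in> psh_hom F G \<Longrightarrow> P \<in> Obj Kp_cat \<Longrightarrow> Q \<in> Obj Kp_cat \<Longrightarrow> f \<in> open_maps Q P \<Longrightarrow> x \<in> fobj F P \<Longrightarrow>
    \<eta> Q (fmap F P Q f x) = fmap G P Q f (\<eta> P x)"
  by (simp add: psh_hom_def)

lemma psh_hom_closed: "\<eta> \<in> psh_hom F G \<Longrightarrow> P \<in> Obj Kp_cat \<Longrightarrow> x \<in> fobj F P \<Longrightarrow> \<eta> P x \<in> fobj G P"
  by (auto simp: psh_hom_def)

lemma psh_hom_eqI: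
  assumes "\<eta> \<in> psh_hom F G" "\<theta> \<in> psh_hom F G"
    and "\<And>P x. P \<in> Obj Kp_cat \<Longrightarrow> x \<in> fobj F P \<Longrightarrow> \<eta> P x = \<theta> P x"
  shows "\<eta> = \<theta>"
proof (rule PiE_ext)
  show "\<eta> \<in> (\<Pi>\<^sub>E P\<in>Obj Kp_cat. fobj F P \<rightarrow>\<^sub>E fobj G P)"
    "\<theta> \<in> (\<Pi>\<^sub>E P\<in>Obj Kp_cat. fobj F P \<rightarrow>\<^sub>E fobj G P)"
    using assms(1,2) by (simp_all add: psh_hom_def)
  then show "\<eta> P = \<theta> P" if "P \<in> Obj Kp_cat" for P
    using that assms(3)[OF that] by (blast intro: PiE_ext[of "\<eta> P" "fobj F P" "\<lambda>_. fobj G P"])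
qed

lemma psh_iso_hom: "psh_iso F G \<eta> \<Longrightarrow> \<eta> \<in> psh_hom F G"
  by (simp add: psh_iso_def)

lemma psh_iso_bij: "psh_iso F G \<eta> \<Longrightarrow> P \<in> Obj Kp_cat \<Longrightarrow> bij_betw (\<eta> P) (fobj F P) (fobj G P)"
  by (simp add: psh_iso_def)

lemma psh_iso_span:
  assumes F: "is_functor (op_cat Kp_cat) Set_cat F" and \<alpha>: "psh_iso F G \<alpha>" and \<beta>: "psh_iso F H \<beta>"
  obtains \<eta> where "psh_iso G H \<eta>"
    "\<And>P x. P \<in> Obj Kp_cat \<Longrightarrow> x \<in> fobj F P \<Longrightarrow> \<eta> P (\<alpha> P x) = \<beta> P x"
proof
  let ?inv = "\<lambda>P. inv_into (fobj F P) (\<alpha> P)"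
  let ?\<eta> = "\<lambda>P\<in>Obj Kp_cat. \<lambda>y\<in>fobj G P. \<beta> P (?inv P y)"
  note bij = psh_iso_bij[OF \<alpha>] psh_iso_bij[OF \<beta>]
  show \<eta>_\<alpha>: "?\<eta> P (\<alpha> P x) = \<beta> P x" if "P \<in> Obj Kp_cat" "x \<in> fobj F P" for P x
    using that psh_hom_closed[OF psh_iso_hom[OF \<alpha>] that]
    by (simp add: inv_into_f_f[OF bij_betw_imp_inj_on[OF bij(1)]])
  have \<eta>_bij: "bij_betw (?\<eta> P) (fobj G P) (fobj H P)" if P: "P \<in> Obj Kp_cat" for P
    using bij_betw_trans[OF bij_betw_inv_into[OF bij(1)[OF P]] bij(2)[OF P]] P
    by (simp add: comp_def cong: bij_betw_cong)
  have natural: "?\<eta> Q (fmap G P Q f y) = fmap H P Q f (?\<eta> P y)"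
    if PQ: "P \<in> Obj Kp_cat" "Q \<in> Obj Kp_cat" "f \<in> open_maps Q P" and y: "y \<in> fobj G P" for P Q f y
  proof -
    obtain x where x: "x \<in> fobj F P" "y = \<alpha> P x"
      using bij_betw_imp_surj_on[OF bij(1)[OF PQ(1)]] y by blast
    have "?\<eta> Q (fmap G P Q f y) = ?\<eta> Q (\<alpha> Q (fmap F P Q f x))"
      using psh_hom_natural[OF psh_iso_hom[OF \<alpha>] PQ x(1)] x(2) by simp
    also have "\<dots> = \<beta> Q (fmap F P Q f x)"
      by (rule \<eta>_\<alpha>[OF PQ(2) presheaf_map_closed[OF F PQ x(1)]])
    also have "\<dots> = fmap H P Q f (\<beta> P x)" by (rule psh_hom_natural[OF psh_iso_hom[OF \<beta>] PQ x(1)])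
    also have "\<beta> P x = ?\<eta> P y" using \<eta>_\<alpha>[OF PQ(1) x(1)] x(2) by simp
    finally show ?thesis .
  qed
  show "psh_iso G H ?\<eta>"
    unfolding psh_iso_def psh_hom_def
    using \<eta>_bij bij_betwE[OF \<eta>_bij] natural by (auto simp: PiE_iff)
qed

lemma sheaf_iso_transfer:
  assumes F: "is_functor (op_cat Kp_cat) Set_cat F" and G: "is_sheaf G" and \<eta>: "psh_iso F G \<eta>"
  shows "is_sheaf F"
  unfolding is_sheaf_def
proof (intro conjI F ballI allI impI)
  fix P R s
  assume P: "P \<in> Obj Kp_cat" and "covering_sieve P R \<and> matching_family F P R s"
  then have R: "covering_sieve P R" "sieve P R" and s: "matching_family F P R s"
    by (auto simp: covering_sieve_def)
  have Q: "Q \<in> Obj Kp_cat" "f \<in> open_maps Q P" "s Q f \<in> fobj F Q" if "(Q, f) \<in> R" for Q f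
    using R(2) s that by (auto simp: sieve_def matching_family_def)
  note closed = psh_hom_closed[OF psh_iso_hom[OF \<eta>]]
    and natural = psh_hom_natural[OF psh_iso_hom[OF \<eta>]]
    and inj = bij_betw_imp_inj_on[OF psh_iso_bij[OF \<eta>]]
  have "s Q' (compose (carrier Q') f g) = fmap F Q Q' g (s Q f)"
    if "(Q, f) \<in> R" "Q' \<in> Obj Kp_cat" "g \<in> open_maps Q' Q" for Q f Q' g
    using s that by (fastforce simp: matching_family_def)
  then have "matching_family G P R (\<lambda>Q f. \<eta> Q (s Q f))"
    using Q closed natural by (auto simp: matching_family_def)
  then obtain u where u: "u \<in> fobj G P" "\<forall>(Q, f)\<in>R. fmap G P Q f u = \<eta> Q (s Q f)"
    and unique: "\<And>v. v \<in> fobj G P \<Longrightarrow> \<forall>(Q, f)\<in>R. fmap G P Q f v = \<eta> Q (s Q f) \<Longrightarrow> v = u"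
    using G P R(1) unfolding is_sheaf_def by blast
  obtain t where t: "t \<in> fobj F P" "u = \<eta> P t"
    using u(1) bij_betw_imp_surj_on[OF psh_iso_bij[OF \<eta> P]] by blast
  have restrict_iff: "fmap G P Q f (\<eta> P t) = \<eta> Q (s Q f) \<longleftrightarrow> fmap F P Q f t = s Q f"
    if "t \<in> fobj F P" "(Q, f) \<in> R" for t Q f
    using natural[OF P Q(1,2)[OF that(2)] that(1)]
      presheaf_map_closed[OF F P Q(1,2)[OF that(2)] that(1)]
      inj_on_eq_iff[OF inj[OF Q(1)[OF that(2)]]] Q(3)[OF that(2)] by metis
  show "\<exists>!t. t \<in> fobj F P \<and> (\<forall>(Q, f)\<in>R. fmap F P Q f t = s Q f)"
  proof (rule ex1I[of _ t])
    show "t \<in> fobj F P \<and> (\<forall>(Q, f)\<in>R. fmap F P Q f t = s Q f)"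
      using u(2) t restrict_iff by blast
    fix t' assume t': "t' \<in> fobj F P \<and> (\<forall>(Q, f)\<in>R. fmap F P Q f t' = s Q f)"
    then have "\<eta> P t' = \<eta> P t"
      unfolding t(2)[symmetric] using restrict_iff closed[OF P] by (intro unique) blast+
    then show "t' = t" using t(1) t' inj_onD[OF inj[OF P]] by blast
  qed
qed

lemma IKp_embedding_presheaf: "is_functor (op_cat Kp_cat) Set_cat (fobj IKp_embedding X)"
proof (rule presheafI)
  fix P Q W :: "nat gorder" and f g x
  assume f: "f \<in> open_maps Q P" and g: "g \<in> open_maps W Q"
    and x: "x \<in> fobj (fobj IKp_embedding X) P"
  then show "fmap (fobj IKp_embedding X) P W (compose (carrier W) f g) x =
      fmap (fobj IKp_embedding X) Q W g (fmap (fobj IKp_embedding X) P Q f x)"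
    using compose_assoc[OF open_maps_funcset[OF g]] by (simp add: open_maps_compose)
qed (auto simp: open_maps_compose compose_Id[OF open_maps_funcset open_maps_extensional])

lemma IKp_embedding_sheaf: "is_sheaf (fobj IKp_embedding X)"
  unfolding is_sheaf_def
proof (intro conjI IKp_embedding_presheaf ballI allI impI)
  fix P R s
  assume "P \<in> Obj Kp_cat" "covering_sieve P R \<and> matching_family (fobj IKp_embedding X) P R s"
  then have R: "sieve P R" "(\<Union>(Q, f)\<in>R. f ` carrier Q) = carrier P"
    and s: "matching_family (fobj IKp_embedding X) P R s"
    by (auto simp: covering_sieve_def)
  have Q: "Q \<in> Obj Kp_cat" "f \<in> open_maps Q P" "s Q f \<in> open_maps Q X" if "(Q, f) \<in> R" for Q f
    using R(1) s that by (auto simp: sieve_def matching_family_def)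
  have "\<exists>!k. k \<in> open_maps P X \<and> (\<forall>(Q, f)\<in>R. compose (carrier Q) k f = s Q f)"
  proof (rule open_maps_amalgamation)
    show "s W (compose (carrier W) f u) = compose (carrier W) (s Q f) u"
      if "(Q, f) \<in> R" "W \<in> Obj Kp_cat" "u \<in> open_maps W Q" for Q f W u
      using s that Q(3)[OF that(1)] by (fastforce simp: matching_family_def)
  qed (use Q equalityD2[OF R(2)] in blast)+
  then show "\<exists>!t. t \<in> fobj (fobj IKp_embedding X) P \<and>
      (\<forall>(Q, f)\<in>R. fmap (fobj IKp_embedding X) P Q f t = s Q f)"
    by (simp cong: conj_cong)
qed

lemma Spec_bar_presheaf:
  assumes A: "heyting_algebra A"
  shows "is_functor (op_cat Kp_cat) Set_cat (fobj Spec_bar A)"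
proof (rule presheafI)
  note poset = Kp_partial_order
  fix P :: "nat gorder" assume P: "P \<in> Obj Kp_cat"
  show "fmap (fobj Spec_bar A) P P (\<lambda>p\<in>carrier P. p) g = g" if "g \<in> fobj (fobj Spec_bar A) P" for g
    using that Id_compose[of g "carrier A" "upsets P"] ha_hom_funcset[of g A "UU P"]
      ha_hom_extensional[of g A]
    by (simp add: UU_map_id)
  fix Q f assume Q: "Q \<in> Obj Kp_cat" and f: "f \<in> open_maps Q P"
  show "fmap (fobj Spec_bar A) P Q f \<in> fobj (fobj Spec_bar A) P \<rightarrow>\<^sub>E fobj (fobj Spec_bar A) Q"
    using hom_UU_restrict[OF A poset[OF Q] poset[OF P] f] by simp
  show "fmap (fobj Spec_bar A) P W (compose (carrier W) f g) h =
      fmap (fobj Spec_bar A) Q W g (fmap (fobj Spec_bar A) P Q f h)"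
    if "g \<in> open_maps W Q" "h \<in> fobj (fobj Spec_bar A) P" for W g h
    using that hom_UU_restrict[OF A poset[OF Q] poset[OF P] f] hom_UU_restrict_compose[OF that(1) f]
    by simp
qed

definition spec_iso :: "'a gorder \<Rightarrow> nat gorder \<Rightarrow> ('a \<Rightarrow> nat set) \<Rightarrow> nat \<Rightarrow> 'a set" where
  "spec_iso A = (\<lambda>P\<in>Obj Kp_cat. \<lambda>g\<in>ha_hom A (UU P). spec_map A P g)"

lemma spec_iso_eq: "P \<in> Obj Kp_cat \<Longrightarrow> g \<in> ha_hom A (UU P) \<Longrightarrow> spec_iso A P g = spec_map A P g"
  by (simp add: spec_iso_def)

lemma spec_iso_psh_iso:
  assumes A: "heyting_algebra A"
  shows "psh_iso (fobj Spec_bar A) (fobj IKp_embedding (spec_poset A)) (spec_iso A)"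
proof -
  note bij = spec_map_bij[OF A Kp_IKp] and poset = Kp_partial_order
  have "spec_iso A Q (fmap (fobj Spec_bar A) P Q f g) =
      fmap (fobj IKp_embedding (spec_poset A)) P Q f (spec_iso A P g)"
    if "P \<in> Obj Kp_cat" "Q \<in> Obj Kp_cat" and f: "f \<in> open_maps Q P"
      and g: "g \<in> ha_hom A (UU P)" for P Q f g
    using that hom_UU_restrict[OF A poset[OF that(2)] poset[OF that(1)] f g]
      bij_betwE[OF bij[OF that(1)]]
    by (simp add: spec_iso_eq spec_map_restrict)
  moreover have "bij_betw (spec_iso A P) (ha_hom A (UU P)) (open_maps P (spec_poset A))"
    if "P \<in> Obj Kp_cat" for P
    using bij[OF that] that by (simp add: spec_iso_eq cong: bij_betw_cong)
  ultimately show ?thesis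
    using bij_betwE[OF bij] by (auto simp: psh_iso_def psh_hom_def PiE_iff spec_iso_def)
qed

lemma Spec_bar_sheaf: "heyting_algebra A \<Longrightarrow> is_sheaf (fobj Spec_bar A)"
  by (rule sheaf_iso_transfer[OF Spec_bar_presheaf IKp_embedding_sheaf spec_iso_psh_iso])

lemma Spec_bar_map_psh_hom:
  assumes A: "heyting_algebra A" and B: "heyting_algebra B" and h: "h \<in> ha_hom A B"
  shows "fmap Spec_bar B A h \<in> psh_hom (fobj Spec_bar B) (fobj Spec_bar A)"
proof -
  have "compose (carrier A) g h \<in> ha_hom A (UU P)" if "g \<in> ha_hom B (UU P)" for g
    and P :: "nat gorder"
    by (rule ha_hom_compose[OF A h that])
  moreover have "compose (carrier A) (compose (carrier B) (UU_map Q P f) g) h =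
      compose (carrier A) (UU_map Q P f) (compose (carrier A) g h)" for P Q :: "nat gorder" and f g
    by (rule compose_assoc[OF ha_hom_funcset[OF h], symmetric])
  ultimately show ?thesis
    using hom_UU_restrict[OF B Kp_partial_order Kp_partial_order] by (simp add: psh_hom_def)
qed

theorem Spec_bar_functor: "is_functor (op_cat HA_cat) Sh_cat Spec_bar"
  unfolding is_functor_def
proof (intro conjI ballI)
  show "fobj Spec_bar A \<in> Obj Sh_cat" if "A \<in> Obj (op_cat HA_cat)" for A
    using that Spec_bar_sheaf by (simp add: HA_Obj)
  show "fmap Spec_bar A A (Ident (op_cat HA_cat) A) = Ident Sh_cat (fobj Spec_bar A)" for A
    by (simp add: fun_eq_iff compose_Id[OF ha_hom_funcset ha_hom_extensional])
  show "fmap Spec_bar B A h \<in> Arr Sh_cat (fobj Spec_bar B) (fobj Spec_bar A)"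
    if "B \<in> Obj (op_cat HA_cat)" "A \<in> Obj (op_cat HA_cat)" "h \<in> Arr (op_cat HA_cat) B A" for A B h
    using that Spec_bar_map_psh_hom by (simp add: HA_Obj del: Spec_bar_simps)
  show "fmap Spec_bar B C (Cmp (op_cat HA_cat) B A C k h) =
      Cmp Sh_cat (fobj Spec_bar B) (fobj Spec_bar A) (fobj Spec_bar C) (fmap Spec_bar A C k)
        (fmap Spec_bar B A h)"
    if "A \<in> Obj (op_cat HA_cat)" "h \<in> Arr (op_cat HA_cat) B A" "k \<in> Arr (op_cat HA_cat) A C"
      for A B C h k
    using that compose_assoc[OF ha_hom_funcset[of k C A]]
    by (auto simp: HA_Obj ha_hom_compose compose_def[of "ha_hom B _"] intro!: restrict_ext)
qed

section \<open>Factorizations through image finite posets\<close>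

definition spec_poset_map :: "'b gorder \<Rightarrow> 'a gorder \<Rightarrow> ('a \<Rightarrow> 'b) \<Rightarrow> 'b set \<Rightarrow> 'a set" where
  "spec_poset_map B A h = (\<lambda>x\<in>carrier (spec_poset B). {a \<in> carrier A. h a \<in> x})"

definition Spec_functor :: "('a gorder, 'a \<Rightarrow> 'a, 'a set gorder, 'a set \<Rightarrow> 'a set) functr" where
  "Spec_functor = \<lparr>fobj = spec_poset, fmap = spec_poset_map\<rparr>"

lemma Spec_functor_simps [simp]:
  "fobj Spec_functor = spec_poset"
  "fmap Spec_functor = spec_poset_map"
  by (simp_all add: Spec_functor_def)

lemma spec_map_compose:
  assumes B: "heyting_algebra B" and h: "h \<in> ha_hom A B" and X: "X \<in> Obj IKp_cat"
    and g: "g \<in> ha_hom B (UU X)"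
  shows "spec_map A X (compose (carrier A) g h) =
      compose (carrier X) (spec_poset_map B A h) (spec_map B X g)"
  using ha_hom_closed[OF h] spec_map_closed[OF B X g]
  by (auto simp: fun_eq_iff compose_def spec_poset_map_def spec_map_def)

lemma spec_poset_map_open:
  assumes A: "heyting_algebra A" and B: "heyting_algebra B" and h: "h \<in> ha_hom A B"
  shows "spec_poset_map B A h \<in> open_maps (spec_poset B) (spec_poset A)"
proof (rule open_maps_local)
  fix x assume "x \<in> carrier (spec_poset B)"
  then obtain P g p
    where P: "P \<in> Obj Kp_cat" "g \<in> ha_hom B (UU P)" "p \<in> carrier P" "x = spec_map B P g p"
    by (rule spec_pointE)
  have "compose (carrier P) (spec_poset_map B A h) (spec_map B P g) \<in> open_maps P (spec_poset A)"
    using spec_map_open[OF A Kp_IKp[OF P(1)] ha_hom_compose[OF A h P(2)]]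
      spec_map_compose[OF B h Kp_IKp[OF P(1)] P(2)]
    by simp
  then show "\<exists>(P :: nat gorder) f. f \<in> open_maps P (spec_poset B) \<and> x \<in> f ` carrier P \<and>
      compose (carrier P) (spec_poset_map B A h) f \<in> open_maps P (spec_poset A)"
    using spec_map_open[OF B Kp_IKp[OF P(1)] P(2)] P(3,4) by blast
qed (simp add: spec_poset_map_def)

lemma Spec_functor_functor: "is_functor (op_cat HA_cat) IKp_cat Spec_functor"
  unfolding is_functor_def
proof (intro conjI ballI)
  show "fobj Spec_functor A \<in> Obj IKp_cat" if "A \<in> Obj (op_cat HA_cat)" for A :: "'a gorder"
    using that spec_poset_IKp by (simp add: HA_Obj)
  have "{a \<in> carrier A. (\<lambda>a\<in>carrier A. a) a \<in> x} = x"
    if "x \<in> carrier (spec_poset A)" for A :: "'a gorder" and x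
    using spec_point_subset[OF that] by auto
  then show "fmap Spec_functor A A (Ident (op_cat HA_cat) A) = Ident IKp_cat (fobj Spec_functor A)"
    for A :: "'a gorder"
    by (simp add: spec_poset_map_def fun_eq_iff)
  show "fmap Spec_functor B A h \<in> Arr IKp_cat (fobj Spec_functor B) (fobj Spec_functor A)"
    if "B \<in> Obj (op_cat HA_cat)" "A \<in> Obj (op_cat HA_cat)" "h \<in> Arr (op_cat HA_cat) B A"
      for A B :: "'a gorder" and h
    using that spec_poset_map_open by (simp add: HA_Obj)
  show "fmap Spec_functor B C (Cmp (op_cat HA_cat) B A C k h) =
      Cmp IKp_cat (fobj Spec_functor B) (fobj Spec_functor A) (fobj Spec_functor C)
        (fmap Spec_functor A C k) (fmap Spec_functor B A h)"
    if "B \<in> Obj (op_cat HA_cat)" "A \<in> Obj (op_cat HA_cat)" "h \<in> Arr (op_cat HA_cat) B A"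
      and "k \<in> Arr (op_cat HA_cat) A C" for A B C :: "'a gorder" and h k
    using that ha_hom_closed[of k C A] open_maps_closed[OF spec_poset_map_open[of A B h]]
    by (auto simp: HA_Obj fun_eq_iff compose_def spec_poset_map_def)
qed

theorem Spec_functor_factorization: "IKp_factorization Spec_functor spec_iso"
  unfolding IKp_factorization_def
proof (intro conjI ballI)
  show "psh_iso (fobj Spec_bar A) (fobj IKp_embedding (fobj Spec_functor A)) (spec_iso A)"
    if "A \<in> Obj HA_cat" for A :: "'a gorder"
    using that spec_iso_psh_iso by (simp add: HA_Obj)
  show "spec_iso A P (fmap Spec_bar B A h P g) =
      fmap IKp_embedding (fobj Spec_functor B) (fobj Spec_functor A) (fmap Spec_functor B A h) P
        (spec_iso B P g)"
    if "A \<in> Obj HA_cat" "B \<in> Obj HA_cat" "h \<in> ha_hom A B" "P \<in> Obj Kp_cat"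
      "g \<in> fobj (fobj Spec_bar B) P"
    for A B :: "'a gorder" and h P g
    using that ha_hom_compose[of A h B g] spec_map_open[OF _ Kp_IKp, of B P g]
      spec_map_compose[OF _ _ Kp_IKp, of B h A P g]
    by (simp add: HA_Obj spec_iso_eq)
qed (rule Spec_functor_functor)

text \<open>Unlike \<open>fmap IKp_embedding\<close>, this allows the points of the two posets to have different types.\<close>

definition embedding_map :: "'x gorder \<Rightarrow> ('x \<Rightarrow> 'y) \<Rightarrow> nat gorder \<Rightarrow> (nat \<Rightarrow> 'x) \<Rightarrow> nat \<Rightarrow> 'y" where
  "embedding_map X k = (\<lambda>P\<in>Obj Kp_cat. \<lambda>f\<in>open_maps P X. compose (carrier P) k f)"

lemma embedding_map_eq:
  "P \<in> Obj Kp_cat \<Longrightarrow> f \<in> open_maps P X \<Longrightarrow> embedding_map X k P f = compose (carrier P) k f"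
  by (simp add: embedding_map_def)

lemma IKp_embedding_fully_faithful:
  fixes X :: "'x gorder" and Y :: "'y gorder"
  assumes X: "X \<in> Obj IKp_cat"
  shows "bij_betw (embedding_map X) (open_maps X Y)
      (psh_hom (fobj IKp_embedding X) (fobj IKp_embedding Y))"
    (is "bij_betw _ _ ?H")
proof -
  have "compose (carrier Q) k (compose (carrier Q) g f) =
      compose (carrier Q) (compose (carrier P) k g) f"
    if "f \<in> open_maps Q P" for k :: "'x \<Rightarrow> 'y" and P Q :: "nat gorder" and f g
    by (rule compose_assoc[OF open_maps_funcset[OF that]])
  then have map_in: "embedding_map X k \<in> ?H" if "k \<in> open_maps X Y" for k
    using that by (simp add: psh_hom_def embedding_map_def open_maps_compose)
  have "\<exists>!k. k \<in> open_maps X Y \<and> embedding_map X k = \<eta>" if \<eta>: "\<eta> \<in> ?H" for \<eta>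
  proof -
    let ?R = "{(P, f). P \<in> Obj Kp_cat \<and> f \<in> open_maps P X}"
    have "\<exists>!k. k \<in> open_maps X Y \<and> (\<forall>(P, f)\<in>?R. compose (carrier P) k f = \<eta> P f)"
    proof (rule open_maps_amalgamation)
      show "carrier X \<subseteq> (\<Union>(P, f)\<in>?R. f ` carrier P)"
      proof
        fix x assume "x \<in> carrier X"
        then obtain P d p where "(P, d) \<in> ?R" "p \<in> carrier P" "x = d p"
          using IKp_chart_at[OF X] by (metis (mono_tags, lifting) case_prodI mem_Collect_eq)
        then show "x \<in> (\<Union>(P, f)\<in>?R. f ` carrier P)" by blast
      qed
      show "\<eta> P f \<in> open_maps P Y" if "(P, f) \<in> ?R" for P f using psh_hom_closed[OF \<eta>] that by simp
      show "\<eta> Q (compose (carrier Q) f u) = compose (carrier Q) (\<eta> P f) u"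
        if "(P, f) \<in> ?R" "Q \<in> Obj Kp_cat" "u \<in> open_maps Q P" for P f Q u
        using psh_hom_natural[OF \<eta>, of P Q u f] psh_hom_closed[OF \<eta>, of P f] that by simp
    qed simp_all
    moreover have "(\<forall>(P, f)\<in>?R. compose (carrier P) k f = \<eta> P f) \<longleftrightarrow> embedding_map X k = \<eta>"
      if "k \<in> open_maps X Y" for k
      using psh_hom_eqI[OF map_in[OF that] \<eta>] by (auto simp: embedding_map_eq)
    ultimately show ?thesis by (simp cong: conj_cong)
  qed
  then show ?thesis using map_in by (intro bij_betwI') metis+
qed

lemma IKp_embedding_reflects_iso:
  assumes X: "X \<in> Obj IKp_cat" and Y: "Y \<in> Obj IKp_cat" and k: "k \<in> open_maps X Y"
    and iso: "psh_iso (fobj IKp_embedding X) (fobj IKp_embedding Y) (embedding_map X k)"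
  shows "bij_betw k (carrier X) (carrier Y)"
proof -
  have bij: "bij_betw (compose (carrier P) k) (open_maps P X) (open_maps P Y)"
    if "P \<in> Obj Kp_cat" for P
    using psh_iso_bij[OF iso that] that by (simp add: embedding_map_def)
  have "inj_on k (carrier X)"
  proof (rule inj_onI)
    fix x x' assume x: "x \<in> carrier X" "x' \<in> carrier X" "k x = k x'"
    obtain P d p where P: "P \<in> Obj Kp_cat" "d \<in> open_maps P X" "p \<in> carrier P" "x = d p"
      using X x(1) by (rule IKp_chart_at)
    obtain Q e q where Q: "Q \<in> Obj Kp_cat" "e \<in> open_maps Q X" "q \<in> carrier Q" "x' = e q"
      using X x(2) by (rule IKp_chart_at)
    have "compose (carrier P) k d p = compose (carrier Q) k e q"
      using x(3) P Q by (simp add: compose_eq)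
    then obtain W u v w where W: "W \<in> Obj Kp_cat" "u \<in> open_maps W P" "v \<in> open_maps W Q"
      "compose (carrier W) (compose (carrier P) k d) u =
          compose (carrier W) (compose (carrier Q) k e) v"
      "w \<in> carrier W" "u w = p" "v w = q"
      by (rule Kp_pullback[OF P(1) Q(1) open_maps_compose[OF P(2) k] open_maps_compose[OF Q(2) k]
          P(3) Q(3)])
    have "compose (carrier W) k (compose (carrier W) d u) =
        compose (carrier W) k (compose (carrier W) e v)"
      using W(4)
      by (simp add: compose_assoc[OF open_maps_funcset[OF W(2)]]
          compose_assoc[OF open_maps_funcset[OF W(3)]])
    then have "compose (carrier W) d u = compose (carrier W) e v"
      using inj_onD[OF bij_betw_imp_inj_on[OF bij[OF W(1)]]] open_maps_compose[OF W(2) P(2)]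
        open_maps_compose[OF W(3) Q(2)]
      by blast
    then show "x = x'" using W(5-7) P(4) Q(4) by (metis compose_eq)
  qed
  moreover have "y \<in> k ` carrier X" if y: "y \<in> carrier Y" for y
  proof -
    obtain P d p where P: "P \<in> Obj Kp_cat" "d \<in> open_maps P Y" "p \<in> carrier P" "y = d p"
      using Y y by (rule IKp_chart_at)
    then obtain f where "f \<in> open_maps P X" "d = compose (carrier P) k f"
      using bij_betw_imp_surj_on[OF bij[OF P(1)]] by blast
    then show ?thesis using P(3,4) open_maps_closed[of f P X p] by (simp add: compose_eq)
  qed
  ultimately show ?thesis using open_maps_closed[OF k] by (auto simp: bij_betw_def)
qed

lemma hom_UU_eqI:
  assumes X: "X \<in> Obj IKp_cat" and g: "g \<in> ha_hom A (UU X)" and h: "h \<in> ha_hom A (UU X)"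
    and eq: "\<And>P d. P \<in> Obj Kp_cat \<Longrightarrow> d \<in> open_maps P X \<Longrightarrow>
      compose (carrier A) (UU_map P X d) g = compose (carrier A) (UU_map P X d) h"
  shows "g = h"
proof (rule ha_hom_eqI[OF g h])
  fix a assume a: "a \<in> carrier A"
  have "x \<in> g a \<longleftrightarrow> x \<in> h a" if x: "x \<in> carrier X" for x
  proof -
    obtain P d p where P: "P \<in> Obj Kp_cat" "d \<in> open_maps P X" "p \<in> carrier P" "x = d p"
      using X x by (rule IKp_chart_at)
    have "UU_map P X d (g a) = UU_map P X d (h a)"
      using fun_cong[OF eq[OF P(1,2)], of a] a by (simp add: compose_eq)
    then show ?thesis
      using P(3,4) hom_UU_upset[OF g a] hom_UU_upset[OF h a] by (auto simp: UU_map_eq)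
  qed
  then show "g a = h a"
    using upsets_subset[OF hom_UU_upset[OF g a]] upsets_subset[OF hom_UU_upset[OF h a]] by blast
qed

lemma open_maps_compose_bij:
  assumes k: "k \<in> open_maps X Y" and bij: "bij_betw k (carrier X) (carrier Y)"
  shows "bij_betw (compose (carrier Z) k) (open_maps Z X) (open_maps Z Y)"
proof -
  let ?i = "\<lambda>y\<in>carrier Y. inv_into (carrier X) k y"
  have ran: "k ` carrier X = carrier Y" using bij by (rule bij_betw_imp_surj_on)
  have "compose (carrier Z) ?i (compose (carrier Z) k f) = f" if f: "f \<in> open_maps Z X" for f
    by (simp add: compose_assoc[OF open_maps_funcset[OF f]] compose_inv_into_id[OF bij]
        Id_compose[OF open_maps_funcset[OF f] open_maps_extensional[OF f]])
  moreover have "compose (carrier Z) k (compose (carrier Z) ?i g) = g"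
    if g: "g \<in> open_maps Z Y" for g
    by (simp add: compose_assoc[OF open_maps_funcset[OF g]] compose_id_inv_into[OF ran]
        Id_compose[OF open_maps_funcset[OF g] open_maps_extensional[OF g]])
  ultimately show ?thesis
    using open_maps_compose[OF _ k] open_maps_compose[OF _ open_maps_inv_into[OF k bij]]
    by (intro bij_betwI[where g = "compose (carrier Z) ?i"]) auto
qed

locale spectrum =
  fixes A :: "'a gorder" and X :: "'x gorder" and \<epsilon> :: "'a \<Rightarrow> 'x set"
  assumes heyting: "heyting_algebra A" and IKp: "X \<in> Obj IKp_cat" and hom: "\<epsilon> \<in> ha_hom A (UU X)"
    and spec_bij: "bij_betw (spec_map A X \<epsilon>) (carrier X) (carrier (spec_poset A))"
begin

lemmas poset = IKp_partial_order[OF IKp]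
  and upset = hom_UU_upset[OF hom]
  and spec_open = spec_map_open[OF heyting IKp hom]

theorem universal:
  assumes Z: "Z \<in> Obj IKp_cat"
  shows "bij_betw (\<lambda>f. compose (carrier A) (UU_map Z X f) \<epsilon>) (open_maps Z X) (ha_hom A (UU Z))"
proof (subst bij_betw_comp_iff2[OF spec_map_bij[OF heyting Z]])
  show "(\<lambda>f. compose (carrier A) (UU_map Z X f) \<epsilon>) ` open_maps Z X \<subseteq> ha_hom A (UU Z)"
    using hom_UU_restrict[OF heyting IKp_partial_order[OF Z] poset _ hom] by blast
  show "bij_betw (spec_map A Z \<circ> (\<lambda>f. compose (carrier A) (UU_map Z X f) \<epsilon>))
      (open_maps Z X) (open_maps Z (spec_poset A))"
    using open_maps_compose_bij[OF spec_open spec_bij]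
    by (simp add: spec_map_restrict[OF _ hom] cong: bij_betw_cong)
qed

lemma le_iff: "x \<in> carrier X \<Longrightarrow> y \<in> carrier X \<Longrightarrow> x \<sqsubseteq>\<^bsub>X\<^esub> y \<longleftrightarrow> (\<forall>a\<in>carrier A. x \<in> \<epsilon> a \<longrightarrow> y \<in> \<epsilon> a)"
  using open_maps_mono[OF spec_open, of x y] open_inj_reflects_le[OF spec_open
      bij_betw_imp_inj_on[OF spec_bij], of x y]
  by (auto simp: spec_map_eq)

lemma ex_principal:
  assumes F: "F \<in> fin_upsets X" and x: "x \<in> F"
  shows "\<exists>a\<in>carrier A. \<forall>y\<in>F. y \<in> \<epsilon> a \<longleftrightarrow> x \<sqsubseteq>\<^bsub>X\<^esub> y"
proof -
  note F = fin_upsetsD[OF F]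
  have x_in: "x \<in> carrier X" using x F(3) by blast
  have "\<exists>a\<in>carrier A. x \<in> \<epsilon> a \<and> (\<forall>y\<in>{y \<in> F. \<not> x \<sqsubseteq>\<^bsub>X\<^esub> y}. y \<notin> \<epsilon> a)"
    by (rule finite_meet_separation[OF heyting poset poset hom hom x_in])
      (use F x_in le_iff in auto)
  then obtain a where a: "a \<in> carrier A" "x \<in> \<epsilon> a" "\<And>y. y \<in> F \<Longrightarrow> \<not> x \<sqsubseteq>\<^bsub>X\<^esub> y \<Longrightarrow> y \<notin> \<epsilon> a"
    by blast
  moreover have "y \<in> \<epsilon> a" if "y \<in> F" "x \<sqsubseteq>\<^bsub>X\<^esub> y" for y
    using upsets_upward[OF upset[OF a(1)] a(2)] that F(3) by blast
  ultimately show ?thesis by blast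
qed

lemma restriction_surj:
  assumes F: "F \<in> fin_upsets X" and V: "V \<in> upsets (X\<lparr>carrier := F\<rparr>)"
  shows "\<exists>a\<in>carrier A. \<epsilon> a \<inter> F = V"
proof -
  interpret X: partial_order X by (rule poset)
  note F_fin = fin_upsetsD[OF F]
  note mem = hom_UU_mem[OF poset hom subsetD[OF F_fin(3)]]
  have VF: "V \<subseteq> F" using upsets_subset[OF V] by simp
  let ?C = "{a \<in> carrier A. \<epsilon> a \<inter> F \<subseteq> V}"
  have "\<exists>a\<in>?C. \<forall>x\<in>V. x \<in> \<epsilon> a"
  proof (rule finite_directed_witness)
    show "finite V" by (rule finite_subset[OF VF F_fin(2)])
    show "\<bottom>\<^bsub>A\<^esub> \<in> ?C" using mem(2) by (auto simp: heyting_closed[OF heyting])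
    show "\<exists>d\<in>?C. \<forall>x\<in>V. x \<in> \<epsilon> a \<or> x \<in> \<epsilon> b \<longrightarrow> x \<in> \<epsilon> d" if "a \<in> ?C" "b \<in> ?C" for a b
      using that VF by (intro bexI[of _ "a \<squnion>\<^bsub>A\<^esub> b"]) (auto simp: mem(4) heyting_closed[OF heyting])
    fix x assume x: "x \<in> V"
    then obtain a where a: "a \<in> carrier A" "\<forall>y\<in>F. y \<in> \<epsilon> a \<longleftrightarrow> x \<sqsubseteq>\<^bsub>X\<^esub> y"
      using ex_principal[OF F] VF by blast
    then have "a \<in> ?C" using upsets_upward[OF V x] by auto
    moreover have "x \<in> \<epsilon> a" using a(2) x VF F_fin(3) by blast
    ultimately show "\<exists>a\<in>?C. x \<in> \<epsilon> a" by blast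
  qed
  then obtain a where "a \<in> carrier A" "\<epsilon> a \<inter> F \<subseteq> V" "V \<subseteq> \<epsilon> a" by blast
  then show ?thesis using VF by (intro bexI[of _ a]) auto
qed

end

lemma representation_spectrum:
  assumes A: "heyting_algebra A" and X: "X \<in> Obj IKp_cat"
    and \<alpha>: "psh_iso (fobj Spec_bar A) (fobj IKp_embedding X) \<alpha>"
  shows "\<exists>\<epsilon>. spectrum A X \<epsilon> \<and>
    (\<forall>P\<in>Obj Kp_cat. \<forall>g\<in>ha_hom A (UU P). compose (carrier A) (UU_map P X (\<alpha> P g)) \<epsilon> = g)"
proof -
  obtain \<eta> where \<eta>: "psh_iso (fobj IKp_embedding X) (fobj IKp_embedding (spec_poset A)) \<eta>"
    and \<eta>_\<alpha>: "\<And>P g. P \<in> Obj Kp_cat \<Longrightarrow> g \<in> ha_hom A (UU P) \<Longrightarrow> \<eta> P (\<alpha> P g) = spec_map A P g"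
    using psh_iso_span[OF Spec_bar_presheaf[OF A] \<alpha> spec_iso_psh_iso[OF A]]
    by (metis Spec_bar_simps(1) spec_iso_eq)
  obtain k where k: "k \<in> open_maps X (spec_poset A)" and k_\<eta>: "embedding_map X k = \<eta>"
    using bij_betw_imp_surj_on[OF IKp_embedding_fully_faithful[OF X, of "spec_poset A"]]
      psh_iso_hom[OF \<eta>]
    by (metis imageE)
  have k_bij: "bij_betw k (carrier X) (carrier (spec_poset A))"
    using IKp_embedding_reflects_iso[OF X spec_poset_IKp[OF A] k] \<eta> k_\<eta> by blast
  let ?\<epsilon> = "spec_hom A X k"
  note \<epsilon> = spec_hom_hom[OF A IKp_partial_order[OF X] k]
  show ?thesis
  proof (intro exI conjI ballI)
    show "spectrum A X ?\<epsilon>"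
      by unfold_locales (simp_all add: A X \<epsilon> k_bij spec_hom_inverse[OF k])
    fix P g assume P: "P \<in> Obj Kp_cat" and g: "g \<in> ha_hom A (UU P)"
    have \<alpha>g: "\<alpha> P g \<in> open_maps P X" using psh_hom_closed[OF psh_iso_hom[OF \<alpha>] P] g by simp
    show "compose (carrier A) (UU_map P X (\<alpha> P g)) ?\<epsilon> = g"
    proof (rule spec_map_inj[OF _ g])
      show "compose (carrier A) (UU_map P X (\<alpha> P g)) ?\<epsilon> \<in> ha_hom A (UU P)"
        by (rule hom_UU_restrict[OF A Kp_partial_order[OF P] IKp_partial_order[OF X] \<alpha>g \<epsilon>])
      have "spec_map A P (compose (carrier A) (UU_map P X (\<alpha> P g)) ?\<epsilon>) =
          embedding_map X k P (\<alpha> P g)"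
        by (simp add: spec_map_restrict[OF \<alpha>g \<epsilon>] spec_hom_inverse[OF k] embedding_map_eq P \<alpha>g)
      then show "spec_map A P (compose (carrier A) (UU_map P X (\<alpha> P g)) ?\<epsilon>) = spec_map A P g"
        by (simp add: k_\<eta> \<eta>_\<alpha> P g)
    qed
  qed
qed

locale spec_factorization =
  fixes S :: "('a gorder, 'a \<Rightarrow> 'a, 's gorder, 's \<Rightarrow> 's) functr" and \<alpha>
  assumes factorization: "IKp_factorization S \<alpha>"
begin

lemma S_functor: "is_functor (op_cat HA_cat) IKp_cat S"
  using factorization by (simp add: IKp_factorization_def)

lemma S_IKp: "heyting_algebra A \<Longrightarrow> fobj S A \<in> Obj IKp_cat"
  using S_functor by (simp add: is_functor_def HA_Obj)

lemma S_open:
  "heyting_algebra A \<Longrightarrow> heyting_algebra B \<Longrightarrow> h \<in> ha_hom A B \<Longrightarrow>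
      fmap S B A h \<in> open_maps (fobj S B) (fobj S A)"
  using S_functor by (simp add: is_functor_def HA_Obj)

lemma \<alpha>_psh_iso: "heyting_algebra A \<Longrightarrow>
    psh_iso (fobj Spec_bar A) (fobj IKp_embedding (fobj S A)) (\<alpha> A)"
  using factorization by (simp add: IKp_factorization_def HA_Obj)

lemma \<alpha>_bij:
  "heyting_algebra A \<Longrightarrow> P \<in> Obj Kp_cat \<Longrightarrow> bij_betw (\<alpha> A P) (ha_hom A (UU P)) (open_maps P (fobj S A))"
  using psh_iso_bij[OF \<alpha>_psh_iso] by simp

lemma \<alpha>_natural:
  assumes "heyting_algebra A" "heyting_algebra B" "h \<in> ha_hom A B" "P \<in> Obj Kp_cat"
    "g \<in> ha_hom B (UU P)"
  shows "\<alpha> A P (compose (carrier A) g h) = compose (carrier P) (fmap S B A h) (\<alpha> B P g)"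
proof -
  have "\<alpha> A P (fmap Spec_bar B A h P g) =
      fmap IKp_embedding (fobj S B) (fobj S A) (fmap S B A h) P (\<alpha> B P g)"
    using factorization assms by (simp add: IKp_factorization_def HA_Obj)
  then show ?thesis using assms bij_betwE[OF \<alpha>_bij[OF assms(2,4)]] by simp
qed

definition counit :: "'a gorder \<Rightarrow> 'a \<Rightarrow> 's set" where
  "counit A = (SOME \<epsilon>. spectrum A (fobj S A) \<epsilon> \<and>
     (\<forall>P\<in>Obj Kp_cat. \<forall>g\<in>ha_hom A (UU P).
        compose (carrier A) (UU_map P (fobj S A) (\<alpha> A P g)) \<epsilon> = g))"

lemma counit_props:
  assumes A: "heyting_algebra A"
  shows "spectrum A (fobj S A) (counit A) \<and>
     (\<forall>P\<in>Obj Kp_cat. \<forall>g\<in>ha_hom A (UU P).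
        compose (carrier A) (UU_map P (fobj S A) (\<alpha> A P g)) (counit A) = g)"
  unfolding counit_def
  by (rule someI_ex[OF representation_spectrum[OF A S_IKp[OF A] \<alpha>_psh_iso[OF A]]])

lemma counit_spectrum: "heyting_algebra A \<Longrightarrow> spectrum A (fobj S A) (counit A)"
  using counit_props by blast

lemma counit_restrict:
  "heyting_algebra A \<Longrightarrow> P \<in> Obj Kp_cat \<Longrightarrow> g \<in> ha_hom A (UU P) \<Longrightarrow>
    compose (carrier A) (UU_map P (fobj S A) (\<alpha> A P g)) (counit A) = g"
  using counit_props by blast

lemma counit_hom: "heyting_algebra A \<Longrightarrow> counit A \<in> ha_hom A (UU (fobj S A))"
  by (rule spectrum.hom[OF counit_spectrum])

lemma counit_natural:
  assumes A: "heyting_algebra A" and B: "heyting_algebra B" and h: "h \<in> ha_hom A B"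
  shows "compose (carrier A) (counit B) h =
    compose (carrier A) (UU_map (fobj S B) (fobj S A) (fmap S B A h)) (counit A)"
    (is "_ = compose _ (UU_map ?SB ?SA ?Sh) _")
proof (rule hom_UU_eqI[OF S_IKp[OF B]])
  note poset = IKp_partial_order[OF S_IKp[OF A]] IKp_partial_order[OF S_IKp[OF B]]
  note Sh = S_open[OF A B h]
  show "compose (carrier A) (counit B) h \<in> ha_hom A (UU ?SB)"
    by (rule ha_hom_compose[OF A h counit_hom[OF B]])
  show "compose (carrier A) (UU_map ?SB ?SA ?Sh) (counit A) \<in> ha_hom A (UU ?SB)"
    by (rule hom_UU_restrict[OF A poset(2,1) Sh counit_hom[OF A]])
  fix P d assume P: "P \<in> Obj Kp_cat" and d: "d \<in> open_maps P ?SB"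
  obtain g where g: "g \<in> ha_hom B (UU P)" "d = \<alpha> B P g"
    using bij_betw_imp_surj_on[OF \<alpha>_bij[OF B P]] d by blast
  have "compose (carrier A) (UU_map P ?SB d) (compose (carrier A) (counit B) h) =
      compose (carrier A) g h"
    using compose_assoc[OF ha_hom_funcset[OF h]] counit_restrict[OF B P g(1)] g(2) by metis
  moreover have "compose (carrier A) (UU_map P ?SB d)
        (compose (carrier A) (UU_map ?SB ?SA ?Sh) (counit A)) =
      compose (carrier A) (UU_map P ?SA (compose (carrier P) ?Sh d)) (counit A)"
    by (rule hom_UU_restrict_compose[OF d Sh counit_hom[OF A], symmetric])
  moreover have "\<dots> = compose (carrier A) g h"
    using counit_restrict[OF A P ha_hom_compose[OF A h g(1)]]
    by (simp add: \<alpha>_natural[OF A B h P g(1)] g(2))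
  ultimately show "compose (carrier A) (UU_map P ?SB d) (compose (carrier A) (counit B) h) =
      compose (carrier A) (UU_map P ?SB d) (compose (carrier A) (UU_map ?SB ?SA ?Sh) (counit A))"
    by simp
qed

end

lemma U_functor_functor: "is_functor IKp_cat (op_cat HA_cat) U_functor"
  unfolding is_functor_def
  by (auto simp: IKp_Obj HA_Obj U_functor_def UU_heyting UU_map_hom UU_map_id UU_map_compose)

theorem (in spec_factorization) right_adjoint: "right_adjoint_to_U S counit TYPE('x gorder)"
  unfolding right_adjoint_to_U_def HA_Obj
  by (intro conjI ballI S_functor U_functor_functor spectrum.universal[OF counit_spectrum]
      counit_natural)
    (simp_all add: HA_Obj counit_hom)

section \<open>Finite Heyting algebras\<close>

lemma (in partial_order) finite_ex_minimal:
  assumes "finite S" "S \<noteq> {}" "S \<subseteq> carrier L"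
  shows "\<exists>m\<in>S. \<forall>x\<in>S. x \<sqsubseteq> m \<longrightarrow> x = m"
proof -
  let ?less = "\<lambda>x y. x \<sqsubseteq> y \<and> x \<noteq> y"
  have "asymp_on S ?less" using assms(3) by (intro asymp_onI) (blast intro: le_antisym)
  moreover have "transp_on S ?less"
  proof (rule transp_onI)
    show "?less x z" if "x \<in> S" "y \<in> S" "z \<in> S" "?less x y" "?less y z" for x y z
      using that assms(3) le_trans[of x y z] le_antisym[of x y] by blast
  qed
  ultimately show ?thesis using Finite_Set.bex_min_element[of S ?less] assms(1,2) by blast
qed

definition join_primes :: "'b gorder \<Rightarrow> 'b set" where
  "join_primes B = {p \<in> carrier B. p \<noteq> \<bottom>\<^bsub>B\<^esub> \<and>
     (\<forall>a\<in>carrier B. \<forall>b\<in>carrier B. p \<sqsubseteq>\<^bsub>B\<^esub> a \<squnion>\<^bsub>B\<^esub> b \<longrightarrow> p \<sqsubseteq>\<^bsub>B\<^esub> a \<or> p \<sqsubseteq>\<^bsub>B\<^esub> b)}"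

definition join_prime_poset :: "'b gorder \<Rightarrow> 'b gorder" where
  "join_prime_poset B = \<lparr>carrier = join_primes B, eq = (=), le = (\<lambda>p q. q \<sqsubseteq>\<^bsub>B\<^esub> p)\<rparr>"

definition join_prime_hom :: "'b gorder \<Rightarrow> 'b \<Rightarrow> 'b set" where
  "join_prime_hom B = (\<lambda>b\<in>carrier B. {p \<in> join_primes B. p \<sqsubseteq>\<^bsub>B\<^esub> b})"

lemma join_prime_poset_simps [simp]:
  "carrier (join_prime_poset B) = join_primes B" "eq (join_prime_poset B) = (=)"
  "p \<sqsubseteq>\<^bsub>join_prime_poset B\<^esub> q \<longleftrightarrow> q \<sqsubseteq>\<^bsub>B\<^esub> p"
  by (simp_all add: join_prime_poset_def)

lemma join_primesD:
  assumes "p \<in> join_primes B"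
  shows "p \<in> carrier B" "p \<noteq> \<bottom>\<^bsub>B\<^esub>"
    and "a \<in> carrier B \<Longrightarrow> b \<in> carrier B \<Longrightarrow> p \<sqsubseteq>\<^bsub>B\<^esub> a \<squnion>\<^bsub>B\<^esub> b \<Longrightarrow> p \<sqsubseteq>\<^bsub>B\<^esub> a \<or> p \<sqsubseteq>\<^bsub>B\<^esub> b"
  using assms by (auto simp: join_primes_def)

declare join_primesD(1) [simp]

lemma join_prime_hom_mem_iff:
  "p \<in> join_primes B \<Longrightarrow> b \<in> carrier B \<Longrightarrow> p \<in> join_prime_hom B b \<longleftrightarrow> p \<sqsubseteq>\<^bsub>B\<^esub> b"
  by (simp add: join_prime_hom_def)

context
  fixes B :: "'b gorder" (structure)
  assumes heyting: "heyting_algebra B" and fin: "finite (carrier B)"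
begin

interpretation heyting B by unfold_locales (rule heyting)

text \<open>Minimal among the elements below \<open>b\<close> but not below \<open>c\<close>, \<open>q\<close> is join prime.\<close>

lemma join_prime_separation:
  assumes b: "b \<in> carrier B" and c: "c \<in> carrier B" and "\<not> b \<sqsubseteq> c"
  shows "\<exists>q\<in>join_primes B. q \<sqsubseteq> b \<and> \<not> q \<sqsubseteq> c"
proof -
  let ?S = "{x \<in> carrier B. x \<sqsubseteq> b \<and> \<not> x \<sqsubseteq> c}"
  have "finite ?S" "?S \<noteq> {}" "?S \<subseteq> carrier B" using fin assms by auto
  then obtain q where "q \<in> ?S" and minimal: "\<forall>x\<in>?S. x \<sqsubseteq> q \<longrightarrow> x = q"
    by (rule finite_ex_minimal[THEN bexE])
  then have q: "q \<in> carrier B" "q \<sqsubseteq> b" "\<not> q \<sqsubseteq> c" by simp_all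
  have q_meet: "q \<sqinter> u \<sqsubseteq> c" if u: "u \<in> carrier B" "\<not> q \<sqsubseteq> u" for u
  proof (rule ccontr)
    assume "\<not> q \<sqinter> u \<sqsubseteq> c"
    moreover have "q \<sqinter> u \<sqsubseteq> b" using le_trans[OF meet_left q(2)] q(1) u(1) b by simp
    ultimately have "q \<sqinter> u = q" using minimal meet_left q(1) u(1) by simp
    then show False using meet_right[of q u] q(1) u by simp
  qed
  have "q \<sqsubseteq> u \<or> q \<sqsubseteq> v" if uv: "u \<in> carrier B" "v \<in> carrier B" and le: "q \<sqsubseteq> u \<squnion> v" for u v
  proof (rule ccontr)
    assume "\<not> (q \<sqsubseteq> u \<or> q \<sqsubseteq> v)"
    then have "q \<sqinter> u \<sqsubseteq> c" "q \<sqinter> v \<sqsubseteq> c" using q_meet uv by blast+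
    then have "u \<sqsubseteq> himp B q c" "v \<sqsubseteq> himp B q c" using q(1) c uv by (simp_all add: le_himp_iff)
    then have "u \<squnion> v \<sqsubseteq> himp B q c" using q(1) c uv by (simp add: join_le_iff)
    then have "q \<sqsubseteq> himp B q c" using le_trans[OF le] q(1) c uv by simp
    then have "q \<sqinter> q \<sqsubseteq> c" using q(1) c by (simp add: le_himp_iff)
    moreover have "q \<sqsubseteq> q \<sqinter> q" using q(1) by (simp add: le_meet_iff)
    ultimately show False using le_trans[of q "q \<sqinter> q" c] q(1,3) c by simp
  qed
  moreover have "q \<noteq> \<bottom>" using q(3) c by auto
  ultimately have "q \<in> join_primes B" unfolding join_primes_def using q(1) by blast
  then show ?thesis using q(2,3) by blast
qed

lemma join_prime_poset_partial_order: "partial_order (join_prime_poset B)"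
proof (rule partial_orderI)
  show "x \<sqsubseteq>\<^bsub>join_prime_poset B\<^esub> x" if "x \<in> carrier (join_prime_poset B)" for x
    using that by simp
  show "x = y" if "x \<in> carrier (join_prime_poset B)" "y \<in> carrier (join_prime_poset B)"
    "x \<sqsubseteq>\<^bsub>join_prime_poset B\<^esub> y" "y \<sqsubseteq>\<^bsub>join_prime_poset B\<^esub> x" for x y
    using that le_antisym by simp
  show "x \<sqsubseteq>\<^bsub>join_prime_poset B\<^esub> z" if "x \<in> carrier (join_prime_poset B)"
    "y \<in> carrier (join_prime_poset B)" "z \<in> carrier (join_prime_poset B)"
    "x \<sqsubseteq>\<^bsub>join_prime_poset B\<^esub> y" "y \<sqsubseteq>\<^bsub>join_prime_poset B\<^esub> z" for x y z
    using that le_trans[of z y x] by simp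
qed simp

lemma join_primes_finite: "finite (join_primes B)"
  using fin by (rule finite_subset[rotated]) auto

lemma join_prime_poset_IKp: "join_prime_poset B \<in> Obj IKp_cat"
  using join_prime_poset_partial_order join_primes_finite by (simp add: IKp_Obj finite_image_finite)

lemma join_prime_hom_upset:
  assumes "b \<in> carrier B"
  shows "join_prime_hom B b \<in> upsets (join_prime_poset B)"
proof -
  have "y \<sqsubseteq> b" if "x \<in> join_primes B" "x \<sqsubseteq> b" "y \<in> join_primes B" "y \<sqsubseteq> x" for x y
    using that assms le_trans[of y x b] by simp
  then show ?thesis using assms by (auto simp: upsets_def join_prime_hom_def)
qed

lemma join_prime_meet_le_iff:
  assumes p: "p \<in> join_primes B" and ab: "a \<in> carrier B" "b \<in> carrier B"
  shows "a \<sqinter> p \<sqsubseteq> b \<longleftrightarrow> (\<forall>q\<in>join_primes B. q \<sqsubseteq> p \<longrightarrow> q \<sqsubseteq> a \<longrightarrow> q \<sqsubseteq> b)"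
proof
  show "\<forall>q\<in>join_primes B. q \<sqsubseteq> p \<longrightarrow> q \<sqsubseteq> a \<longrightarrow> q \<sqsubseteq> b" if "a \<sqinter> p \<sqsubseteq> b"
  proof (intro ballI impI)
    fix q assume "q \<in> join_primes B" "q \<sqsubseteq> p" "q \<sqsubseteq> a"
    then show "q \<sqsubseteq> b" using ab p by (intro le_trans[OF _ that]) (simp_all add: le_meet_iff)
  qed
  show "a \<sqinter> p \<sqsubseteq> b" if below: "\<forall>q\<in>join_primes B. q \<sqsubseteq> p \<longrightarrow> q \<sqsubseteq> a \<longrightarrow> q \<sqsubseteq> b"
  proof (rule ccontr)
    assume "\<not> a \<sqinter> p \<sqsubseteq> b"
    then obtain q where "q \<in> join_primes B" "q \<sqsubseteq> a \<sqinter> p" "\<not> q \<sqsubseteq> b"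
      using join_prime_separation[of "a \<sqinter> p" b] ab p by auto
    then show False using below ab p by (simp add: le_meet_iff)
  qed
qed

lemma join_prime_hom_hom: "join_prime_hom B \<in> ha_hom B (UU (join_prime_poset B))"
proof (rule hom_UU_I[OF heyting join_prime_poset_partial_order])
  show "join_prime_hom B \<in> carrier B \<rightarrow>\<^sub>E upsets (join_prime_poset B)"
    using join_prime_hom_upset by (auto simp: join_prime_hom_def)
  fix p assume "p \<in> carrier (join_prime_poset B)"
  then have p: "p \<in> join_primes B" by simp
  then have pB: "p \<in> carrier B" by simp
  note mem = join_prime_hom_mem_iff[OF p]
  show "p \<in> join_prime_hom B \<top>" using pB by (simp add: mem)
  have "\<not> p \<sqsubseteq> \<bottom>"
    using join_primesD(2)[OF p] le_antisym[OF _ bottom_lower[OF pB] pB bottom_closed] by blast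
  then show "p \<notin> join_prime_hom B \<bottom>" by (simp add: mem)
  fix a b assume ab: "a \<in> carrier B" "b \<in> carrier B"
  show "p \<in> join_prime_hom B (a \<sqinter> b) \<longleftrightarrow> p \<in> join_prime_hom B a \<and> p \<in> join_prime_hom B b"
    using ab pB by (simp add: mem le_meet_iff)
  have "p \<sqsubseteq> a \<squnion> b" if "p \<sqsubseteq> a \<or> p \<sqsubseteq> b"
    using that le_trans[of p a "a \<squnion> b"] le_trans[of p b "a \<squnion> b"] join_left[of a b]
      join_right[of a b] pB ab
    by auto
  then show "p \<in> join_prime_hom B (a \<squnion> b) \<longleftrightarrow> p \<in> join_prime_hom B a \<or> p \<in> join_prime_hom B b"
    using join_primesD(3)[OF p ab] ab by (auto simp: mem)
  show "p \<in> join_prime_hom B (himp B a b) \<longleftrightarrow> (\<forall>q\<in>carrier (join_prime_poset B).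
      p \<sqsubseteq>\<^bsub>join_prime_poset B\<^esub> q \<longrightarrow> q \<in> join_prime_hom B a \<longrightarrow> q \<in> join_prime_hom B b)"
    using ab pB join_prime_meet_le_iff[OF p ab]
    by (simp add: mem le_himp_iff join_prime_hom_mem_iff)
qed

lemma join_prime_hom_inj: "inj_on (join_prime_hom B) (carrier B)"
proof (rule inj_onI)
  fix a b assume ab: "a \<in> carrier B" "b \<in> carrier B" and "join_prime_hom B a = join_prime_hom B b"
  then have "q \<sqsubseteq> a \<longleftrightarrow> q \<sqsubseteq> b" if "q \<in> join_primes B" for q
    using join_prime_hom_mem_iff[OF that] by metis
  then have "a \<sqsubseteq> b" "b \<sqsubseteq> a" using join_prime_separation ab by blast+
  then show "a = b" using ab by (rule le_antisym)
qed

end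

section \<open>Pro-objects and their limits\<close>

lemma cofiltered_square:
  assumes I: "cofiltered I" and obj: "i \<in> Obj I" "k \<in> Obj I" "l \<in> Obj I"
    and uv: "u \<in> Arr I k i" "v \<in> Arr I l i"
  obtains n p q
    where "n \<in> Obj I" "p \<in> Arr I n k" "q \<in> Arr I n l" "Cmp I n k i u p = Cmp I n l i v q"
proof -
  have comp: "Cmp I w x y g f \<in> Arr I w y"
    if "w \<in> Obj I" "x \<in> Obj I" "y \<in> Obj I" "f \<in> Arr I w x" "g \<in> Arr I x y" for w x y f g
    using I that by (simp add: cofiltered_def category_def)
  have assoc: "Cmp I w y z h (Cmp I w x y g f) = Cmp I w x z (Cmp I x y z h g) f"
    if "w \<in> Obj I" "x \<in> Obj I" "y \<in> Obj I" "z \<in> Obj I" "f \<in> Arr I w x" "g \<in> Arr I x y"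
      "h \<in> Arr I y z"
    for w x y z f g h
    using I that by (simp add: cofiltered_def category_def)
  obtain m p' q' where m: "m \<in> Obj I" "p' \<in> Arr I m k" "q' \<in> Arr I m l"
    using I obj unfolding cofiltered_def by blast
  obtain n w where n: "n \<in> Obj I" "w \<in> Arr I n m"
    and "Cmp I n m i (Cmp I m k i u p') w = Cmp I n m i (Cmp I m l i v q') w"
    using I m(1) obj(1) comp[OF m(1) obj(2,1) m(2) uv(1)] comp[OF m(1) obj(3,1) m(3) uv(2)]
    unfolding cofiltered_def by blast
  then have "Cmp I n k i u (Cmp I n m k p' w) = Cmp I n l i v (Cmp I n m l q' w)"
    using assoc[OF n(1) m(1) obj(2,1) n(2) m(2) uv(1)] assoc[OF n(1) m(1) obj(3,1) n(2) m(3) uv(2)]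
    by simp
  then show thesis
    using that n comp[OF n(1) m(1) obj(2) n(2) m(2)] comp[OF n(1) m(1) obj(3) n(2) m(3)] by blast
qed

context
  fixes X :: "('i, 'm, 'h) pro"
  assumes X: "pro_object X"
begin

lemma pro_cofiltered: "cofiltered (idx X)"
  using X by (simp add: pro_object_def)

lemma pro_index_id: "i \<in> Obj (idx X) \<Longrightarrow> Ident (idx X) i \<in> Arr (idx X) i i"
  using pro_cofiltered by (simp add: cofiltered_def category_def)

lemma pro_index_comp:
  "i \<in> Obj (idx X) \<Longrightarrow> j \<in> Obj (idx X) \<Longrightarrow> k \<in> Obj (idx X) \<Longrightarrow> u \<in> Arr (idx X) i j \<Longrightarrow> v \<in> Arr (idx X) j k \<Longrightarrow>
    Cmp (idx X) i j k v u \<in> Arr (idx X) i k"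
  using pro_cofiltered by (simp add: cofiltered_def category_def)

lemma pro_obj_heyting: "i \<in> Obj (idx X) \<Longrightarrow> heyting_algebra (pob X i)"
  using X by (auto simp: pro_object_def is_functor_def HAf_cat_def)

lemma pro_obj_finite: "i \<in> Obj (idx X) \<Longrightarrow> finite (carrier (pob X i))"
  using X by (auto simp: pro_object_def is_functor_def HAf_cat_def)

lemma pro_map_hom:
  "i \<in> Obj (idx X) \<Longrightarrow> j \<in> Obj (idx X) \<Longrightarrow> u \<in> Arr (idx X) i j \<Longrightarrow>
      fmap (dia X) i j u \<in> ha_hom (pob X i) (pob X j)"
  using X by (simp add: pro_object_def is_functor_def HAf_cat_def)

lemma pro_map_id:
  "i \<in> Obj (idx X) \<Longrightarrow> fmap (dia X) i i (Ident (idx X) i) = (\<lambda>a\<in>carrier (pob X i). a)"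
  using X by (simp add: pro_object_def is_functor_def HAf_cat_def)

lemma pro_map_comp:
  assumes "i \<in> Obj (idx X)" "j \<in> Obj (idx X)" "k \<in> Obj (idx X)" "u \<in> Arr (idx X) i j"
    "v \<in> Arr (idx X) j k"
    and "a \<in> carrier (pob X i)"
  shows "fmap (dia X) i k (Cmp (idx X) i j k v u) a = fmap (dia X) j k v (fmap (dia X) i j u a)"
  using X assms by (simp add: pro_object_def is_functor_def HAf_cat_def compose_eq)

lemma pro_lim_carrier:
  "x \<in> carrier (pro_lim X) \<longleftrightarrow> x \<in> (\<Pi>\<^sub>E i\<in>Obj (idx X). carrier (pob X i)) \<and>
     (\<forall>i\<in>Obj (idx X). \<forall>j\<in>Obj (idx X). \<forall>u\<in>Arr (idx X) i j. fmap (dia X) i j u (x i) = x j)"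
  by (simp add: pro_lim_def)

lemma pro_lim_nth_closed: "x \<in> carrier (pro_lim X) \<Longrightarrow> i \<in> Obj (idx X) \<Longrightarrow> x i \<in> carrier (pob X i)"
  by (auto simp: pro_lim_carrier)

lemma pro_lim_compat:
  "x \<in> carrier (pro_lim X) \<Longrightarrow> i \<in> Obj (idx X) \<Longrightarrow> j \<in> Obj (idx X) \<Longrightarrow> u \<in> Arr (idx X) i j \<Longrightarrow>
    fmap (dia X) i j u (x i) = x j"
  by (auto simp: pro_lim_carrier)

lemma pro_lim_restrictI:
  assumes "\<And>i. i \<in> Obj (idx X) \<Longrightarrow> x i \<in> carrier (pob X i)"
    and "\<And>i j u. i \<in> Obj (idx X) \<Longrightarrow> j \<in> Obj (idx X) \<Longrightarrow> u \<in> Arr (idx X) i j \<Longrightarrow>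
        fmap (dia X) i j u (x i) = x j"
  shows "(\<lambda>i\<in>Obj (idx X). x i) \<in> carrier (pro_lim X)"
  using assms by (simp add: pro_lim_carrier)

lemma pro_lim_eqI:
  assumes "x \<in> carrier (pro_lim X)" "y \<in> carrier (pro_lim X)" "\<And>i. i \<in> Obj (idx X) \<Longrightarrow> x i = y i"
  shows "x = y"
  using assms by (auto simp: pro_lim_carrier intro: PiE_ext)

lemma pro_lim_le: "x \<sqsubseteq>\<^bsub>pro_lim X\<^esub> y \<longleftrightarrow> (\<forall>i\<in>Obj (idx X). x i \<sqsubseteq>\<^bsub>pob X i\<^esub> y i)"
  by (simp add: pro_lim_def)

lemma pro_lim_partial_order: "partial_order (pro_lim X)"
proof (rule partial_orderI)
  note nth = pro_lim_nth_closed
  show "eq (pro_lim X) = (=)" by (simp add: pro_lim_def)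
  show "x \<sqsubseteq>\<^bsub>pro_lim X\<^esub> x" if x: "x \<in> carrier (pro_lim X)" for x
    unfolding pro_lim_le
  proof
    fix i assume i: "i \<in> Obj (idx X)"
    interpret partial_order "pob X i" by (rule heyting_partial_order[OF pro_obj_heyting[OF i]])
    show "x i \<sqsubseteq>\<^bsub>pob X i\<^esub> x i" using nth[OF x i] by simp
  qed
  show "x = y" if xy: "x \<in> carrier (pro_lim X)" "y \<in> carrier (pro_lim X)"
    "x \<sqsubseteq>\<^bsub>pro_lim X\<^esub> y" "y \<sqsubseteq>\<^bsub>pro_lim X\<^esub> x" for x y
  proof (rule pro_lim_eqI[OF xy(1,2)])
    fix i assume i: "i \<in> Obj (idx X)"
    interpret partial_order "pob X i" by (rule heyting_partial_order[OF pro_obj_heyting[OF i]])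
    show "x i = y i" using xy(3,4) nth[OF xy(1) i] nth[OF xy(2) i] i
      by (intro le_antisym) (simp_all add: pro_lim_le)
  qed
  show "x \<sqsubseteq>\<^bsub>pro_lim X\<^esub> z"
    if xyz: "x \<in> carrier (pro_lim X)" "y \<in> carrier (pro_lim X)" "z \<in> carrier (pro_lim X)"
    "x \<sqsubseteq>\<^bsub>pro_lim X\<^esub> y" "y \<sqsubseteq>\<^bsub>pro_lim X\<^esub> z" for x y z
    unfolding pro_lim_le
  proof
    fix i assume i: "i \<in> Obj (idx X)"
    interpret partial_order "pob X i" by (rule heyting_partial_order[OF pro_obj_heyting[OF i]])
    show "x i \<sqsubseteq>\<^bsub>pob X i\<^esub> z i"
      using xyz(4,5) nth[OF xyz(1) i] nth[OF xyz(2) i] nth[OF xyz(3) i] i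
        le_trans[of "x i" "y i" "z i"]
      by (simp add: pro_lim_le)
  qed
qed

lemma pro_lim_pointwise:
  assumes "x \<in> carrier (pro_lim X)" "y \<in> carrier (pro_lim X)"
    and "\<And>i a b. i \<in> Obj (idx X) \<Longrightarrow> a \<in> carrier (pob X i) \<Longrightarrow> b \<in> carrier (pob X i) \<Longrightarrow>
        f i a b \<in> carrier (pob X i)"
    and "\<And>i j h a b. h \<in> ha_hom (pob X i) (pob X j) \<Longrightarrow> a \<in> carrier (pob X i) \<Longrightarrow>
        b \<in> carrier (pob X i) \<Longrightarrow>
      h (f i a b) = f j (h a) (h b)"
  shows "(\<lambda>i\<in>Obj (idx X). f i (x i) (y i)) \<in> carrier (pro_lim X)"
proof (rule pro_lim_restrictI)
  note nth = pro_lim_nth_closed[OF assms(1)] pro_lim_nth_closed[OF assms(2)]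
  show "f i (x i) (y i) \<in> carrier (pob X i)" if "i \<in> Obj (idx X)" for i
    using that nth assms(3) by simp
  show "fmap (dia X) i j u (f i (x i) (y i)) = f j (x j) (y j)"
    if u: "i \<in> Obj (idx X)" "j \<in> Obj (idx X)" "u \<in> Arr (idx X) i j" for i j u
    using assms(4)[OF pro_map_hom[OF u] nth(1,2)[OF u(1)]]
    by (simp add: pro_lim_compat[OF assms(1) u] pro_lim_compat[OF assms(2) u])
qed

lemma pro_lim_heyting_operations:
  "heyting_operations (pro_lim X)
     (\<lambda>i\<in>Obj (idx X). \<top>\<^bsub>pob X i\<^esub>) (\<lambda>i\<in>Obj (idx X). \<bottom>\<^bsub>pob X i\<^esub>)
     (\<lambda>x y. \<lambda>i\<in>Obj (idx X). x i \<sqinter>\<^bsub>pob X i\<^esub> y i) (\<lambda>x y. \<lambda>i\<in>Obj (idx X). x i \<squnion>\<^bsub>pob X i\<^esub> y i)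
     (\<lambda>x y. \<lambda>i\<in>Obj (idx X). himp (pob X i) (x i) (y i))"
proof (intro heyting_operations.intro heyting_operations_axioms.intro pro_lim_partial_order)
  let ?L = "pro_lim X"
  note closed = heyting_closed[OF pro_obj_heyting] and nth = pro_lim_nth_closed
  note pob_heyting = heyting.intro[OF pro_obj_heyting]
  have bounds: "x i \<sqsubseteq>\<^bsub>pob X i\<^esub> \<top>\<^bsub>pob X i\<^esub>" "\<bottom>\<^bsub>pob X i\<^esub> \<sqsubseteq>\<^bsub>pob X i\<^esub> x i"
    if "x \<in> carrier ?L" "i \<in> Obj (idx X)" for x i
  proof -
    interpret heyting "pob X i" by (rule pob_heyting[OF that(2)])
    show "x i \<sqsubseteq>\<^bsub>pob X i\<^esub> \<top>\<^bsub>pob X i\<^esub>" "\<bottom>\<^bsub>pob X i\<^esub> \<sqsubseteq>\<^bsub>pob X i\<^esub> x i" using nth[OF that] by simp_all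
  qed
  show "(\<lambda>i\<in>Obj (idx X). \<top>\<^bsub>pob X i\<^esub>) \<in> carrier ?L" "(\<lambda>i\<in>Obj (idx X). \<bottom>\<^bsub>pob X i\<^esub>) \<in> carrier ?L"
    by (auto intro!: pro_lim_restrictI simp: closed ha_hom_preserves(1,2)[OF pro_map_hom])
  fix x assume x: "x \<in> carrier ?L"
  show "x \<sqsubseteq>\<^bsub>?L\<^esub> (\<lambda>i\<in>Obj (idx X). \<top>\<^bsub>pob X i\<^esub>)" "(\<lambda>i\<in>Obj (idx X). \<bottom>\<^bsub>pob X i\<^esub>) \<sqsubseteq>\<^bsub>?L\<^esub> x"
    using bounds[OF x] by (simp_all add: pro_lim_le)
  fix y assume y: "y \<in> carrier ?L"
  show "(\<lambda>i\<in>Obj (idx X). x i \<sqinter>\<^bsub>pob X i\<^esub> y i) \<in> carrier ?L"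
    and "(\<lambda>i\<in>Obj (idx X). x i \<squnion>\<^bsub>pob X i\<^esub> y i) \<in> carrier ?L"
    and "(\<lambda>i\<in>Obj (idx X). himp (pob X i) (x i) (y i)) \<in> carrier ?L"
    by (rule pro_lim_pointwise[OF x y]; simp add: closed ha_hom_preserves)+
  fix z assume z: "z \<in> carrier ?L"
  note nth = nth[OF x] nth[OF y] nth[OF z]
  show "z \<sqsubseteq>\<^bsub>?L\<^esub> (\<lambda>i\<in>Obj (idx X). x i \<sqinter>\<^bsub>pob X i\<^esub> y i) \<longleftrightarrow> z \<sqsubseteq>\<^bsub>?L\<^esub> x \<and> z \<sqsubseteq>\<^bsub>?L\<^esub> y"
    and "(\<lambda>i\<in>Obj (idx X). x i \<squnion>\<^bsub>pob X i\<^esub> y i) \<sqsubseteq>\<^bsub>?L\<^esub> z \<longleftrightarrow> x \<sqsubseteq>\<^bsub>?L\<^esub> z \<and> y \<sqsubseteq>\<^bsub>?L\<^esub> z"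
    and "z \<sqsubseteq>\<^bsub>?L\<^esub> (\<lambda>i\<in>Obj (idx X). himp (pob X i) (x i) (y i)) \<longleftrightarrow>
      (\<lambda>i\<in>Obj (idx X). x i \<sqinter>\<^bsub>pob X i\<^esub> z i) \<sqsubseteq>\<^bsub>?L\<^esub> y"
    using nth
    by (auto simp: pro_lim_le heyting.le_meet_iff[OF pob_heyting]
        heyting.join_le_iff[OF pob_heyting] heyting.le_himp_iff[OF pob_heyting])
qed

lemmas pro_lim_heyting = heyting_operations.heyting_algebra[OF pro_lim_heyting_operations]
  and pro_lim_ops = heyting_operations.top_eq_one[OF pro_lim_heyting_operations]
    heyting_operations.bottom_eq_zero[OF pro_lim_heyting_operations]
    heyting_operations.meet_eq_conj[OF pro_lim_heyting_operations]
    heyting_operations.join_eq_disj[OF pro_lim_heyting_operations]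
    heyting_operations.himp_eq_impl[OF pro_lim_heyting_operations]

lemma pro_lim_proj_hom:
  assumes i: "i \<in> Obj (idx X)"
  shows "(\<lambda>x\<in>carrier (pro_lim X). x i) \<in> ha_hom (pro_lim X) (pob X i)"
proof (rule ha_homI)
  show "(\<lambda>x\<in>carrier (pro_lim X). x i) \<in> carrier (pro_lim X) \<rightarrow>\<^sub>E carrier (pob X i)"
    using i pro_lim_nth_closed by simp
qed (simp_all add: heyting_closed[OF pro_lim_heyting], simp_all add: i pro_lim_ops)

lemma pro_lim_homI:
  assumes A: "heyting_algebra A" and h: "h \<in> carrier A \<rightarrow>\<^sub>E carrier (pro_lim X)"
    and proj: "\<And>i. i \<in> Obj (idx X) \<Longrightarrow> (\<lambda>a\<in>carrier A. h a i) \<in> ha_hom A (pob X i)"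
  shows "h \<in> ha_hom A (pro_lim X)"
proof (rule ha_homI[OF h])
  have h_closed: "h a \<in> carrier (pro_lim X)" if "a \<in> carrier A" for a using h that by blast
  have eqI: "h a = y"
    if "a \<in> carrier A" "y \<in> carrier (pro_lim X)" "\<And>i. i \<in> Obj (idx X) \<Longrightarrow> h a i = y i" for a y
    using pro_lim_eqI[OF h_closed] that by blast
  note closed = heyting_closed[OF A] heyting_closed[OF pro_lim_heyting] and ops = pro_lim_ops
  show "h \<top>\<^bsub>A\<^esub> = \<top>\<^bsub>pro_lim X\<^esub>"
    using ha_hom_preserves(1)[OF proj] by (intro eqI) (simp_all add: closed, simp_all add: ops(1))
  show "h \<bottom>\<^bsub>A\<^esub> = \<bottom>\<^bsub>pro_lim X\<^esub>"
    using ha_hom_preserves(2)[OF proj] by (intro eqI) (simp_all add: closed, simp_all add: ops(2))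
  fix a b assume ab: "a \<in> carrier A" "b \<in> carrier A"
  show "h (a \<sqinter>\<^bsub>A\<^esub> b) = h a \<sqinter>\<^bsub>pro_lim X\<^esub> h b"
    using ha_hom_preserves(3)[OF proj ab] ab
    by (intro eqI) (simp_all add: closed h_closed, simp_all add: h_closed ops(3))
  show "h (a \<squnion>\<^bsub>A\<^esub> b) = h a \<squnion>\<^bsub>pro_lim X\<^esub> h b"
    using ha_hom_preserves(4)[OF proj ab] ab
    by (intro eqI) (simp_all add: closed h_closed, simp_all add: h_closed ops(4))
  show "h (himp A a b) = himp (pro_lim X) (h a) (h b)"
    using ha_hom_preserves(5)[OF proj ab] ab
    by (intro eqI) (simp_all add: closed h_closed, simp_all add: h_closed ops(5))
qed

end

section \<open>Morphisms of pro-objects\<close>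

lemma compose_cong:
  "(\<And>x. x \<in> S \<Longrightarrow> g (f x) = g' (f' x)) \<Longrightarrow> compose S g f = compose S g' f'"
  by (simp add: compose_def fun_eq_iff)

context
  fixes X :: "('i, 'm, 'h) pro"
  assumes X: "pro_object X"
begin

lemma pro_rel_iff:
  "((i, f), (i', f')) \<in> pro_rel X B \<longleftrightarrow>
     i \<in> Obj (idx X) \<and> f \<in> ha_hom (pob X i) B \<and> i' \<in> Obj (idx X) \<and> f' \<in> ha_hom (pob X i') B \<and>
     (\<exists>k\<in>Obj (idx X). \<exists>u\<in>Arr (idx X) k i. \<exists>u'\<in>Arr (idx X) k i'.
        \<forall>a\<in>carrier (pob X k). f (fmap (dia X) k i u a) = f' (fmap (dia X) k i' u' a))"
  by (simp add: pro_rel_def compose_def fun_eq_iff Ball_def)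

lemma pro_relE:
  assumes "((i, f), (i', f')) \<in> pro_rel X B"
  obtains k u u'
    where "i \<in> Obj (idx X)" "f \<in> ha_hom (pob X i) B" "i' \<in> Obj (idx X)" "f' \<in> ha_hom (pob X i') B"
    "k \<in> Obj (idx X)" "u \<in> Arr (idx X) k i" "u' \<in> Arr (idx X) k i'"
    "\<forall>a\<in>carrier (pob X k). f (fmap (dia X) k i u a) = f' (fmap (dia X) k i' u' a)"
  using assms unfolding pro_rel_iff by blast

lemma pro_relI:
  assumes "i \<in> Obj (idx X)" "f \<in> ha_hom (pob X i) B" "i' \<in> Obj (idx X)" "f' \<in> ha_hom (pob X i') B"
    and "k \<in> Obj (idx X)" "u \<in> Arr (idx X) k i" "u' \<in> Arr (idx X) k i'"
    and "\<And>a. a \<in> carrier (pob X k) \<Longrightarrow> f (fmap (dia X) k i u a) = f' (fmap (dia X) k i' u' a)"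
  shows "((i, f), (i', f')) \<in> pro_rel X B"
  unfolding pro_rel_iff using assms by blast

lemma pro_rel_refl:
  "i \<in> Obj (idx X) \<Longrightarrow> f \<in> ha_hom (pob X i) B \<Longrightarrow> ((i, f), (i, f)) \<in> pro_rel X B"
  by (rule pro_relI) (auto intro: pro_index_id[OF X])

lemma pro_rel_sym: "((i, f), (i', f')) \<in> pro_rel X B \<Longrightarrow> ((i', f'), (i, f)) \<in> pro_rel X B"
  unfolding pro_rel_iff by metis

text \<open>
  If \<open>f\<close> and \<open>f'\<close> agree on \<open>k\<close>, and \<open>f'\<close> and \<open>f''\<close> on \<open>l\<close>, then \<open>f\<close> and \<open>f''\<close> agree on the vertex
  of a commuting square over \<open>k\<close> and \<open>l\<close>.
\<close>

lemma pro_rel_trans: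
  assumes "((i, f), (i', f')) \<in> pro_rel X B" "((i', f'), (i'', f'')) \<in> pro_rel X B"
  shows "((i, f), (i'', f'')) \<in> pro_rel X B"
proof -
  obtain k u u'
    where i: "i \<in> Obj (idx X)" "f \<in> ha_hom (pob X i) B" "i' \<in> Obj (idx X)"
      "f' \<in> ha_hom (pob X i') B"
    and k: "k \<in> Obj (idx X)" "u \<in> Arr (idx X) k i" "u' \<in> Arr (idx X) k i'"
    and f_f': "\<forall>a\<in>carrier (pob X k). f (fmap (dia X) k i u a) = f' (fmap (dia X) k i' u' a)"
    using assms(1) by (rule pro_relE)
  obtain l v v' where "i' \<in> Obj (idx X)" "f' \<in> ha_hom (pob X i') B"
    and i'': "i'' \<in> Obj (idx X)" "f'' \<in> ha_hom (pob X i'') B"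
    and l: "l \<in> Obj (idx X)" "v \<in> Arr (idx X) l i'" "v' \<in> Arr (idx X) l i''"
    and f'_f'': "\<forall>a\<in>carrier (pob X l). f' (fmap (dia X) l i' v a) = f'' (fmap (dia X) l i'' v' a)"
    using assms(2) by (rule pro_relE)
  obtain n p q where n: "n \<in> Obj (idx X)" "p \<in> Arr (idx X) n k" "q \<in> Arr (idx X) n l"
    and square: "Cmp (idx X) n k i' u' p = Cmp (idx X) n l i' v q"
    using cofiltered_square[OF pro_cofiltered[OF X] i(3) k(1) l(1) k(3) l(2)] .
  show ?thesis
  proof (rule pro_relI[OF i(1,2) i'' n(1)])
    show "Cmp (idx X) n k i u p \<in> Arr (idx X) n i" "Cmp (idx X) n l i'' v' q \<in> Arr (idx X) n i''"
      using pro_index_comp[OF X] i i'' k l n by blast+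
    fix a assume a: "a \<in> carrier (pob X n)"
    note closed = ha_hom_closed[OF pro_map_hom[OF X n(1) k(1) n(2)] a]
      ha_hom_closed[OF pro_map_hom[OF X n(1) l(1) n(3)] a]
    have "f (fmap (dia X) n i (Cmp (idx X) n k i u p) a) =
        f' (fmap (dia X) n i' (Cmp (idx X) n k i' u' p) a)"
      using bspec[OF f_f' closed(1)] by (simp add: pro_map_comp[OF X] n k i a)
    also have "\<dots> = f'' (fmap (dia X) n i'' (Cmp (idx X) n l i'' v' q) a)"
      using bspec[OF f'_f'' closed(2)] by (simp add: square pro_map_comp[OF X] n l i i'' a)
    finally show "f (fmap (dia X) n i (Cmp (idx X) n k i u p) a) =
        f'' (fmap (dia X) n i'' (Cmp (idx X) n l i'' v' q) a)" .
  qed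
qed

lemma pro_rel_equiv: "equiv (SIGMA i : Obj (idx X). ha_hom (pob X i) B) (pro_rel X B)"
proof (rule equivI)
  show "pro_rel X B \<subseteq>
      (SIGMA i : Obj (idx X). ha_hom (pob X i) B) \<times> (SIGMA i : Obj (idx X). ha_hom (pob X i) B)"
    by (auto simp: pro_rel_def)
  show "refl_on (SIGMA i : Obj (idx X). ha_hom (pob X i) B) (pro_rel X B)"
    by (rule refl_onI) (auto intro: pro_rel_refl)
  show "sym (pro_rel X B)" by (rule symI) (auto intro: pro_rel_sym)
  show "trans (pro_rel X B)" by (rule transI) (auto intro: pro_rel_trans)
qed

lemma pro_rel_compose:
  assumes "((i, f), (i', f')) \<in> pro_rel X B" and g: "g \<in> ha_hom B C"
  shows "((i, compose (carrier (pob X i)) g f), (i', compose (carrier (pob X i')) g f'))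
      \<in> pro_rel X C"
proof -
  obtain k u u'
    where i: "i \<in> Obj (idx X)" "f \<in> ha_hom (pob X i) B" "i' \<in> Obj (idx X)"
      "f' \<in> ha_hom (pob X i') B"
    and k: "k \<in> Obj (idx X)" "u \<in> Arr (idx X) k i" "u' \<in> Arr (idx X) k i'"
    and eq: "\<forall>a\<in>carrier (pob X k). f (fmap (dia X) k i u a) = f' (fmap (dia X) k i' u' a)"
    using assms(1) by (rule pro_relE)
  show ?thesis
  proof (rule pro_relI[OF i(1) _ i(3) _ k])
    show "compose (carrier (pob X i)) g f \<in> ha_hom (pob X i) C"
      and "compose (carrier (pob X i')) g f' \<in> ha_hom (pob X i') C"
      using i g by (simp_all add: ha_hom_compose pro_obj_heyting[OF X])
    show "compose (carrier (pob X i)) g f (fmap (dia X) k i u a) =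
        compose (carrier (pob X i')) g f' (fmap (dia X) k i' u' a)" if "a \<in> carrier (pob X k)" for a
      using that eq k i ha_hom_closed[OF pro_map_hom[OF X]] by (simp add: compose_eq)
  qed
qed

lemma pro_rel_transition:
  assumes "i \<in> Obj (idx X)" "k \<in> Obj (idx X)" "u \<in> Arr (idx X) k i" "f \<in> ha_hom (pob X i) B"
  shows "((k, compose (carrier (pob X k)) f (fmap (dia X) k i u)), (i, f)) \<in> pro_rel X B"
proof (rule pro_relI[OF assms(2) _ assms(1,4,2) pro_index_id[OF X assms(2)] assms(3)])
  show "compose (carrier (pob X k)) f (fmap (dia X) k i u) \<in> ha_hom (pob X k) B"
    by (rule ha_hom_compose[OF pro_obj_heyting[OF X assms(2)] pro_map_hom[OF X assms(2,1,3)]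
        assms(4)])
  show "compose (carrier (pob X k)) f (fmap (dia X) k i u) (fmap (dia X) k k (Ident (idx X) k) a) =
      f (fmap (dia X) k i u a)" if "a \<in> carrier (pob X k)" for a
    using that by (simp add: pro_map_id[OF X assms(2)] compose_eq)
qed

lemma pro_rel_eval:
  assumes "((i, f), (i', f')) \<in> pro_rel X B" and x: "x \<in> carrier (pro_lim X)"
  shows "f (x i) = f' (x i')"
  using assms(1)
proof (rule pro_relE)
  fix k u u'
  assume k: "i \<in> Obj (idx X)" "i' \<in> Obj (idx X)" "k \<in> Obj (idx X)" "u \<in> Arr (idx X) k i"
    "u' \<in> Arr (idx X) k i'"
    and eq: "\<forall>a\<in>carrier (pob X k). f (fmap (dia X) k i u a) = f' (fmap (dia X) k i' u' a)"
  show "f (x i) = f' (x i')"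
    using bspec[OF eq pro_lim_nth_closed[OF X x k(3)]] pro_lim_compat[OF X x k(3,1,4)]
      pro_lim_compat[OF X x k(3,2,5)]
    by simp
qed

lemma pro_colim_repr:
  assumes "c \<in> pro_colim X B"
  obtains i f where "(i, f) \<in> c" "i \<in> Obj (idx X)" "f \<in> ha_hom (pob X i) B"
  using in_quotient_imp_non_empty[OF pro_rel_equiv assms[unfolded pro_colim_def]]
    in_quotient_imp_subset[OF pro_rel_equiv assms[unfolded pro_colim_def]] by blast

lemma pro_colim_mem:
  assumes "c \<in> pro_colim X B" "(i, f) \<in> c"
  shows "i \<in> Obj (idx X)" "f \<in> ha_hom (pob X i) B"
  using in_quotient_imp_subset[OF pro_rel_equiv assms(1)[unfolded pro_colim_def]] assms(2) by auto

lemma pro_colim_rel: "c \<in> pro_colim X B \<Longrightarrow> z \<in> c \<Longrightarrow> z' \<in> c \<longleftrightarrow> (z, z') \<in> pro_rel X B"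
  unfolding pro_colim_def
  using in_quotient_imp_in_rel[OF pro_rel_equiv, of c B z z']
    in_quotient_imp_closed[OF pro_rel_equiv, of c B z z']
  by blast

lemma pro_colim_eqI: "c \<in> pro_colim X B \<Longrightarrow> c' \<in> pro_colim X B \<Longrightarrow> z \<in> c \<Longrightarrow> z \<in> c' \<Longrightarrow> c = c'"
  using pro_colim_rel by blast

lemma pro_class_in_colim:
  "i \<in> Obj (idx X) \<Longrightarrow> f \<in> ha_hom (pob X i) B \<Longrightarrow> pro_rel X B `` {(i, f)} \<in> pro_colim X B"
  unfolding pro_colim_def by (rule quotientI) blast

lemma pro_class_self: "i \<in> Obj (idx X) \<Longrightarrow> f \<in> ha_hom (pob X i) B \<Longrightarrow> (i, f) \<in> pro_rel X B `` {(i, f)}"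
  using pro_rel_refl by blast

end

context
  fixes X :: "('i, 'm, 'h) pro" and Y :: "('j, 'n, 'k) pro"
  assumes X: "pro_object X" and Y: "pro_object Y"
begin

lemma pro_homI:
  assumes "\<phi> \<in> extensional (Obj (idx Y))" "\<And>j. j \<in> Obj (idx Y) \<Longrightarrow> \<phi> j \<in> pro_colim X (pob Y j)"
    and "\<And>j j' v i f. j \<in> Obj (idx Y) \<Longrightarrow> j' \<in> Obj (idx Y) \<Longrightarrow> v \<in> Arr (idx Y) j j' \<Longrightarrow> (i, f) \<in> \<phi> j \<Longrightarrow>
      (i, compose (carrier (pob X i)) (fmap (dia Y) j j' v) f) \<in> \<phi> j'"
  shows "\<phi> \<in> pro_hom X Y"
  using assms by (auto simp: pro_hom_def PiE_iff)

lemma pro_hom_in_colim: "\<phi> \<in> pro_hom X Y \<Longrightarrow> j \<in> Obj (idx Y) \<Longrightarrow> \<phi> j \<in> pro_colim X (pob Y j)"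
  by (auto simp: pro_hom_def)

lemma pro_hom_extensional: "\<phi> \<in> pro_hom X Y \<Longrightarrow> \<phi> \<in> extensional (Obj (idx Y))"
  by (simp add: pro_hom_def PiE_iff)

lemma pro_hom_compat:
  "\<phi> \<in> pro_hom X Y \<Longrightarrow> j \<in> Obj (idx Y) \<Longrightarrow> j' \<in> Obj (idx Y) \<Longrightarrow> v \<in> Arr (idx Y) j j' \<Longrightarrow> (i, f) \<in> \<phi> j \<Longrightarrow>
    (i, compose (carrier (pob X i)) (fmap (dia Y) j j' v) f) \<in> \<phi> j'"
  by (fastforce simp: pro_hom_def)

lemma pro_hom_repr:
  assumes "\<phi> \<in> pro_hom X Y" "j \<in> Obj (idx Y)"
  obtains i f where "(i, f) \<in> \<phi> j" "i \<in> Obj (idx X)" "f \<in> ha_hom (pob X i) (pob Y j)"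
  using pro_colim_repr[OF X pro_hom_in_colim[OF assms]] .

lemma pro_hom_mem:
  assumes "\<phi> \<in> pro_hom X Y" "j \<in> Obj (idx Y)" "(i, f) \<in> \<phi> j"
  shows "i \<in> Obj (idx X)" "f \<in> ha_hom (pob X i) (pob Y j)"
  using pro_colim_mem[OF X pro_hom_in_colim[OF assms(1,2)] assms(3)] .

lemma pro_hom_eqI:
  assumes \<phi>: "\<phi> \<in> pro_hom X Y" and \<psi>: "\<psi> \<in> pro_hom X Y"
    and meet: "\<And>j. j \<in> Obj (idx Y) \<Longrightarrow> \<phi> j \<inter> \<psi> j \<noteq> {}"
  shows "\<phi> = \<psi>"
proof (rule extensionalityI[OF pro_hom_extensional[OF \<phi>] pro_hom_extensional[OF \<psi>]])
  show "\<phi> j = \<psi> j" if j: "j \<in> Obj (idx Y)" for j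
    using pro_colim_eqI[OF X pro_hom_in_colim[OF \<phi> j] pro_hom_in_colim[OF \<psi> j]] meet[OF j] by blast
qed

lemma pro_lim_map_eval:
  assumes \<phi>: "\<phi> \<in> pro_hom X Y" and x: "x \<in> carrier (pro_lim X)" and j: "j \<in> Obj (idx Y)"
    and f: "(i, f) \<in> \<phi> j"
  shows "pro_lim_map X Y \<phi> x j = f (x i)"
proof -
  have "f' (x i') = f (x i)" if "(i', f') \<in> \<phi> j" for i' f'
    using pro_rel_eval[OF X _ x] pro_colim_rel[OF X pro_hom_in_colim[OF \<phi> j] that] f by blast
  then have "(THE y. \<exists>(i, f)\<in>\<phi> j. y = f (x i)) = f (x i)"
    by (intro the_equality bexI[OF _ f]) (simp, blast)
  then show ?thesis using x j by (simp add: pro_lim_map_def)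
qed

lemma pro_lim_map_extensional: "pro_lim_map X Y \<phi> \<in> extensional (carrier (pro_lim X))"
  by (simp add: pro_lim_map_def)

lemma pro_lim_map_closed:
  assumes \<phi>: "\<phi> \<in> pro_hom X Y" and x: "x \<in> carrier (pro_lim X)"
  shows "pro_lim_map X Y \<phi> x \<in> carrier (pro_lim Y)"
proof -
  have "(\<lambda>j\<in>Obj (idx Y). pro_lim_map X Y \<phi> x j) \<in> carrier (pro_lim Y)"
  proof (rule pro_lim_restrictI[OF Y])
    fix j assume j: "j \<in> Obj (idx Y)"
    obtain i f where f: "(i, f) \<in> \<phi> j" "i \<in> Obj (idx X)" "f \<in> ha_hom (pob X i) (pob Y j)"
      using \<phi> j by (rule pro_hom_repr)
    show "pro_lim_map X Y \<phi> x j \<in> carrier (pob Y j)"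
      using ha_hom_closed[OF f(3) pro_lim_nth_closed[OF X x f(2)]]
      by (simp add: pro_lim_map_eval[OF \<phi> x j f(1)])
    fix j' v assume j': "j' \<in> Obj (idx Y)" and v: "v \<in> Arr (idx Y) j j'"
    show "fmap (dia Y) j j' v (pro_lim_map X Y \<phi> x j) = pro_lim_map X Y \<phi> x j'"
      using pro_lim_nth_closed[OF X x f(2)]
      by (simp add: pro_lim_map_eval[OF \<phi> x j f(1)]
          pro_lim_map_eval[OF \<phi> x j' pro_hom_compat[OF \<phi> j j' v f(1)]] compose_eq)
  qed
  moreover have "pro_lim_map X Y \<phi> x \<in> extensional (Obj (idx Y))"
    using x by (simp add: pro_lim_map_def)
  ultimately show ?thesis by (simp add: extensional_restrict)
qed

lemma pro_lim_map_hom: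
  assumes \<phi>: "\<phi> \<in> pro_hom X Y"
  shows "pro_lim_map X Y \<phi> \<in> ha_hom (pro_lim X) (pro_lim Y)"
proof (rule pro_lim_homI[OF Y pro_lim_heyting[OF X]])
  show "pro_lim_map X Y \<phi> \<in> carrier (pro_lim X) \<rightarrow>\<^sub>E carrier (pro_lim Y)"
    using pro_lim_map_closed[OF \<phi>] pro_lim_map_extensional by (simp add: PiE_iff)
  fix j assume j: "j \<in> Obj (idx Y)"
  obtain i f where f: "(i, f) \<in> \<phi> j" "i \<in> Obj (idx X)" "f \<in> ha_hom (pob X i) (pob Y j)"
    using \<phi> j by (rule pro_hom_repr)
  have "(\<lambda>x\<in>carrier (pro_lim X). pro_lim_map X Y \<phi> x j) =
      compose (carrier (pro_lim X)) f (\<lambda>x\<in>carrier (pro_lim X). x i)"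
    using pro_lim_map_eval[OF \<phi> _ j f(1)] by (simp add: compose_def fun_eq_iff)
  then show "(\<lambda>x\<in>carrier (pro_lim X). pro_lim_map X Y \<phi> x j) \<in> ha_hom (pro_lim X) (pob Y j)"
    using ha_hom_compose[OF pro_lim_heyting[OF X] pro_lim_proj_hom[OF X f(2)] f(3)] by simp
qed

end

lemma pro_id_mem:
  assumes X: "pro_object X" and i: "i \<in> Obj (idx X)"
  shows "(i, \<lambda>a\<in>carrier (pob X i). a) \<in> pro_id X i"
  using pro_class_self[OF X i ha_hom_id[OF pro_obj_heyting[OF X i]]] i by (simp add: pro_id_def)

lemma pro_id_hom:
  assumes X: "pro_object X"
  shows "pro_id X \<in> pro_hom X X"
proof (rule pro_homI[OF X X])
  note id_hom = ha_hom_id[OF pro_obj_heyting[OF X]]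
  show "pro_id X \<in> extensional (Obj (idx X))" by (simp add: pro_id_def)
  show "pro_id X j \<in> pro_colim X (pob X j)" if "j \<in> Obj (idx X)" for j
    using pro_class_in_colim[OF X that id_hom[OF that]] that by (simp add: pro_id_def)
  fix j j' v i f assume j: "j \<in> Obj (idx X)" "j' \<in> Obj (idx X)" and v: "v \<in> Arr (idx X) j j'"
    and f: "(i, f) \<in> pro_id X j"
  let ?v = "fmap (dia X) j j' v"
  have v_hom: "?v \<in> ha_hom (pob X j) (pob X j')" by (rule pro_map_hom[OF X j v])
  have "((j, \<lambda>a\<in>carrier (pob X j). a), (i, f)) \<in> pro_rel X (pob X j)"
    using f j(1) by (simp add: pro_id_def)
  moreover have "compose (carrier (pob X j)) ?v (\<lambda>a\<in>carrier (pob X j). a) =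
      compose (carrier (pob X j)) (\<lambda>a\<in>carrier (pob X j'). a) ?v"
    using ha_hom_closed[OF v_hom] by (intro compose_cong) simp
  ultimately have "((j, compose (carrier (pob X j)) (\<lambda>a\<in>carrier (pob X j'). a) ?v),
      (i, compose (carrier (pob X i)) ?v f)) \<in> pro_rel X (pob X j')"
    using pro_rel_compose[OF X _ v_hom] by metis
  then have "((j', \<lambda>a\<in>carrier (pob X j'). a), (i, compose (carrier (pob X i)) ?v f))
      \<in> pro_rel X (pob X j')"
    by (rule pro_rel_trans[OF X pro_rel_sym[OF X
        pro_rel_transition[OF X j(2,1) v id_hom[OF j(2)]]]])
  then show "(i, compose (carrier (pob X i)) ?v f) \<in> pro_id X j'" using j by (simp add: pro_id_def)
qed

lemma pro_lim_map_id:
  assumes X: "pro_object X"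
  shows "pro_lim_map X X (pro_id X) = (\<lambda>x\<in>carrier (pro_lim X). x)"
proof (rule extensionalityI[OF pro_lim_map_extensional[OF X X]])
  fix x assume x: "x \<in> carrier (pro_lim X)"
  have "pro_lim_map X X (pro_id X) x = x"
  proof (rule pro_lim_eqI[OF X pro_lim_map_closed[OF X X pro_id_hom[OF X] x] x])
    show "pro_lim_map X X (pro_id X) x i = x i" if i: "i \<in> Obj (idx X)" for i
      using pro_lim_nth_closed[OF X x i]
      by (simp add: pro_lim_map_eval[OF X X pro_id_hom[OF X] x i pro_id_mem[OF X i]])
  qed
  then show "pro_lim_map X X (pro_id X) x = (\<lambda>x\<in>carrier (pro_lim X). x) x" using x by simp
qed simp

context
  fixes X :: "('i, 'm, 'h) pro" and Y :: "('j, 'n, 'k) pro" and Z :: "('q, 'l, 'r) pro" and \<phi> \<psi>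
  assumes X: "pro_object X" and Y: "pro_object Y" and Z: "pro_object Z"
    and \<phi>: "\<phi> \<in> pro_hom X Y" and \<psi>: "\<psi> \<in> pro_hom Y Z"
begin

lemma pro_comp_independent:
  assumes q: "q \<in> Obj (idx Z)" and g: "(j, g) \<in> \<psi> q" "(j', g') \<in> \<psi> q"
    and f: "(i, f) \<in> \<phi> j" "(i', f') \<in> \<phi> j'"
  shows "((i, compose (carrier (pob X i)) g f), (i', compose (carrier (pob X i')) g' f'))
      \<in> pro_rel X (pob Z q)"
proof -
  have "((j, g), (j', g')) \<in> pro_rel Y (pob Z q)"
    using pro_colim_rel[OF Y pro_hom_in_colim[OF Y Z \<psi> q] g(1)] g(2) by blast
  then obtain k v v' where j: "j \<in> Obj (idx Y)" "g \<in> ha_hom (pob Y j) (pob Z q)"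
    "j' \<in> Obj (idx Y)" "g' \<in> ha_hom (pob Y j') (pob Z q)"
    and k: "k \<in> Obj (idx Y)" "v \<in> Arr (idx Y) k j" "v' \<in> Arr (idx Y) k j'"
    and eq: "\<forall>b\<in>carrier (pob Y k). g (fmap (dia Y) k j v b) = g' (fmap (dia Y) k j' v' b)"
    by (rule pro_relE[OF Y])
  obtain l e where e: "(l, e) \<in> \<phi> k" "l \<in> Obj (idx X)" "e \<in> ha_hom (pob X l) (pob Y k)"
    using pro_hom_repr[OF X Y \<phi> k(1)] .
  let ?ve = "compose (carrier (pob X l)) (fmap (dia Y) k j v) e"
  let ?v'e = "compose (carrier (pob X l)) (fmap (dia Y) k j' v') e"
  have "((i, f), (l, ?ve)) \<in> pro_rel X (pob Y j)"
    using pro_colim_rel[OF X pro_hom_in_colim[OF X Y \<phi> j(1)] f(1)]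
      pro_hom_compat[OF X Y \<phi> k(1) j(1) k(2) e(1)] by blast
  then have "((i, compose (carrier (pob X i)) g f), (l, compose (carrier (pob X l)) g ?ve))
      \<in> pro_rel X (pob Z q)"
    by (rule pro_rel_compose[OF X _ j(2)])
  moreover have "compose (carrier (pob X l)) g ?ve = compose (carrier (pob X l)) g' ?v'e"
    using eq ha_hom_closed[OF e(3)] by (intro compose_cong) (simp add: compose_eq)
  moreover have "((l, ?v'e), (i', f')) \<in> pro_rel X (pob Y j')"
    using pro_colim_rel[OF X pro_hom_in_colim[OF X Y \<phi> j(3)]
        pro_hom_compat[OF X Y \<phi> k(1) j(3) k(3) e(1)]] f(2) by blast
  then have "((l, compose (carrier (pob X l)) g' ?v'e), (i', compose (carrier (pob X i')) g' f'))
      \<in> pro_rel X (pob Z q)"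
    by (rule pro_rel_compose[OF X _ j(4)])
  ultimately show ?thesis using pro_rel_trans[OF X] by metis
qed

lemma pro_comp_class:
  assumes q: "q \<in> Obj (idx Z)" and g: "(j, g) \<in> \<psi> q" and f: "(i, f) \<in> \<phi> j"
  shows "pro_comp X Y Z \<psi> \<phi> q = pro_rel X (pob Z q) `` {(i, compose (carrier (pob X i)) g f)}"
    (is "_ = ?class g i f")
proof -
  have inner: "(\<Union>(i', f')\<in>\<phi> j'. ?class g' i' f') = ?class g i f" if g': "(j', g') \<in> \<psi> q" for j' g'
  proof (rule SUP_eq_const)
    show "\<phi> j' \<noteq> {}" using pro_hom_repr[OF X Y \<phi> pro_hom_mem(1)[OF Y Z \<psi> q g']] by blast
    show "(case z of (i', f') \<Rightarrow> ?class g' i' f') = ?class g i f" if "z \<in> \<phi> j'" for z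
      using equiv_class_eq[OF pro_rel_equiv[OF X] pro_comp_independent[OF q g' g _ f]] that
      by (cases z) simp
  qed
  have "(\<Union>(j', g')\<in>\<psi> q. \<Union>(i', f')\<in>\<phi> j'. ?class g' i' f') = ?class g i f"
  proof (rule SUP_eq_const)
    show "(case z of (j', g') \<Rightarrow> \<Union>(i', f')\<in>\<phi> j'. ?class g' i' f') = ?class g i f" if "z \<in> \<psi> q" for z
      using inner that by (cases z) simp
  qed (use g in blast)
  then show ?thesis using q by (simp add: pro_comp_def)
qed

lemma pro_comp_mem:
  assumes q: "q \<in> Obj (idx Z)" and g: "(j, g) \<in> \<psi> q" and f: "(i, f) \<in> \<phi> j"
  shows "(i, compose (carrier (pob X i)) g f) \<in> pro_comp X Y Z \<psi> \<phi> q"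
  using pro_comp_independent[OF q g g f f] by (simp add: pro_comp_class[OF q g f])

lemma pro_comp_repr:
  assumes q: "q \<in> Obj (idx Z)"
  obtains j g i f
    where "(j, g) \<in> \<psi> q" "(i, f) \<in> \<phi> j" "j \<in> Obj (idx Y)" "g \<in> ha_hom (pob Y j) (pob Z q)"
    "i \<in> Obj (idx X)" "f \<in> ha_hom (pob X i) (pob Y j)"
proof -
  obtain j g where g: "(j, g) \<in> \<psi> q" "j \<in> Obj (idx Y)" "g \<in> ha_hom (pob Y j) (pob Z q)"
    using pro_hom_repr[OF Y Z \<psi> q] .
  obtain i f where "(i, f) \<in> \<phi> j" "i \<in> Obj (idx X)" "f \<in> ha_hom (pob X i) (pob Y j)"
    using pro_hom_repr[OF X Y \<phi> g(2)] .
  with g show thesis using that by blast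
qed

lemma pro_comp_hom: "pro_comp X Y Z \<psi> \<phi> \<in> pro_hom X Z"
proof (rule pro_homI[OF X Z])
  show "pro_comp X Y Z \<psi> \<phi> \<in> extensional (Obj (idx Z))" by (simp add: pro_comp_def)
  fix q assume q: "q \<in> Obj (idx Z)"
  obtain j g i f where g: "(j, g) \<in> \<psi> q" and f: "(i, f) \<in> \<phi> j"
    and hom: "g \<in> ha_hom (pob Y j) (pob Z q)" "i \<in> Obj (idx X)" "f \<in> ha_hom (pob X i) (pob Y j)"
    using q by (rule pro_comp_repr)
  show "pro_comp X Y Z \<psi> \<phi> q \<in> pro_colim X (pob Z q)"
    unfolding pro_comp_class[OF q g f]
    by (rule pro_class_in_colim[OF X hom(2) ha_hom_compose[OF pro_obj_heyting[OF X hom(2)]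
        hom(3,1)]])
  fix q' w i' h assume q': "q' \<in> Obj (idx Z)" and w: "w \<in> Arr (idx Z) q q'"
    and h: "(i', h) \<in> pro_comp X Y Z \<psi> \<phi> q"
  let ?w = "fmap (dia Z) q q' w"
  have "((i, compose (carrier (pob X i)) g f), (i', h)) \<in> pro_rel X (pob Z q)"
    using h by (simp add: pro_comp_class[OF q g f])
  then have "((i, compose (carrier (pob X i)) ?w (compose (carrier (pob X i)) g f)),
      (i', compose (carrier (pob X i')) ?w h)) \<in> pro_rel X (pob Z q')"
    by (rule pro_rel_compose[OF X _ pro_map_hom[OF Z q q' w]])
  then show "(i', compose (carrier (pob X i')) ?w h) \<in> pro_comp X Y Z \<psi> \<phi> q'"
    by (simp add: pro_comp_class[OF q' pro_hom_compat[OF Y Z \<psi> q q' w g] f]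
        compose_assoc[OF ha_hom_funcset[OF hom(3)]])
qed

lemma pro_lim_map_comp:
  "pro_lim_map X Z (pro_comp X Y Z \<psi> \<phi>) =
      compose (carrier (pro_lim X)) (pro_lim_map Y Z \<psi>) (pro_lim_map X Y \<phi>)"
proof (rule extensionalityI[OF pro_lim_map_extensional[OF X Z]])
  fix x assume x: "x \<in> carrier (pro_lim X)"
  note y = pro_lim_map_closed[OF X Y \<phi> x]
  have "pro_lim_map X Z (pro_comp X Y Z \<psi> \<phi>) x = pro_lim_map Y Z \<psi> (pro_lim_map X Y \<phi> x)"
  proof (rule pro_lim_eqI[OF Z pro_lim_map_closed[OF X Z pro_comp_hom x]
      pro_lim_map_closed[OF Y Z \<psi> y]])
    fix q assume q: "q \<in> Obj (idx Z)"
    obtain j g i f where g: "(j, g) \<in> \<psi> q" and f: "(i, f) \<in> \<phi> j" and j: "j \<in> Obj (idx Y)"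
      and i: "i \<in> Obj (idx X)"
      using q by (rule pro_comp_repr)
    show "pro_lim_map X Z (pro_comp X Y Z \<psi> \<phi>) x q = pro_lim_map Y Z \<psi> (pro_lim_map X Y \<phi> x) q"
      using pro_lim_nth_closed[OF X x i]
      by (simp add: pro_lim_map_eval[OF X Z pro_comp_hom x q pro_comp_mem[OF q g f]]
          pro_lim_map_eval[OF Y Z \<psi> y q g] pro_lim_map_eval[OF X Y \<phi> x j f] compose_eq)
  qed
  then show "pro_lim_map X Z (pro_comp X Y Z \<psi> \<phi>) x =
      compose (carrier (pro_lim X)) (pro_lim_map Y Z \<psi>) (pro_lim_map X Y \<phi>) x"
    using x by (simp add: compose_eq)
qed simp

end

lemma Pro_cat_simps [simp]:
  "Obj Pro_cat = {X. pro_object X}" "Arr Pro_cat = pro_hom" "Ident Pro_cat = pro_id"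
  "Cmp Pro_cat = pro_comp"
  by (simp_all add: Pro_cat_def)

lemma forget_functor_functor: "is_functor Pro_cat HA_cat forget_functor"
  unfolding is_functor_def
  by (simp add: forget_functor_def HA_Obj pro_lim_heyting pro_lim_map_hom pro_lim_map_id
      pro_lim_map_comp)

section \<open>Universal maps to limits of pro-objects\<close>

abbreviation pro_postcompose ::
  "'a gorder \<Rightarrow> ('i, 'm, 'h) pro \<Rightarrow> ('j, 'n, 'k) pro \<Rightarrow> ('a \<Rightarrow> 'i \<Rightarrow> 'h) \<Rightarrow>
   ('j \<Rightarrow> ('i \<times> ('h \<Rightarrow> 'k)) set) \<Rightarrow> 'a \<Rightarrow> 'j \<Rightarrow> 'k" where
  "pro_postcompose A X Y r \<phi> \<equiv> compose (carrier A) (pro_lim_map X Y \<phi>) r"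

lemma pro_postcompose_hom:
  assumes "heyting_algebra A" "pro_object X" "pro_object Y" "r \<in> ha_hom A (pro_lim X)"
    "\<phi> \<in> pro_hom X Y"
  shows "pro_postcompose A X Y r \<phi> \<in> ha_hom A (pro_lim Y)"
  by (rule ha_hom_compose[OF assms(1,4) pro_lim_map_hom[OF assms(2,3,5)]])

lemma pro_postcompose_id:
  assumes "pro_object X" "r \<in> ha_hom A (pro_lim X)"
  shows "pro_postcompose A X X r (pro_id X) = r"
  by (simp add: pro_lim_map_id[OF assms(1)] Id_compose[OF ha_hom_funcset[OF assms(2)]
      ha_hom_extensional[OF assms(2)]])

lemma pro_postcompose_comp:
  assumes "pro_object X" "pro_object Y" "pro_object Z" "r \<in> ha_hom A (pro_lim X)"
    and "\<phi> \<in> pro_hom X Y" "\<psi> \<in> pro_hom Y Z"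
  shows "pro_postcompose A X Z r (pro_comp X Y Z \<psi> \<phi>) =
      pro_postcompose A Y Z (pro_postcompose A X Y r \<phi>) \<psi>"
  by (simp add: pro_lim_map_comp[OF assms(1-3,5,6)] compose_assoc[OF ha_hom_funcset[OF assms(4)]])

lemma pro_lim_component_hom:
  assumes A: "heyting_algebra A" and Y: "pro_object Y" and g: "g \<in> ha_hom A (pro_lim Y)"
    and j: "j \<in> Obj (idx Y)"
  shows "(\<lambda>a\<in>carrier A. g a j) \<in> ha_hom A (pob Y j)"
proof -
  have "compose (carrier A) (\<lambda>y\<in>carrier (pro_lim Y). y j) g = (\<lambda>a\<in>carrier A. g a j)"
    using ha_hom_closed[OF g] by (simp add: compose_def fun_eq_iff)
  then show ?thesis using ha_hom_compose[OF A g pro_lim_proj_hom[OF Y j]] by simp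
qed

definition factorizations ::
  "'a gorder \<Rightarrow> ('i, 'm, 'h) pro \<Rightarrow> ('a \<Rightarrow> 'i \<Rightarrow> 'h) \<Rightarrow> 'k gorder \<Rightarrow> ('a \<Rightarrow> 'k) \<Rightarrow> ('i \<times> ('h \<Rightarrow> 'k)) set"
    where
  "factorizations A X r B g = {(i, f). i \<in> Obj (idx X) \<and> f \<in> ha_hom (pob X i) B \<and>
     (\<forall>a\<in>carrier A. f (r a i) = g a)}"

lemma factorizations_iff:
  "(i, f) \<in> factorizations A X r B g \<longleftrightarrow> i \<in> Obj (idx X) \<and> f \<in> ha_hom (pob X i) B \<and>
    (\<forall>a\<in>carrier A. f (r a i) = g a)"
  by (simp add: factorizations_def)

lemma factorizations_in_colimI:
  assumes X: "pro_object X" and r: "r \<in> ha_hom A (pro_lim X)"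
    and f: "(i, f) \<in> factorizations A X r B g"
    and unique: "\<And>i f i' f'. (i, f) \<in> factorizations A X r B g \<Longrightarrow>
        (i', f') \<in> factorizations A X r B g \<Longrightarrow>
      ((i, f), (i', f')) \<in> pro_rel X B"
  shows "factorizations A X r B g \<in> pro_colim X B"
proof -
  have "(i', f') \<in> factorizations A X r B g" if rel: "((i, f), (i', f')) \<in> pro_rel X B" for i' f'
  proof -
    have "i' \<in> Obj (idx X)" "f' \<in> ha_hom (pob X i') B"
      using rel by (simp_all add: pro_rel_iff[OF X])
    moreover have "f' (r a i') = g a" if "a \<in> carrier A" for a
      using pro_rel_eval[OF X rel ha_hom_closed[OF r that]] f that by (simp add: factorizations_iff)
    ultimately show ?thesis by (simp add: factorizations_iff)
  qed
  then have "factorizations A X r B g = pro_rel X B `` {(i, f)}" using unique[OF f] by auto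
  moreover have "i \<in> Obj (idx X)" "f \<in> ha_hom (pob X i) B"
    using f by (simp_all add: factorizations_iff)
  ultimately show ?thesis using pro_class_in_colim[OF X] by metis
qed

text \<open>
  That the factorizations of \<open>g\<close> form an element of the colimit says both that there is one and that
  any two of them become equal in the colimit.
\<close>

locale pro_representation =
  fixes A :: "'a gorder" and X :: "('i, 'm, 'h) pro" and r :: "'a \<Rightarrow> 'i \<Rightarrow> 'h"
  assumes heyting: "heyting_algebra A" and pro_object: "pro_object X"
    and hom: "r \<in> ha_hom A (pro_lim X)"
    and factorizations_in_colim: "\<And>(B :: 'k gorder) g. heyting_algebra B \<Longrightarrow> finite (carrier B) \<Longrightarrow>
      g \<in> ha_hom A B \<Longrightarrow> factorizations A X r B g \<in> pro_colim X B"
begin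

lemma component_factorizations_in_colim:
  fixes Y :: "('j, 'n, 'k) pro"
  assumes Y: "pro_object Y" and g: "g \<in> ha_hom A (pro_lim Y)" and j: "j \<in> Obj (idx Y)"
  shows "factorizations A X r (pob Y j) (\<lambda>a\<in>carrier A. g a j) \<in> pro_colim X (pob Y j)"
  by (rule factorizations_in_colim[OF pro_obj_heyting[OF Y j] pro_obj_finite[OF Y j]
        pro_lim_component_hom[OF heyting Y g j]])

lemma pro_hom_eq_factorizations:
  fixes Y :: "('j, 'n, 'k) pro"
  assumes Y: "pro_object Y" and \<phi>: "\<phi> \<in> pro_hom X Y" and j: "j \<in> Obj (idx Y)"
  shows "\<phi> j = factorizations A X r (pob Y j) (\<lambda>a\<in>carrier A. pro_postcompose A X Y r \<phi> a j)"
proof -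
  obtain i f where f: "(i, f) \<in> \<phi> j" "i \<in> Obj (idx X)" "f \<in> ha_hom (pob X i) (pob Y j)"
    using pro_object Y \<phi> j by (rule pro_hom_repr)
  then have "(i, f) \<in> factorizations A X r (pob Y j) (\<lambda>a\<in>carrier A. pro_postcompose A X Y r \<phi> a j)"
    using pro_lim_map_eval[OF pro_object Y \<phi> _ j f(1)] ha_hom_closed[OF hom]
    by (simp add: factorizations_iff compose_eq)
  with f(1) show ?thesis
    by (rule pro_colim_eqI[OF pro_object pro_hom_in_colim[OF pro_object Y \<phi> j]
          component_factorizations_in_colim[OF Y
            pro_postcompose_hom[OF heyting pro_object Y hom \<phi>] j]])
qed

definition extension :: "('j, 'n, 'k) pro \<Rightarrow> ('a \<Rightarrow> 'j \<Rightarrow> 'k) \<Rightarrow> 'j \<Rightarrow> ('i \<times> ('h \<Rightarrow> 'k)) set" where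
  "extension Y g = (\<lambda>j\<in>Obj (idx Y). factorizations A X r (pob Y j) (\<lambda>a\<in>carrier A. g a j))"

lemma extension_hom:
  fixes Y :: "('j, 'n, 'k) pro"
  assumes Y: "pro_object Y" and g: "g \<in> ha_hom A (pro_lim Y)"
  shows "extension Y g \<in> pro_hom X Y"
proof (rule pro_homI[OF pro_object Y])
  show "extension Y g \<in> extensional (Obj (idx Y))" by (simp add: extension_def)
  show "extension Y g j \<in> pro_colim X (pob Y j)" if "j \<in> Obj (idx Y)" for j
    using component_factorizations_in_colim[OF Y g that] that by (simp add: extension_def)
  fix j j' v i f assume j: "j \<in> Obj (idx Y)" "j' \<in> Obj (idx Y)" and v: "v \<in> Arr (idx Y) j j'"
    and "(i, f) \<in> extension Y g j"
  then have i: "i \<in> Obj (idx X)" and f: "f \<in> ha_hom (pob X i) (pob Y j)"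
    and fg: "\<forall>a\<in>carrier A. f (r a i) = g a j"
    by (simp_all add: extension_def factorizations_iff)
  have "compose (carrier (pob X i)) (fmap (dia Y) j j' v) f (r a i) = g a j'"
    if a: "a \<in> carrier A" for a
    using fg a pro_lim_nth_closed[OF pro_object ha_hom_closed[OF hom a] i]
      pro_lim_compat[OF Y ha_hom_closed[OF g a] j v]
    by (simp add: compose_eq)
  moreover have "compose (carrier (pob X i)) (fmap (dia Y) j j' v) f \<in> ha_hom (pob X i) (pob Y j')"
    by (rule ha_hom_compose[OF pro_obj_heyting[OF pro_object i] f pro_map_hom[OF Y j v]])
  ultimately show "(i, compose (carrier (pob X i)) (fmap (dia Y) j j' v) f) \<in> extension Y g j'"
    using i j(2) by (simp add: extension_def factorizations_iff)
qed

lemma pro_postcompose_extension: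
  fixes Y :: "('j, 'n, 'k) pro"
  assumes Y: "pro_object Y" and g: "g \<in> ha_hom A (pro_lim Y)"
  shows "pro_postcompose A X Y r (extension Y g) = g"
proof (rule ha_hom_eqI[OF pro_postcompose_hom[OF heyting pro_object Y hom extension_hom[OF Y g]] g])
  fix a assume a: "a \<in> carrier A"
  note ra = ha_hom_closed[OF hom a] and ext = extension_hom[OF Y g]
  have "pro_lim_map X Y (extension Y g) (r a) = g a"
  proof (rule pro_lim_eqI[OF Y pro_lim_map_closed[OF pro_object Y ext ra] ha_hom_closed[OF g a]])
    fix j assume j: "j \<in> Obj (idx Y)"
    obtain i f
      where f: "(i, f) \<in> extension Y g j" "i \<in> Obj (idx X)" "f \<in> ha_hom (pob X i) (pob Y j)"
      using pro_object Y ext j by (rule pro_hom_repr)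
    have "f (r a i) = g a j" using f(1) a j by (simp add: extension_def factorizations_iff)
    then show "pro_lim_map X Y (extension Y g) (r a) j = g a j"
      by (simp add: pro_lim_map_eval[OF pro_object Y ext ra j f(1)])
  qed
  then show "pro_postcompose A X Y r (extension Y g) a = g a" using a by (simp add: compose_eq)
qed

theorem universal:
  fixes Y :: "('j, 'n, 'k) pro"
  assumes Y: "pro_object Y"
  shows "bij_betw (pro_postcompose A X Y r) (pro_hom X Y) (ha_hom A (pro_lim Y))"
proof (rule bij_betwI[where g = "extension Y"])
  show "extension Y (pro_postcompose A X Y r \<phi>) = \<phi>" if "\<phi> \<in> pro_hom X Y" for \<phi>
    using pro_hom_eq_factorizations[OF Y that] pro_hom_extensional[OF pro_object Y that]
    by (intro extensionalityI[of _ "Obj (idx Y)"]) (simp_all add: extension_def)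
qed (use pro_postcompose_hom[OF heyting pro_object Y hom] extension_hom[OF Y]
    pro_postcompose_extension[OF Y] in auto)

end

definition pro_universal ::
  "'a gorder \<Rightarrow> ('i, 'm, 'h) pro \<Rightarrow> ('a \<Rightarrow> 'i \<Rightarrow> 'h) \<Rightarrow> ('j, 'n, 'k) pro itself \<Rightarrow> bool" where
  "pro_universal A X r (T :: ('j, 'n, 'k) pro itself) \<longleftrightarrow> pro_object X \<and> r \<in> ha_hom A (pro_lim X) \<and>
     (\<forall>Y :: ('j, 'n, 'k) pro. pro_object Y \<longrightarrow>
        bij_betw (pro_postcompose A X Y r) (pro_hom X Y) (ha_hom A (pro_lim Y)))"

lemma pro_universal_eqI:
  fixes Y :: "('j, 'n, 'k) pro"
  assumes "pro_universal A X r TYPE(('j, 'n, 'k) pro)" "pro_object Y" "\<phi> \<in> pro_hom X Y"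
    "\<psi> \<in> pro_hom X Y"
    and "pro_postcompose A X Y r \<phi> = pro_postcompose A X Y r \<psi>"
  shows "\<phi> = \<psi>"
  using assms unfolding pro_universal_def bij_betw_def by (blast dest: inj_onD)

lemma pro_universal_comp_eqI:
  fixes Y :: "('j, 'n, 'k) pro" and Y' :: "('p, 'l, 'q) pro" and Z :: "('t, 'u, 'v) pro"
  assumes X: "pro_universal A X r TYPE(('t, 'u, 'v) pro)"
    and Y: "pro_object Y" "\<phi> \<in> pro_hom X Y" "\<psi> \<in> pro_hom Y Z"
    and Y': "pro_object Y'" "\<phi>' \<in> pro_hom X Y'" "\<psi>' \<in> pro_hom Y' Z"
    and Z: "pro_object Z"
    and eq: "pro_postcompose A Y Z (pro_postcompose A X Y r \<phi>) \<psi> =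
      pro_postcompose A Y' Z (pro_postcompose A X Y' r \<phi>') \<psi>'"
  shows "pro_comp X Y Z \<psi> \<phi> = pro_comp X Y' Z \<psi>' \<phi>'"
proof (rule pro_universal_eqI[OF X Z])
  have X_obj: "pro_object X" and r: "r \<in> ha_hom A (pro_lim X)"
    using X by (simp_all add: pro_universal_def)
  show "pro_comp X Y Z \<psi> \<phi> \<in> pro_hom X Z" "pro_comp X Y' Z \<psi>' \<phi>' \<in> pro_hom X Z"
    by (rule pro_comp_hom[OF X_obj Y(1) Z Y(2,3)] pro_comp_hom[OF X_obj Y'(1) Z Y'(2,3)])+
  show "pro_postcompose A X Z r (pro_comp X Y Z \<psi> \<phi>) =
      pro_postcompose A X Z r (pro_comp X Y' Z \<psi>' \<phi>')"
    unfolding pro_postcompose_comp[OF X_obj Y(1) Z r Y(2,3)]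
      pro_postcompose_comp[OF X_obj Y'(1) Z r Y'(2,3)]
    by (rule eq)
qed

lemma pro_universal_extend:
  fixes Y :: "('j, 'n, 'k) pro"
  assumes "pro_universal A X r TYPE(('j, 'n, 'k) pro)" "pro_object Y" "g \<in> ha_hom A (pro_lim Y)"
  obtains \<phi> where "\<phi> \<in> pro_hom X Y" "pro_postcompose A X Y r \<phi> = g"
proof -
  have "g \<in> pro_postcompose A X Y r ` pro_hom X Y"
    using assms unfolding pro_universal_def bij_betw_def by blast
  then show thesis using that by blast
qed

lemma pro_universal_inverse:
  fixes X :: "('i, 'm, 'h) pro"
  assumes X: "pro_universal A X r TYPE(('i, 'm, 'h) pro)" and Y: "pro_object Y"
    and \<phi>: "\<phi> \<in> pro_hom X Y" and \<psi>: "\<psi> \<in> pro_hom Y X"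
    and eq: "pro_postcompose A Y X (pro_postcompose A X Y r \<phi>) \<psi> = r"
  shows "pro_comp X Y X \<psi> \<phi> = pro_id X"
proof (rule pro_universal_eqI[OF X])
  have X_univ: "pro_object X" "r \<in> ha_hom A (pro_lim X)"
    using X by (simp_all add: pro_universal_def)
  then show "pro_object X" "pro_comp X Y X \<psi> \<phi> \<in> pro_hom X X" "pro_id X \<in> pro_hom X X"
    using pro_comp_hom[OF _ Y _ \<phi> \<psi>] pro_id_hom by blast+
  show "pro_postcompose A X X r (pro_comp X Y X \<psi> \<phi>) = pro_postcompose A X X r (pro_id X)"
    unfolding pro_postcompose_comp[OF X_univ(1) Y X_univ \<phi> \<psi>] pro_postcompose_id[OF X_univ]
    by (rule eq)
qed

lemma pro_universal_iso:
  fixes X :: "('i, 'm, 'h) pro" and Y :: "('j, 'n, 'k) pro"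
  assumes X: "pro_universal A X r TYPE(('i, 'm, 'h) pro)"
    and Y: "pro_universal A Y s TYPE(('i, 'm, 'h) pro)" "pro_universal A Y s TYPE(('j, 'n, 'k) pro)"
    and \<phi>: "\<phi> \<in> pro_hom X Y" "pro_postcompose A X Y r \<phi> = s"
  shows "pro_iso X Y \<phi>"
proof -
  have X_univ: "pro_object X" "r \<in> ha_hom A (pro_lim X)" and Y_obj: "pro_object Y"
    using X Y(1) by (simp_all add: pro_universal_def)
  obtain \<psi> where \<psi>: "\<psi> \<in> pro_hom Y X" "pro_postcompose A Y X s \<psi> = r"
    using Y(1) X_univ by (rule pro_universal_extend)
  have "pro_comp X Y X \<psi> \<phi> = pro_id X" "pro_comp Y X Y \<phi> \<psi> = pro_id Y"
    using pro_universal_inverse[OF X Y_obj \<phi>(1) \<psi>(1)]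
      pro_universal_inverse[OF Y(2) X_univ(1) \<psi>(1) \<phi>(1)] \<phi>(2) \<psi>(2)
    by simp_all
  then show ?thesis using \<phi>(1) \<psi>(1) by (auto simp: pro_iso_def)
qed

lemma profinite_completionD:
  fixes L :: "('a gorder, 'a \<Rightarrow> 'a, ('i, 'm, 'h) pro, 'i \<Rightarrow> ('i \<times> ('h \<Rightarrow> 'h)) set) functr"
  assumes L: "profinite_completion L \<eta> (T :: ('j, 'n, 'k) pro itself)" and A: "A \<in> Obj HA_cat"
  shows "pro_universal A (fobj L A) (\<eta> A) TYPE(('j, 'n, 'k) pro)"
    and "B \<in> Obj HA_cat \<Longrightarrow> h \<in> ha_hom A B \<Longrightarrow> fmap L A B h \<in> pro_hom (fobj L A) (fobj L B)"
    and "B \<in> Obj HA_cat \<Longrightarrow> h \<in> ha_hom A B \<Longrightarrow>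
      compose (carrier A) (\<eta> B) h = pro_postcompose A (fobj L A) (fobj L B) (\<eta> A) (fmap L A B h)"
  using assms by (simp_all add: profinite_completion_def pro_universal_def is_functor_def)

lemma profinite_completion_unique:
  fixes L :: "('a gorder, 'a \<Rightarrow> 'a, ('i, 'm, 'h) pro, 'i \<Rightarrow> ('i \<times> ('h \<Rightarrow> 'h)) set) functr"
    and M :: "('a gorder, 'a \<Rightarrow> 'a, ('j, 'n, 'k) pro, 'j \<Rightarrow> ('j \<times> ('k \<Rightarrow> 'k)) set) functr"
  assumes L: "profinite_completion L \<eta> TYPE(('i, 'm, 'h) pro)"
    "profinite_completion L \<eta> TYPE(('j, 'n, 'k) pro)"
    and M: "profinite_completion M \<zeta> TYPE(('i, 'm, 'h) pro)"
      "profinite_completion M \<zeta> TYPE(('j, 'n, 'k) pro)"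
  obtains \<theta> where "pro_nat_iso L M \<theta>"
    "\<And>A. A \<in> Obj HA_cat \<Longrightarrow> pro_postcompose A (fobj L A) (fobj M A) (\<eta> A) (\<theta> A) = \<zeta> A"
proof -
  note univ_L = profinite_completionD(1)[OF L(1)] profinite_completionD(1)[OF L(2)]
  note univ_M = profinite_completionD(1)[OF M(1)] profinite_completionD(1)[OF M(2)]
  have L_obj: "pro_object (fobj L A)" if "A \<in> Obj HA_cat" for A
    using univ_L(1)[OF that] by (simp add: pro_universal_def)
  have M_obj: "pro_object (fobj M A)" and \<zeta>: "\<zeta> A \<in> ha_hom A (pro_lim (fobj M A))"
    if "A \<in> Obj HA_cat" for A
    using univ_M(1)[OF that] by (simp_all add: pro_universal_def)
  have "\<exists>\<theta>. \<theta> \<in> pro_hom (fobj L A) (fobj M A) \<and>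
      pro_postcompose A (fobj L A) (fobj M A) (\<eta> A) \<theta> = \<zeta> A"
    if A: "A \<in> Obj HA_cat" for A
    using pro_universal_extend[OF univ_L(2)[OF A] M_obj[OF A] \<zeta>[OF A]] by blast
  then obtain \<theta> where \<theta>: "\<And>A. A \<in> Obj HA_cat \<Longrightarrow> \<theta> A \<in> pro_hom (fobj L A) (fobj M A)"
    and \<theta>_\<eta>: "\<And>A. A \<in> Obj HA_cat \<Longrightarrow> pro_postcompose A (fobj L A) (fobj M A) (\<eta> A) (\<theta> A) = \<zeta> A"
    by metis
  have "pro_comp (fobj L A) (fobj L B) (fobj M B) (\<theta> B) (fmap L A B h) =
      pro_comp (fobj L A) (fobj M A) (fobj M B) (fmap M A B h) (\<theta> A)"
    if A: "A \<in> Obj HA_cat" and B: "B \<in> Obj HA_cat" and h: "h \<in> ha_hom A B" for A B h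
  proof -
    note Lh = profinite_completionD(2,3)[OF L(1) A B h]
      and Mh = profinite_completionD(2,3)[OF M(1) A B h]
    have "pro_postcompose A (fobj L B) (fobj M B)
        (pro_postcompose A (fobj L A) (fobj L B) (\<eta> A) (fmap L A B h)) (\<theta> B) =
        compose (carrier A) (\<zeta> B) h"
      unfolding Lh(2)[symmetric] \<theta>_\<eta>[OF B, symmetric]
      by (rule compose_assoc[OF ha_hom_funcset[OF h]])
    also have "\<dots> = pro_postcompose A (fobj M A) (fobj M B)
        (pro_postcompose A (fobj L A) (fobj M A) (\<eta> A) (\<theta> A)) (fmap M A B h)"
      unfolding \<theta>_\<eta>[OF A] by (rule Mh(2))
    finally show ?thesis
      by (rule pro_universal_comp_eqI[OF univ_L(2)[OF A] L_obj[OF B] Lh(1) \<theta>[OF B]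
            M_obj[OF A] \<theta>[OF A] Mh(1) M_obj[OF B]])
  qed
  then have "pro_nat_iso L M \<theta>"
    using pro_universal_iso[OF univ_L(1) univ_M \<theta> \<theta>_\<eta>] by (simp add: pro_nat_iso_def)
  then show thesis using that \<theta>_\<eta> by blast
qed

section \<open>Profinite algebras of up-sets\<close>

lemma fin_upsets_Un: "F \<in> fin_upsets X \<Longrightarrow> G \<in> fin_upsets X \<Longrightarrow> F \<union> G \<in> fin_upsets X"
  by (auto simp: fin_upsets_def upsets_def)

lemma fin_upsets_partial_order:
  "partial_order X \<Longrightarrow> F \<in> fin_upsets X \<Longrightarrow> partial_order (X\<lparr>carrier := F\<rparr>)"
  by (rule partial_order_subset[OF _ fin_upsetsD(3)])

lemma restrict_open:
  assumes f: "f \<in> open_maps X Y" and F: "F \<in> upsets X" and G: "f ` F \<subseteq> G" "G \<subseteq> carrier Y"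
  shows "restrict f F \<in> open_maps (X\<lparr>carrier := F\<rparr>) (Y\<lparr>carrier := G\<rparr>)"
proof (rule open_mapsI)
  have FX: "p \<in> carrier X" if "p \<in> F" for p using that upsets_subset[OF F] by blast
  show "restrict f F p \<sqsubseteq>\<^bsub>Y\<lparr>carrier := G\<rparr>\<^esub> restrict f F p'"
    if "p \<in> carrier (X\<lparr>carrier := F\<rparr>)" "p' \<in> carrier (X\<lparr>carrier := F\<rparr>)" "p \<sqsubseteq>\<^bsub>X\<lparr>carrier := F\<rparr>\<^esub> p'"
      for p p'
    using that open_maps_mono[OF f FX FX] by simp
  fix p q
  assume "p \<in> carrier (X\<lparr>carrier := F\<rparr>)" "q \<in> carrier (Y\<lparr>carrier := G\<rparr>)"
    and "restrict f F p \<sqsubseteq>\<^bsub>Y\<lparr>carrier := G\<rparr>\<^esub> q"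
  then have p: "p \<in> F" and q: "q \<in> carrier Y" "f p \<sqsubseteq>\<^bsub>Y\<^esub> q" using G(2) by auto
  then obtain p' where "p' \<in> carrier X" "p \<sqsubseteq>\<^bsub>X\<^esub> p'" "f p' = q"
    using open_maps_lift[OF f FX[OF p]] by blast
  then show "\<exists>p'\<in>carrier (X\<lparr>carrier := F\<rparr>). p \<sqsubseteq>\<^bsub>X\<lparr>carrier := F\<rparr>\<^esub> p' \<and> restrict f F p' = q"
    using upsets_upward[OF F p] by (intro bexI[of _ p']) simp_all
qed (use G(1) in auto)

lemma UU_restriction_hom:
  assumes Y: "partial_order Y" and G: "G \<in> upsets Y"
  shows "(\<lambda>V\<in>upsets Y. V \<inter> G) \<in> ha_hom (UU Y) (UU (Y\<lparr>carrier := G\<rparr>))"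
proof -
  note GY = upsets_subset[OF G]
  have "restrict (\<lambda>y\<in>carrier Y. y) G \<in> open_maps (Y\<lparr>carrier := G\<rparr>) Y"
    using restrict_open[OF open_maps_id[OF Y] G, of "carrier Y"] GY by auto
  moreover have "UU_map (Y\<lparr>carrier := G\<rparr>) Y (restrict (\<lambda>y\<in>carrier Y. y) G) = (\<lambda>V\<in>upsets Y. V \<inter> G)"
    using GY by (auto simp: UU_map_def fun_eq_iff)
  ultimately show ?thesis using UU_map_hom[OF partial_order_subset[OF Y GY] Y] by metis
qed

lemma U_pro_obj_simps [simp]:
  "Obj (idx (U_pro_obj X)) = fin_upsets X"
  "Arr (idx (U_pro_obj X)) F G = (if G \<subseteq> F then {()} else {})"
  "Cmp (idx (U_pro_obj X)) = (\<lambda>_ _ _ _ _. ())"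
  "Ident (idx (U_pro_obj X)) = (\<lambda>_. ())"
  "pob (U_pro_obj X) F = UU (X\<lparr>carrier := F\<rparr>)"
  "fmap (dia (U_pro_obj X)) F G u = (\<lambda>V\<in>upsets (X\<lparr>carrier := F\<rparr>). V \<inter> G)"
  by (simp_all add: U_pro_obj_def)

lemma U_pro_obj_cofiltered: "cofiltered (idx (U_pro_obj X))"
  unfolding cofiltered_def category_def
proof (intro conjI)
  show "Obj (idx (U_pro_obj X)) \<noteq> {}"
    by (auto simp: fin_upsets_def upsets_def)
  have "\<exists>H\<in>fin_upsets X. F \<subseteq> H \<and> G \<subseteq> H" if "F \<in> fin_upsets X" "G \<in> fin_upsets X" for F G
    using fin_upsets_Un[OF that] by blast
  then show "\<forall>F\<in>Obj (idx (U_pro_obj X)). \<forall>G\<in>Obj (idx (U_pro_obj X)).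
      \<exists>H\<in>Obj (idx (U_pro_obj X)).
        Arr (idx (U_pro_obj X)) H F \<noteq> {} \<and> Arr (idx (U_pro_obj X)) H G \<noteq> {}"
    by simp blast
qed (auto split: if_splits)

lemma U_pro_obj_restriction_hom:
  assumes "partial_order X" and F: "F \<in> fin_upsets X" and G: "G \<in> fin_upsets X" "G \<subseteq> F"
  shows "(\<lambda>V\<in>upsets (X\<lparr>carrier := F\<rparr>). V \<inter> G)
      \<in> ha_hom (UU (X\<lparr>carrier := F\<rparr>)) (UU (X\<lparr>carrier := G\<rparr>))"
proof -
  have "G \<in> upsets (X\<lparr>carrier := F\<rparr>)"
    using upsets_restrict[OF fin_upsetsD(1)[OF G(1)] fin_upsetsD(3)[OF F]] G(2)
    by (simp add: Int_absorb2)
  then show ?thesis using UU_restriction_hom[OF fin_upsets_partial_order[OF assms(1) F]] by simp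
qed

lemma U_pro_obj_diagram:
  assumes X: "partial_order X"
  shows "is_functor (idx (U_pro_obj X)) HAf_cat (dia (U_pro_obj X))"
  unfolding is_functor_def
proof (intro conjI ballI)
  fix F assume "F \<in> Obj (idx (U_pro_obj X))"
  then have F: "F \<in> fin_upsets X" by simp
  have "finite (upsets (X\<lparr>carrier := F\<rparr>))"
    by (rule finite_subset[of _ "Pow F"]) (use fin_upsetsD(2)[OF F] in \<open>auto simp: upsets_def\<close>)
  then show "pob (U_pro_obj X) F \<in> Obj HAf_cat"
    using UU_heyting[OF fin_upsets_partial_order[OF X F]] by (simp add: HAf_cat_def)
  have "V \<inter> F = V" if "V \<in> upsets (X\<lparr>carrier := F\<rparr>)" for V using upsets_subset[OF that] by auto
  then show "fmap (dia (U_pro_obj X)) F F (Ident (idx (U_pro_obj X)) F) =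
      Ident HAf_cat (pob (U_pro_obj X) F)"
    by (simp add: HAf_cat_def cong: restrict_cong)
  fix G u assume "G \<in> Obj (idx (U_pro_obj X))" "u \<in> Arr (idx (U_pro_obj X)) F G"
  then have G: "G \<in> fin_upsets X" "G \<subseteq> F" by (auto split: if_splits)
  show "fmap (dia (U_pro_obj X)) F G u \<in> Arr HAf_cat (pob (U_pro_obj X) F) (pob (U_pro_obj X) G)"
    using U_pro_obj_restriction_hom[OF X F G] by (simp add: HAf_cat_def)
  fix H v assume "v \<in> Arr (idx (U_pro_obj X)) G H"
  then have "V \<inter> H = V \<inter> G \<inter> H" for V by (auto split: if_splits)
  moreover have "V \<inter> G \<in> upsets (X\<lparr>carrier := G\<rparr>)" if "V \<in> upsets (X\<lparr>carrier := F\<rparr>)" for V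
    using hom_UU_upset[OF U_pro_obj_restriction_hom[OF X F G]] that by simp
  ultimately show "fmap (dia (U_pro_obj X)) F H (Cmp (idx (U_pro_obj X)) F G H v u) =
      Cmp HAf_cat (pob (U_pro_obj X) F) (pob (U_pro_obj X) G) (pob (U_pro_obj X) H)
        (fmap (dia (U_pro_obj X)) G H v) (fmap (dia (U_pro_obj X)) F G u)"
    by (simp add: HAf_cat_def compose_def cong: restrict_cong)
qed

lemma U_pro_obj_pro_object: "partial_order X \<Longrightarrow> pro_object (U_pro_obj X)"
  by (simp add: pro_object_def U_pro_obj_cofiltered U_pro_obj_diagram)

context
  fixes X :: "'x gorder" and Y :: "'y gorder" and f
  assumes X: "partial_order X" and Y: "partial_order Y" and f: "f \<in> open_maps X Y"
begin

abbreviation (input) "UU_fin_map F \<equiv> UU_map (X\<lparr>carrier := F\<rparr>) (Y\<lparr>carrier := f ` F\<rparr>) f"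

lemma fin_upsets_image: "F \<in> fin_upsets X \<Longrightarrow> f ` F \<in> fin_upsets Y"
  using image_upset[OF f] by (simp add: fin_upsets_def)

lemma UU_fin_map_hom:
  assumes F: "F \<in> fin_upsets X"
  shows "UU_fin_map F \<in> ha_hom (UU (Y\<lparr>carrier := f ` F\<rparr>)) (UU (X\<lparr>carrier := F\<rparr>))"
proof -
  note fF = fin_upsets_image[OF F]
  have "restrict f F \<in> open_maps (X\<lparr>carrier := F\<rparr>) (Y\<lparr>carrier := f ` F\<rparr>)"
    by (rule restrict_open[OF f fin_upsetsD(1)[OF F] order_refl fin_upsetsD(3)[OF fF]])
  moreover have "UU_map (X\<lparr>carrier := F\<rparr>) (Y\<lparr>carrier := f ` F\<rparr>) (restrict f F) = UU_fin_map F"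
    by (simp add: UU_map_def cong: conj_cong)
  ultimately show ?thesis
    using UU_map_hom[OF fin_upsets_partial_order[OF X F] fin_upsets_partial_order[OF Y fF]] by metis
qed

lemma UU_fin_map_restrict:
  assumes F: "F \<in> fin_upsets X" and G: "G \<in> fin_upsets X" "G \<subseteq> F"
    and V: "V \<in> upsets (Y\<lparr>carrier := f ` F\<rparr>)"
  shows "UU_fin_map G (V \<inter> f ` G) = UU_fin_map F V \<inter> G"
proof -
  have "V \<inter> f ` G \<in> upsets (Y\<lparr>carrier := f ` G\<rparr>)"
    using hom_UU_upset[OF U_pro_obj_restriction_hom[OF Y fin_upsets_image[OF F]
        fin_upsets_image[OF G(1)] image_mono[OF G(2)]]] V
    by simp
  then show ?thesis using V G(2) by (auto simp: UU_map_eq)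
qed

lemma U_pro_map_mem:
  assumes F: "F \<in> fin_upsets X"
  shows "(f ` F, UU_fin_map F) \<in> U_pro_map X Y f F"
  using pro_class_self[OF U_pro_obj_pro_object[OF Y], of "f ` F" "UU_fin_map F"
      "UU (X\<lparr>carrier := F\<rparr>)"]
    fin_upsets_image[OF F] UU_fin_map_hom[OF F] F
  by (simp add: U_pro_map_def)

lemma U_pro_map_hom: "U_pro_map X Y f \<in> pro_hom (U_pro_obj Y) (U_pro_obj X)"
proof (rule pro_homI[OF U_pro_obj_pro_object[OF Y] U_pro_obj_pro_object[OF X]])
  note pX = U_pro_obj_pro_object[OF X] and pY = U_pro_obj_pro_object[OF Y]
  show "U_pro_map X Y f \<in> extensional (Obj (idx (U_pro_obj X)))" by (simp add: U_pro_map_def)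
  fix F assume "F \<in> Obj (idx (U_pro_obj X))"
  then have F: "F \<in> fin_upsets X" by simp
  show "U_pro_map X Y f F \<in> pro_colim (U_pro_obj Y) (pob (U_pro_obj X) F)"
    using pro_class_in_colim[OF pY, of "f ` F" "UU_fin_map F"] fin_upsets_image[OF F]
      UU_fin_map_hom[OF F] F
    by (simp add: U_pro_map_def)
  fix G v H e assume "G \<in> Obj (idx (U_pro_obj X))"
    and v: "v \<in> Arr (idx (U_pro_obj X)) F G" and e: "(H, e) \<in> U_pro_map X Y f F"
  then have G: "G \<in> fin_upsets X" "G \<subseteq> F" by (auto split: if_splits)
  let ?B = "pob (U_pro_obj X) G" and ?r = "fmap (dia (U_pro_obj X)) F G v"
  let ?fF = "pob (U_pro_obj Y) (f ` F)" and ?s = "fmap (dia (U_pro_obj Y)) (f ` F) (f ` G) ()"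
  have "compose (carrier ?fF) (UU_fin_map G) ?s = compose (carrier ?fF) ?r (UU_fin_map F)"
    using UU_fin_map_restrict[OF F G] hom_UU_upset[OF UU_fin_map_hom[OF F]]
    by (intro compose_cong) simp
  moreover have "((f ` F, compose (carrier ?fF) (UU_fin_map G) ?s), (f ` G, UU_fin_map G))
      \<in> pro_rel (U_pro_obj Y) ?B"
    by (rule pro_rel_transition[OF pY])
      (use fin_upsets_image[OF F] fin_upsets_image[OF G(1)] UU_fin_map_hom[OF G(1)]
          image_mono[OF G(2)] in simp_all)
  moreover have "((f ` F, compose (carrier ?fF) ?r (UU_fin_map F)),
        (H, compose (carrier (pob (U_pro_obj Y) H)) ?r e))
      \<in> pro_rel (U_pro_obj Y) ?B"
  proof (rule pro_rel_compose[OF pY])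
    show "((f ` F, UU_fin_map F), (H, e)) \<in> pro_rel (U_pro_obj Y) (pob (U_pro_obj X) F)"
      using e F by (simp add: U_pro_map_def)
    show "?r \<in> ha_hom (pob (U_pro_obj X) F) ?B" using pro_map_hom[OF pX _ _ v] F G(1) by simp
  qed
  ultimately have "((f ` G, UU_fin_map G), (H, compose (carrier (pob (U_pro_obj Y) H)) ?r e))
      \<in> pro_rel (U_pro_obj Y) ?B"
    using pro_rel_trans[OF pY pro_rel_sym[OF pY]] by metis
  then show "(H, compose (carrier (pob (U_pro_obj Y) H)) ?r e) \<in> U_pro_map X Y f G"
    using G(1) by (simp add: U_pro_map_def)
qed

end

lemma U_pro_map_id:
  assumes X: "partial_order X"
  shows "U_pro_map X X (\<lambda>x\<in>carrier X. x) = pro_id (U_pro_obj X)"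
proof (rule pro_hom_eqI[OF _ _ U_pro_map_hom[OF X X open_maps_id[OF X]] pro_id_hom])
  fix F assume "F \<in> Obj (idx (U_pro_obj X))"
  then have F: "F \<in> fin_upsets X" by simp
  note FX = fin_upsetsD(3)[OF F]
  have "(\<lambda>x\<in>carrier X. x) ` F = F" using FX by force
  moreover have "UU_map (X\<lparr>carrier := F\<rparr>) (X\<lparr>carrier := F\<rparr>) (\<lambda>x\<in>carrier X. x) =
      (\<lambda>V\<in>upsets (X\<lparr>carrier := F\<rparr>). V)"
    using FX by (auto simp: UU_map_def fun_eq_iff upsets_def)
  ultimately have "(F, \<lambda>V\<in>upsets (X\<lparr>carrier := F\<rparr>). V) \<in> U_pro_map X X (\<lambda>x\<in>carrier X. x) F"
    using U_pro_map_mem[OF X X open_maps_id[OF X] F] by simp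
  moreover have "(F, \<lambda>V\<in>upsets (X\<lparr>carrier := F\<rparr>). V) \<in> pro_id (U_pro_obj X) F"
    using pro_id_mem[OF U_pro_obj_pro_object[OF X], of F] F by simp
  ultimately show "U_pro_map X X (\<lambda>x\<in>carrier X. x) F \<inter> pro_id (U_pro_obj X) F \<noteq> {}" by blast
qed (use U_pro_obj_pro_object[OF X] in simp_all)

lemma U_pro_map_compose:
  assumes X: "partial_order X" and Y: "partial_order Y" and Z: "partial_order Z"
    and f: "f \<in> open_maps X Y" and g: "g \<in> open_maps Y Z"
  shows "U_pro_map X Z (compose (carrier X) g f) =
    pro_comp (U_pro_obj Z) (U_pro_obj Y) (U_pro_obj X) (U_pro_map X Y f) (U_pro_map Y Z g)"
    (is "?gf = ?comp")
proof -
  note pro_obj = X[THEN U_pro_obj_pro_object] Y[THEN U_pro_obj_pro_object]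
    Z[THEN U_pro_obj_pro_object]
  note f_hom = U_pro_map_hom[OF X Y f] and g_hom = U_pro_map_hom[OF Y Z g]
    and gf_hom = U_pro_map_hom[OF X Z open_maps_compose[OF f g]]
  show ?thesis
  proof (rule pro_hom_eqI[OF pro_obj(3,1) gf_hom pro_comp_hom[OF pro_obj(3,2,1) g_hom f_hom]])
    fix F assume F_obj: "F \<in> Obj (idx (U_pro_obj X))"
    then have F: "F \<in> fin_upsets X" by simp
    note fF = fin_upsets_image[OF X Y f F] and FX = fin_upsetsD(3)[OF F]
    let ?X = "X\<lparr>carrier := F\<rparr>" and ?Y = "Y\<lparr>carrier := f ` F\<rparr>" and ?Z = "Z\<lparr>carrier := g ` f ` F\<rparr>"
    have "compose (carrier X) g f ` F = g ` f ` F" using FX by (force simp: compose_def)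
    then have "(g ` f ` F, UU_map ?X ?Z (compose (carrier X) g f)) \<in> ?gf F"
      using U_pro_map_mem[OF X Z open_maps_compose[OF f g] F] by simp
    moreover have "UU_map ?X ?Z (compose (carrier X) g f) =
        compose (upsets ?Z) (UU_map ?X ?Y f) (UU_map ?Y ?Z g)"
    proof (rule extensionalityI)
      fix V assume V: "V \<in> upsets ?Z"
      then have "UU_map ?Y ?Z g V \<in> upsets ?Y"
        using hom_UU_upset[OF UU_fin_map_hom[OF Y Z g fF]] by simp
      then show "UU_map ?X ?Z (compose (carrier X) g f) V =
          compose (upsets ?Z) (UU_map ?X ?Y f) (UU_map ?Y ?Z g) V"
        using V FX by (auto simp: compose_def UU_map_eq)
    qed (simp_all add: UU_map_def)
    moreover have "(g ` f ` F, compose (upsets ?Z) (UU_map ?X ?Y f) (UU_map ?Y ?Z g)) \<in> ?comp F"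
      using pro_comp_mem[OF pro_obj(3,2,1) g_hom f_hom F_obj U_pro_map_mem[OF X Y f F]
          U_pro_map_mem[OF Y Z g fF]] by simp
    ultimately show "?gf F \<inter> ?comp F \<noteq> {}" by auto
  qed
qed

lemma U_pro_functor_functor: "is_functor IKp_cat (op_cat Pro_cat) U_pro_functor"
  by (simp add: is_functor_def U_pro_functor_def IKp_Obj U_pro_obj_pro_object U_pro_map_hom
      U_pro_map_id U_pro_map_compose)

lemma is_functor_comp: "is_functor C D F \<Longrightarrow> is_functor D E G \<Longrightarrow> is_functor C E (comp_functr G F)"
  by (simp add: is_functor_def comp_functr_def)

lemma is_functor_op: "is_functor (op_cat C) (op_cat D) F \<Longrightarrow> is_functor C D (op_functr F)"
  by (simp add: is_functor_def op_functr_def)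

section \<open>Profinite completion\<close>

context spectrum
begin

abbreviation (input) completion_map :: "'a \<Rightarrow> 'x set \<Rightarrow> 'x set" where
  "completion_map \<equiv> compose (carrier A) (U_pro_lim_iso X) \<epsilon>"

lemmas pro_object = U_pro_obj_pro_object[OF poset]

lemma completion_map_eq: "a \<in> carrier A \<Longrightarrow> completion_map a = (\<lambda>F\<in>fin_upsets X. \<epsilon> a \<inter> F)"
  using upset by (simp add: compose_eq U_pro_lim_iso_def)

lemma restriction_hom:
  assumes F: "F \<in> fin_upsets X"
  shows "(\<lambda>a\<in>carrier A. \<epsilon> a \<inter> F) \<in> ha_hom A (UU (X\<lparr>carrier := F\<rparr>))"
proof -
  have "compose (carrier A) (\<lambda>V\<in>upsets X. V \<inter> F) \<epsilon> = (\<lambda>a\<in>carrier A. \<epsilon> a \<inter> F)"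
    using upset by (simp add: compose_def cong: restrict_cong)
  then show ?thesis
    using ha_hom_compose[OF heyting hom UU_restriction_hom[OF poset fin_upsetsD(1)[OF F]]] by simp
qed

lemma completion_map_hom: "completion_map \<in> ha_hom A (pro_lim (U_pro_obj X))"
proof (rule pro_lim_homI[OF pro_object heyting])
  have "(\<lambda>F\<in>Obj (idx (U_pro_obj X)). \<epsilon> a \<inter> F) \<in> carrier (pro_lim (U_pro_obj X))"
    if a: "a \<in> carrier A" for a
  proof (rule pro_lim_restrictI[OF pro_object])
    fix F assume F: "F \<in> Obj (idx (U_pro_obj X))"
    then show closed: "\<epsilon> a \<inter> F \<in> carrier (pob (U_pro_obj X) F)"
      using upsets_restrict[OF upset[OF a] fin_upsetsD(3)] by simp
    show "fmap (dia (U_pro_obj X)) F G u (\<epsilon> a \<inter> F) = \<epsilon> a \<inter> G"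
      if "u \<in> Arr (idx (U_pro_obj X)) F G" for G u
      using closed that by (auto split: if_splits)
  qed
  then show "completion_map \<in> carrier A \<rightarrow>\<^sub>E carrier (pro_lim (U_pro_obj X))"
    using completion_map_eq by (simp add: PiE_iff)
  fix F assume F: "F \<in> Obj (idx (U_pro_obj X))"
  then have "(\<lambda>a\<in>carrier A. completion_map a F) = (\<lambda>a\<in>carrier A. \<epsilon> a \<inter> F)"
    using completion_map_eq by (simp cong: restrict_cong)
  then show "(\<lambda>a\<in>carrier A. completion_map a F) \<in> ha_hom A (pob (U_pro_obj X) F)"
    using restriction_hom F by simp
qed

text \<open>Two factorizations through \<open>F\<close> and \<open>G\<close> agree on \<open>F \<union> G\<close>, since \<open>A \<rightarrow> U (F \<union> G)\<close> is onto.\<close>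

lemma factorizations_related:
  assumes F: "F \<in> fin_upsets X" and f: "f \<in> ha_hom (UU (X\<lparr>carrier := F\<rparr>)) B"
    and G: "G \<in> fin_upsets X" and g: "g \<in> ha_hom (UU (X\<lparr>carrier := G\<rparr>)) B"
    and eq: "\<And>a. a \<in> carrier A \<Longrightarrow> f (\<epsilon> a \<inter> F) = g (\<epsilon> a \<inter> G)"
  shows "((F, f), (G, g)) \<in> pro_rel (U_pro_obj X) B"
proof (rule pro_relI[OF pro_object, where k = "F \<union> G"])
  fix V assume "V \<in> carrier (pob (U_pro_obj X) (F \<union> G))"
  then have V: "V \<in> upsets (X\<lparr>carrier := F \<union> G\<rparr>)" by simp
  then obtain a where a: "a \<in> carrier A" "\<epsilon> a \<inter> (F \<union> G) = V"
    using restriction_surj[OF fin_upsets_Un[OF F G]] by blast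
  have "V \<inter> F = \<epsilon> a \<inter> F" "V \<inter> G = \<epsilon> a \<inter> G" using a(2) by blast+
  then show "f (fmap (dia (U_pro_obj X)) (F \<union> G) F () V) =
      g (fmap (dia (U_pro_obj X)) (F \<union> G) G () V)"
    using V eq[OF a(1)] by simp
qed (use F G f g fin_upsets_Un[OF F G] in simp_all)

lemma hom_factors_through_restriction:
  assumes F: "F \<in> fin_upsets X" and g: "g \<in> ha_hom A B"
    and ker: "\<And>a b. a \<in> carrier A \<Longrightarrow> b \<in> carrier A \<Longrightarrow> \<epsilon> a \<inter> F = \<epsilon> b \<inter> F \<Longrightarrow> g a = g b"
  shows "\<exists>f\<in>ha_hom (UU (X\<lparr>carrier := F\<rparr>)) B. \<forall>a\<in>carrier A. f (\<epsilon> a \<inter> F) = g a"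
proof -
  let ?U = "upsets (X\<lparr>carrier := F\<rparr>)" and ?r = "\<lambda>a\<in>carrier A. \<epsilon> a \<inter> F"
  have "\<exists>b. \<forall>a\<in>carrier A. \<epsilon> a \<inter> F = V \<longrightarrow> g a = b" for V using ker by metis
  then obtain f' where f': "\<And>V a. a \<in> carrier A \<Longrightarrow> \<epsilon> a \<inter> F = V \<Longrightarrow> f' V = g a" by metis
  let ?f = "restrict f' ?U"
  have f_r: "?f (\<epsilon> a \<inter> F) = g a" if "a \<in> carrier A" for a
    using f'[OF that refl] hom_UU_upset[OF restriction_hom[OF F] that] that by simp
  have "?f \<in> ha_hom (UU (X\<lparr>carrier := F\<rparr>)) B"
  proof (rule ha_hom_factor_surj[OF heyting restriction_hom[OF F]])
    show "?r ` carrier A = carrier (UU (X\<lparr>carrier := F\<rparr>))"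
      using restriction_surj[OF F] hom_UU_upset[OF restriction_hom[OF F]] by (auto simp: image_iff)
    have "compose (carrier A) ?f ?r = g"
      by (rule extensionalityI[OF _ ha_hom_extensional[OF g]])
        (use f_r in \<open>simp_all add: compose_eq\<close>)
    then show "compose (carrier A) ?f ?r \<in> ha_hom A B" using g by simp
  qed simp
  then show ?thesis using f_r by blast
qed

text \<open>
  A finite \<open>B\<close> embeds into \<open>U P\<close> for a finite poset \<open>P\<close>; by universality \<open>A \<rightarrow> B \<rightarrow> U P\<close> comes from an
  open map \<open>P \<rightarrow> X\<close>, whose image is the finite up-set through which \<open>A \<rightarrow> B\<close> factors.
\<close>

lemma finite_hom_factors:
  fixes B :: "'k gorder"
  assumes B: "heyting_algebra B" "finite (carrier B)" and g: "g \<in> ha_hom A B"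
  shows "\<exists>F\<in>fin_upsets X. \<exists>f\<in>ha_hom (UU (X\<lparr>carrier := F\<rparr>)) B. \<forall>a\<in>carrier A. f (\<epsilon> a \<inter> F) = g a"
proof -
  let ?P = "join_prime_poset B" and ?j = "join_prime_hom B"
  have "compose (carrier A) ?j g \<in> ha_hom A (UU ?P)"
    by (rule ha_hom_compose[OF heyting g join_prime_hom_hom[OF B]])
  then obtain k where k: "k \<in> open_maps ?P X"
    and jg: "compose (carrier A) ?j g = compose (carrier A) (UU_map ?P X k) \<epsilon>"
    using bij_betw_imp_surj_on[OF universal[OF join_prime_poset_IKp[OF B]]]
    by (metis (no_types, lifting) imageE)
  define F where "F = k ` carrier ?P"
  have F: "F \<in> fin_upsets X"
    using image_upset[OF k carrier_upset] join_primes_finite[OF B]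
    by (simp add: F_def fin_upsets_def)
  have j_g: "?j (g a) = {p \<in> carrier ?P. k p \<in> \<epsilon> a \<inter> F}" if a: "a \<in> carrier A" for a
    using fun_cong[OF jg, of a] a by (auto simp: compose_eq UU_map_eq[OF upset[OF a]] F_def)
  have "g a = g b" if "a \<in> carrier A" "b \<in> carrier A" "\<epsilon> a \<inter> F = \<epsilon> b \<inter> F" for a b
    using inj_onD[OF join_prime_hom_inj[OF B]] j_g[OF that(1)] j_g[OF that(2)] that
      ha_hom_closed[OF g] by metis
  then show ?thesis using hom_factors_through_restriction[OF F g] F by blast
qed

theorem completion_pro_representation: "pro_representation TYPE('k) A (U_pro_obj X) completion_map"
proof
  show "heyting_algebra A" "pro_object (U_pro_obj X)"
    "completion_map \<in> ha_hom A (pro_lim (U_pro_obj X))"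
    by (rule heyting pro_object completion_map_hom)+
  fix B :: "'k gorder" and g assume B: "heyting_algebra B" "finite (carrier B)"
    and g: "g \<in> ha_hom A B"
  have mem_iff: "(F, f) \<in> factorizations A (U_pro_obj X) completion_map B g \<longleftrightarrow>
      F \<in> fin_upsets X \<and> f \<in> ha_hom (UU (X\<lparr>carrier := F\<rparr>)) B \<and>
        (\<forall>a\<in>carrier A. f (\<epsilon> a \<inter> F) = g a)" for F f
    using completion_map_eq by (auto simp: factorizations_iff)
  obtain F f
    where "F \<in> fin_upsets X" "f \<in> ha_hom (UU (X\<lparr>carrier := F\<rparr>)) B" "\<forall>a\<in>carrier A. f (\<epsilon> a \<inter> F) = g a"
    using finite_hom_factors[OF B g] by blast
  then have "(F, f) \<in> factorizations A (U_pro_obj X) completion_map B g" by (simp add: mem_iff)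
  then show "factorizations A (U_pro_obj X) completion_map B g \<in> pro_colim (U_pro_obj X) B"
    by (rule factorizations_in_colimI[OF pro_object completion_map_hom])
      (simp add: mem_iff factorizations_related)
qed

end

lemma completion_map_natural:
  assumes A: "spectrum A X \<epsilon>" and B: "spectrum B Y \<delta>" and h: "h \<in> ha_hom A B"
    and f: "f \<in> open_maps Y X"
    and natural: "compose (carrier A) \<delta> h = compose (carrier A) (UU_map Y X f) \<epsilon>"
  shows "compose (carrier A) (compose (carrier B) (U_pro_lim_iso Y) \<delta>) h =
    pro_postcompose A (U_pro_obj X) (U_pro_obj Y) (compose (carrier A) (U_pro_lim_iso X) \<epsilon>)
      (U_pro_map Y X f)"
proof (rule compose_cong)
  interpret A: spectrum A X \<epsilon> by (rule A)
  interpret B: spectrum B Y \<delta> by (rule B)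
  note f_hom = U_pro_map_hom[OF B.poset A.poset f]
  fix a assume a: "a \<in> carrier A"
  have ha: "h a \<in> carrier B" by (rule ha_hom_closed[OF h a])
  note completion_a = ha_hom_closed[OF A.completion_map_hom a]
  show "B.completion_map (h a) =
      pro_lim_map (U_pro_obj X) (U_pro_obj Y) (U_pro_map Y X f) (A.completion_map a)"
  proof (rule pro_lim_eqI[OF B.pro_object ha_hom_closed[OF B.completion_map_hom ha]
        pro_lim_map_closed[OF A.pro_object B.pro_object f_hom completion_a]])
    fix F assume F_obj: "F \<in> Obj (idx (U_pro_obj Y))"
    then have F: "F \<in> fin_upsets Y" by simp
    note fF = fin_upsets_image[OF B.poset A.poset f F]
    have "\<delta> (h a) = UU_map Y X f (\<epsilon> a)" using fun_cong[OF natural, of a] a by (simp add: compose_eq)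
    then have "\<delta> (h a) \<inter> F = {x \<in> F. f x \<in> \<epsilon> a \<inter> f ` F}"
      using fin_upsetsD(3)[OF F] by (auto simp: UU_map_eq[OF A.upset[OF a]])
    also have "\<dots> = UU_map (Y\<lparr>carrier := F\<rparr>) (X\<lparr>carrier := f ` F\<rparr>) f (\<epsilon> a \<inter> f ` F)"
      by (simp add: UU_map_eq[OF upsets_restrict[OF A.upset[OF a] fin_upsetsD(3)[OF fF]]])
    finally show "B.completion_map (h a) F =
        pro_lim_map (U_pro_obj X) (U_pro_obj Y) (U_pro_map Y X f) (A.completion_map a) F"
      unfolding pro_lim_map_eval[OF A.pro_object B.pro_object f_hom completion_a F_obj
          U_pro_map_mem[OF B.poset A.poset f F]]
      using F fF by (simp add: A.completion_map_eq[OF a] B.completion_map_eq[OF ha])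
  qed
qed

lemma completion_functor_simps:
  "fobj (op_functr (comp_functr U_pro_functor S)) A = U_pro_obj (fobj S A)"
  "fmap (op_functr (comp_functr U_pro_functor S)) A B h =
      U_pro_map (fobj S B) (fobj S A) (fmap S B A h)"
  by (simp_all add: op_functr_def comp_functr_def U_pro_functor_def)

theorem (in spec_factorization) profinite_completion:
  "profinite_completion (op_functr (comp_functr U_pro_functor S))
     (\<lambda>A. compose (carrier A) (U_pro_lim_iso (fobj S A)) (counit A)) TYPE(('j, 'n, 'k) pro)"
proof -
  have "is_functor HA_cat Pro_cat (op_functr (comp_functr U_pro_functor S))"
    by (rule is_functor_op[OF is_functor_comp[OF S_functor U_pro_functor_functor]])
  then show ?thesis
    unfolding profinite_completion_def completion_functor_simps
    using completion_map_natural[OF counit_spectrum counit_spectrum _ S_open counit_natural]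
    by (simp add: HA_Obj forget_functor_functor spectrum.completion_map_hom[OF counit_spectrum]
        pro_representation.universal[OF spectrum.completion_pro_representation[OF counit_spectrum]])
qed

theorem theorem4p13:
  shows
    "is_functor (op_cat HA_cat) Sh_cat
       (Spec_bar :: ('a gorder, 'a \<Rightarrow> 'a, ('a \<Rightarrow> nat set) psh,
                     nat gorder \<Rightarrow> ('a \<Rightarrow> nat set) \<Rightarrow> ('a \<Rightarrow> nat set)) functr) \<and>
     (\<exists>(S :: ('a gorder, 'a \<Rightarrow> 'a, 'a set gorder, 'a set \<Rightarrow> 'a set) functr) \<alpha>.
        IKp_factorization S \<alpha>) \<and>
     (\<forall>(S :: ('a gorder, 'a \<Rightarrow> 'a, 's gorder, 's \<Rightarrow> 's) functr) \<alpha>. IKp_factorization S \<alpha> \<longrightarrow>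
        (\<exists>\<epsilon>. right_adjoint_to_U S \<epsilon> TYPE('s gorder) \<and>
             right_adjoint_to_U S \<epsilon> TYPE('x gorder) \<and>
             profinite_completion (op_functr (comp_functr U_pro_functor S))
               (\<lambda>A. compose (carrier A) (U_pro_lim_iso (fobj S A)) (\<epsilon> A))
               TYPE(('j, 'n, 'k) pro) \<and>
             (\<forall>(L :: ('a gorder, 'a \<Rightarrow> 'a, ('i, 'm, 'h) pro, 'i \<Rightarrow> ('i \<times> ('h \<Rightarrow> 'h)) set) functr) \<eta>.
                profinite_completion L \<eta> TYPE(('i, 'm, 'h) pro) \<and>
                profinite_completion L \<eta> TYPE(('s set, unit, 's set) pro) \<longrightarrow>
                (\<exists>\<theta>. pro_nat_iso L (op_functr (comp_functr U_pro_functor S)) \<theta> \<and>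
                     (\<forall>A\<in>Obj HA_cat.
                        compose (carrier A)
                          (pro_lim_map (fobj L A) (U_pro_obj (fobj S A)) (\<theta> A)) (\<eta> A) =
                        compose (carrier A) (U_pro_lim_iso (fobj S A)) (\<epsilon> A))))))"
proof (intro conjI allI impI, goal_cases sheaf factorization adjoint)
  case sheaf
  show ?case by (rule Spec_bar_functor)
next
  case factorization
  show ?case using Spec_functor_factorization by blast
next
  case (adjoint S \<alpha>)
  then interpret spec_factorization S \<alpha> by unfold_locales
  let ?M = "op_functr (comp_functr U_pro_functor S)"
  let ?\<zeta> = "\<lambda>A. compose (carrier A) (U_pro_lim_iso (fobj S A)) (counit A)"
  have unique: "\<exists>\<theta>. pro_nat_iso L ?M \<theta> \<and>
      (\<forall>A\<in>Obj HA_cat. pro_postcompose A (fobj L A) (U_pro_obj (fobj S A)) (\<eta> A) (\<theta> A) = ?\<zeta> A)"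
    if "profinite_completion L \<eta> TYPE(('i, 'm, 'h) pro)"
      "profinite_completion L \<eta> TYPE(('s set, unit, 's set) pro)"
    for L :: "('a gorder, 'a \<Rightarrow> 'a, ('i, 'm, 'h) pro, 'i \<Rightarrow> ('i \<times> ('h \<Rightarrow> 'h)) set) functr" and \<eta>
    by (rule profinite_completion_unique[OF that profinite_completion profinite_completion])
      (auto simp: completion_functor_simps)
  show ?case
    by (intro exI[of _ counit] conjI allI impI right_adjoint profinite_completion unique) auto
qed

end
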